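(* Let $2p\in\{2,4\}$ and let $U$ be the smooth solution of the Cauchy problem $$U_{tt}=U_{xx}+F,\quad x\in(-\infty,\infty),\ t\ge0,\qquad U(x,0)=f^1(x),\ U_t(x,0)=f^2(x),\qquad \|U(\cdot,t)\|_{L_2}<\infty,$$ with $F,f^1,f^2$ compatible smooth functions with compact support. Consider the SBP-SAT semi-discretization with a grid interface at $x=0$, with mesh sizes $h_L$ (left) and $h_R$ (right), $h=h_L=rh_R$ with $r>0$ fixed: $$u^L_{tt}=D_Lu^L+\tfrac12H_L^{-1}S_L^Te_{0L}\{u\}-\tfrac12H_L^{-1}e_{0L}\{Su\}-\tau_LH_L^{-1}e_{0L}\{u\}+F_{gL},$$ $$u^R_{tt}=D_Ru^R+\tfrac12H_R^{-1}S_R^Te_{0R}\{u\}-\tfrac12H_R^{-1}e_{0R}\{Su\}-\tau_RH_R^{-1}e_{0R}\{u\}+F_{gR},$$ with exact initial data on the grid, $\tau:=\tau_L=-\tau_R$, and suppose the scheme is stable, i.e. $\tau\ge\tilde\tau_{2p}:=\dfrac{h_L+h_R}{4\alpha_{2p}h_Lh_R}$, where $\tau=\lambda\tilde\tau_{2p}$ with $\lambda\ge1$ independent of $h$. Then the numerical solution converges to the true solution at rate $q$: for every final time $t_f$ there is a constant $C$ independent of $h$ such that for all sufficiently small $h$ $$\sqrt{\int_0^{t_f}\left(\|\xi^L(t)\|_{h_L}^2+\|\xi^R(t)\|_{h_R}^2\right)dt}\le Ch^q,\qquad \xi^L_{-j}=U(x_{-j},t)-u^L_{-j}(t),\ \ \xi^R_j=U(x_j,t)-u^R_j(t),$$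 where - $2p=2$: $q=2$ if $\tau>\tilde\tau_2$, and $q=1.5$ if $\tau=\tilde\tau_2$; - $2p=4$: $q=4$ if $\tau>\tilde\tau_4$, and $q=2.5$ if $\tau=\tilde\tau_4$.
   Context: Grids: $x_{-j}=-jh_L$ and $x_j=jh_R$, $j=0,1,2,\dots$ (the point $x=0$ belongs to both grids). Grid functions $u^L=[\dots,u^L_{-1},u^L_0]^T$, $u^L_{-j}(t)\approx U(x_{-j},t)$, and $u^R=[u^R_0,u^R_1,\dots]^T$, $u^R_j(t)\approx U(x_j,t)$. $e_{0L}=[\dots,0,0,1]^T$, $e_{0R}=[1,0,0,\dots]^T$. $\{u\}=u^L_0-u^R_0$, $\{Su\}=(S_Lu^L)_0-(S_Ru^R)_0$, where $(S_Lu^L)_0=e_{0L}^TS_Lu^L$ and $(S_Ru^R)_0=e_{0R}^TS_Ru^R$ both approximate $U_x(0,t)$. $F_{gL},F_{gR}$ are the grid functions of $F$. $\|v\|_{h_L}^2=h_L\sum_{j\ge0}|v_{-j}|^2$ and $\|v\|_{h_R}^2=h_R\sum_{j\ge0}|v_j|^2$. SBP operators on the half-line grid $x_j=jh$, $j\ge0$ (diagonal norm, order $2p$): $D=H^{-1}(-A+BS)$ with $H$ diagonal positive definite, $A$ symmetric positive semi-definite, $B=\mathrm{diag}(-1,0,0,\dots)$; only the first row of $S$ matters. Rows and columns are numbered from $0$; unlisted entries of a listed row are zero; $D_+v_j=(v_{j+1}-v_j)/h$, $D_-v_j=(v_j-v_{j-1})/h$. $2p=2$: $H=h\,\mathrm{diag}(\tfrac12,1,1,\dots)$;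 first row of $S$: $\frac1h(-\tfrac32,2,-\tfrac12)$; row $0$ of $h^2D$: $(1,-2,1)$; $(Dv)_j=D_+D_-v_j$ for $j\ge1$. $2p=4$: $H=h\,\mathrm{diag}(\tfrac{17}{48},\tfrac{59}{48},\tfrac{43}{48},\tfrac{49}{48},1,1,\dots)$; first row of $S$: $\frac1h(-\tfrac{11}{6},3,-\tfrac32,\tfrac13)$; rows $0$–$3$ of $h^2D$: $(2,-5,4,-1)$; $(1,-2,1)$; $(-\tfrac4{43},\tfrac{59}{43},-\tfrac{110}{43},\tfrac{59}{43},-\tfrac4{43})$; $(-\tfrac1{49},0,\tfrac{59}{49},-\tfrac{118}{49},\tfrac{64}{49},-\tfrac4{49})$; $(Dv)_j=(D_+D_--\tfrac{h^2}{12}(D_+D_-)^2)v_j$ for $j\ge4$. $D_R,H_R,S_R$ are these operators with $h=h_R$. $D_L,H_L,S_L$ are their mirror images under $x\mapsto-x$ with $h=h_L$ (index $j$ replaced by $-j$), where the row of $S_L$ at $x=0$ also changes sign, so that it approximates $+\partial_x$; e.g. for $2p=2$, $(S_Lu^L)_0=\frac1{h_L}(\tfrac32u^L_0-2u^L_{-1}+\tfrac12u^L_{-2})$. $\alpha_{2p}>0$ is the largest number such that $A-h\alpha_{2p}(E_0S)^T(E_0S)$ is positive semi-definite, where $E_0=e_0e_0^T$, $e_0=[1,0,0,\dots]^T$; $\alpha_2=0.4$, $\alpha_4\approx0.2508560249$. *)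

theory Defs
  imports "HOL-Analysis.Analysis" "HOL-Library.More_List"
begin

section \<open>The Cauchy problem\<close>

definition smooth :: "(real \<Rightarrow> real) \<Rightarrow> bool" where
  "smooth f \<longleftrightarrow> (\<forall>k x. ((deriv ^^ k) f) field_differentiable (at x))"

text \<open>
  \<open>Ck_halfplane k f\<close>: the function \<open>f x t\<close> is of class \<open>C\<^sup>k\<close> on the closed half-plane \<open>t \<ge> 0\<close>.
  At \<open>t = 0\<close> the time derivative is the one-sided one; values at \<open>t < 0\<close> are irrelevant.
\<close>

primrec Ck_halfplane :: "nat \<Rightarrow> (real \<Rightarrow> real \<Rightarrow> real) \<Rightarrow> bool" where
  "Ck_halfplane 0 f \<longleftrightarrow> continuous_on (UNIV \<times> {0..}) (\<lambda>(x, t). f x t)"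
| "Ck_halfplane (Suc k) f \<longleftrightarrow>
     continuous_on (UNIV \<times> {0..}) (\<lambda>(x, t). f x t) \<and>
     (\<exists>fx ft.
        (\<forall>x. \<forall>t\<ge>0. ((\<lambda>y. f y t) has_real_derivative fx x t) (at x)) \<and>
        (\<forall>x. \<forall>t\<ge>0. ((\<lambda>s. f x s) has_real_derivative ft x t) (at t within {0..})) \<and>
        Ck_halfplane k fx \<and> Ck_halfplane k ft)"

definition smooth_halfplane :: "(real \<Rightarrow> real \<Rightarrow> real) \<Rightarrow> bool" where
  "smooth_halfplane f \<longleftrightarrow> (\<forall>k. Ck_halfplane k f)"

definition compact_support :: "(real \<Rightarrow> real) \<Rightarrow> bool" where
  "compact_support f \<longleftrightarrow> compact (closure {x. f x \<noteq> 0})"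

text \<open>
  For the forcing, compactness of the support is only required on each bounded time interval.
  Every \<open>F\<close> whose support in the half-plane \<open>t \<ge> 0\<close> is compact satisfies this.
\<close>

definition compact_support_in_space :: "(real \<Rightarrow> real \<Rightarrow> real) \<Rightarrow> bool" where
  "compact_support_in_space F \<longleftrightarrow> (\<forall>T\<ge>0. compact (closure {x. \<exists>t\<in>{0..T}. F x t \<noteq> 0}))"

definition cauchy_solution ::
  "(real \<Rightarrow> real \<Rightarrow> real) \<Rightarrow> (real \<Rightarrow> real) \<Rightarrow> (real \<Rightarrow> real) \<Rightarrow> (real \<Rightarrow> real \<Rightarrow> real) \<Rightarrow> bool" where
  "cauchy_solution F f1 f2 U \<longleftrightarrow>
     (\<exists>Ut Utt Ux Uxx.
        (\<forall>x. \<forall>t\<ge>0.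
           ((\<lambda>s. U x s) has_real_derivative Ut x t) (at t within {0..}) \<and>
           ((\<lambda>s. Ut x s) has_real_derivative Utt x t) (at t within {0..}) \<and>
           ((\<lambda>y. U y t) has_real_derivative Ux x t) (at x) \<and>
           ((\<lambda>y. Ux y t) has_real_derivative Uxx x t) (at x) \<and>
           Utt x t = Uxx x t + F x t) \<and>
        (\<forall>x. U x 0 = f1 x \<and> Ut x 0 = f2 x)) \<and>
     (\<forall>t\<ge>0. integrable lborel (\<lambda>x. (U x t)\<^sup>2))"

section \<open>SBP operators on a half-line grid\<close>

text \<open>
  A grid function on a half-line is a map \<open>v :: nat \<Rightarrow> real\<close>, with \<open>v 0\<close> the value at the interface
  \<open>x = 0\<close>. On the right grid \<open>v j\<close> lives at \<open>x\<^sub>j = j h\<^sub>R\<close>; on the left grid \<open>v j\<close> lives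
  at \<open>x\<^bsub>-j\<^esub> = -j h\<^sub>L\<close>. The argument \<open>ord\<close> is the order \<open>2p\<close>; only the values \<open>2\<close> and \<open>4\<close> are
  meaningful.
\<close>

definition Dplus :: "real \<Rightarrow> (nat \<Rightarrow> real) \<Rightarrow> nat \<Rightarrow> real" where
  "Dplus h v j = (v (j + 1) - v j) / h"

text \<open>Only used at \<open>j \<ge> 1\<close>, where the truncated subtraction is harmless.\<close>

definition Dminus :: "real \<Rightarrow> (nat \<Rightarrow> real) \<Rightarrow> nat \<Rightarrow> real" where
  "Dminus h v j = (v j - v (j - 1)) / h"

definition apply_row :: "real list \<Rightarrow> (nat \<Rightarrow> real) \<Rightarrow> real" where
  "apply_row c v = (\<Sum>k<length c. c ! k * v k)"

definition sbp_H :: "nat \<Rightarrow> real \<Rightarrow> nat \<Rightarrow> real" where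
  "sbp_H ord h j = h * nth_default 1 (if ord = 2 then [1/2] else [17/48, 59/48, 43/48, 49/48]) j"

text \<open>First row of \<open>S\<close>, without the factor \<open>1/h\<close>.\<close>

definition S_row :: "nat \<Rightarrow> real list" where
  "S_row ord = (if ord = 2 then [-3/2, 2, -1/2] else [-11/6, 3, -3/2, 1/3])"

definition sbp_S0 :: "nat \<Rightarrow> real \<Rightarrow> (nat \<Rightarrow> real) \<Rightarrow> real" where
  "sbp_S0 ord h v = apply_row (S_row ord) v / h"

text \<open>The grid function \<open>S\<^sup>T e\<^sub>0\<close>, i.e. the first row of \<open>S\<close> as a column.\<close>

definition sbp_ST_e0 :: "nat \<Rightarrow> real \<Rightarrow> nat \<Rightarrow> real" where
  "sbp_ST_e0 ord h j = nth_default 0 (S_row ord) j / h"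

definition D_rows :: "nat \<Rightarrow> real list list" where
  "D_rows ord =
     (if ord = 2 then [[1, -2, 1]]
      else [[2, -5, 4, -1],
            [1, -2, 1],
            [-4/43, 59/43, -110/43, 59/43, -4/43],
            [-1/49, 0, 59/49, -118/49, 64/49, -4/49]])"

definition sbp_D :: "nat \<Rightarrow> real \<Rightarrow> (nat \<Rightarrow> real) \<Rightarrow> nat \<Rightarrow> real" where
  "sbp_D ord h v j =
     (if j < length (D_rows ord) then apply_row (D_rows ord ! j) v / h\<^sup>2
      else if ord = 2 then Dplus h (Dminus h v) j
      else Dplus h (Dminus h v) j
           - h\<^sup>2 / 12 * Dplus h (Dminus h (Dplus h (Dminus h v))) j)"

definition e0 :: "nat \<Rightarrow> real" where
  "e0 j = (if j = 0 then 1 else 0)"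

text \<open>
  \<open>A = B S - H D\<close> with \<open>B = diag(-1, 0, 0, \<dots>)\<close>, obtained by solving
  \<open>D = H\<^sup>-\<^sup>1 (-A + B S)\<close> for \<open>A\<close>.
\<close>

definition sbp_A :: "nat \<Rightarrow> real \<Rightarrow> (nat \<Rightarrow> real) \<Rightarrow> nat \<Rightarrow> real" where
  "sbp_A ord h v j = - e0 j * sbp_S0 ord h v - sbp_H ord h j * sbp_D ord h v j"

text \<open>
  \<open>\<alpha>\<^bsub>2p\<^esub>\<close>: the largest \<open>a\<close> such that \<open>A - h a (E\<^sub>0 S)\<^sup>T (E\<^sub>0 S)\<close> is positive semi-definite.
  The quadratic form is tested on finitely supported grid functions, and
  \<open>v\<^sup>T (E\<^sub>0 S)\<^sup>T (E\<^sub>0 S) v = ((S v)\<^sub>0)\<^sup>2\<close>.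
  By scaling, the condition on \<open>a\<close> is the same for every \<open>h > 0\<close>.
\<close>

definition sbp_alpha :: "nat \<Rightarrow> real" where
  "sbp_alpha ord =
     (GREATEST a. \<forall>h>0. \<forall>v. finite {j. v j \<noteq> 0} \<longrightarrow>
        (\<Sum>j | v j \<noteq> 0. v j * sbp_A ord h v j) - h * a * (sbp_S0 ord h v)\<^sup>2 \<ge> 0)"

section \<open>The interface scheme\<close>

definition tau_min :: "nat \<Rightarrow> real \<Rightarrow> real \<Rightarrow> real" where
  "tau_min ord hL hR = (hL + hR) / (4 * sbp_alpha ord * hL * hR)"

text \<open>
  Mirroring under \<open>x \<mapsto> -x\<close> is already built into the indexing of left grid functions, so \<open>D\<^sub>L\<close> and
  \<open>H\<^sub>L\<close> are \<^const>\<open>sbp_D\<close> and \<^const>\<open>sbp_H\<close> with \<open>h = h\<^sub>L\<close>, while the boundary row of \<open>S\<^sub>L\<close> is minus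
  the one of \<open>S\<close>.
\<close>

definition jump :: "(nat \<Rightarrow> real) \<Rightarrow> (nat \<Rightarrow> real) \<Rightarrow> real" where
  "jump vL vR = vL 0 - vR 0"

definition jump_S :: "nat \<Rightarrow> real \<Rightarrow> real \<Rightarrow> (nat \<Rightarrow> real) \<Rightarrow> (nat \<Rightarrow> real) \<Rightarrow> real" where
  "jump_S ord hL hR vL vR = (- sbp_S0 ord hL vL) - sbp_S0 ord hR vR"

definition rhs_L ::
  "nat \<Rightarrow> real \<Rightarrow> real \<Rightarrow> real \<Rightarrow> (nat \<Rightarrow> real) \<Rightarrow> (nat \<Rightarrow> real) \<Rightarrow> nat \<Rightarrow> real" where
  "rhs_L ord hL hR \<tau>L vL vR j =
     sbp_D ord hL vL j
     + 1/2 * inverse (sbp_H ord hL j) * (- sbp_ST_e0 ord hL j) * jump vL vR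
     - 1/2 * inverse (sbp_H ord hL j) * e0 j * jump_S ord hL hR vL vR
     - \<tau>L * inverse (sbp_H ord hL j) * e0 j * jump vL vR"

definition rhs_R ::
  "nat \<Rightarrow> real \<Rightarrow> real \<Rightarrow> real \<Rightarrow> (nat \<Rightarrow> real) \<Rightarrow> (nat \<Rightarrow> real) \<Rightarrow> nat \<Rightarrow> real" where
  "rhs_R ord hL hR \<tau>R vL vR j =
     sbp_D ord hR vR j
     + 1/2 * inverse (sbp_H ord hR j) * sbp_ST_e0 ord hR j * jump vL vR
     - 1/2 * inverse (sbp_H ord hR j) * e0 j * jump_S ord hL hR vL vR
     - \<tau>R * inverse (sbp_H ord hR j) * e0 j * jump vL vR"

definition grid_l2 :: "(nat \<Rightarrow> real) \<Rightarrow> bool" where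
  "grid_l2 v \<longleftrightarrow> summable (\<lambda>j. \<bar>v j\<bar>\<^sup>2)"

definition grid_norm :: "real \<Rightarrow> (nat \<Rightarrow> real) \<Rightarrow> real" where
  "grid_norm h v = sqrt (h * (\<Sum>j. \<bar>v j\<bar>\<^sup>2))"

text \<open>
  Solutions of the semi-discrete (infinite) ODE system with exact initial data, at grid functions of
  finite norm, locally boundedly in time. Without the norm condition, solutions of the infinite system
  would not be determined by the initial data.
\<close>

definition scheme_solution ::
  "nat \<Rightarrow> real \<Rightarrow> real \<Rightarrow> real \<Rightarrow> real \<Rightarrow>
   (real \<Rightarrow> real \<Rightarrow> real) \<Rightarrow> (real \<Rightarrow> real) \<Rightarrow> (real \<Rightarrow> real) \<Rightarrow>
   (real \<Rightarrow> nat \<Rightarrow> real) \<Rightarrow> (real \<Rightarrow> nat \<Rightarrow> real) \<Rightarrow> bool" where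
  "scheme_solution ord hL hR \<tau>L \<tau>R F f1 f2 uL uR \<longleftrightarrow>
     (\<forall>T\<ge>0. \<exists>K. \<forall>t\<in>{0..T}.
        grid_l2 (uL t) \<and> grid_norm hL (uL t) \<le> K \<and> grid_l2 (uR t) \<and> grid_norm hR (uR t) \<le> K) \<and>
     (\<exists>uLt uRt.
        (\<forall>t\<ge>0. \<forall>j.
           ((\<lambda>s. uL s j) has_real_derivative uLt t j) (at t within {0..}) \<and>
           ((\<lambda>s. uLt s j) has_real_derivative
              rhs_L ord hL hR \<tau>L (uL t) (uR t) j + F (- real j * hL) t) (at t within {0..}) \<and>
           ((\<lambda>s. uR s j) has_real_derivative uRt t j) (at t within {0..}) \<and>
           ((\<lambda>s. uRt s j) has_real_derivative
              rhs_R ord hL hR \<tau>R (uL t) (uR t) j + F (real j * hR) t) (at t within {0..})) \<and>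
        (\<forall>j. uL 0 j = f1 (- real j * hL) \<and> uLt 0 j = f2 (- real j * hL) \<and>
             uR 0 j = f1 (real j * hR) \<and> uRt 0 j = f2 (real j * hR)))"

definition err_L :: "(real \<Rightarrow> real \<Rightarrow> real) \<Rightarrow> real \<Rightarrow> (real \<Rightarrow> nat \<Rightarrow> real) \<Rightarrow> real \<Rightarrow> nat \<Rightarrow> real" where
  "err_L U hL uL t j = U (- real j * hL) t - uL t j"

definition err_R :: "(real \<Rightarrow> real \<Rightarrow> real) \<Rightarrow> real \<Rightarrow> (real \<Rightarrow> nat \<Rightarrow> real) \<Rightarrow> real \<Rightarrow> nat \<Rightarrow> real" where
  "err_R U hR uR t j = U (real j * hR) t - uR t j"

text \<open>
  The summability and integrability conjuncts make sure that the infinite sums and the integral in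
  the bound are genuine rather than default values.
\<close>

definition error_bound ::
  "(real \<Rightarrow> real \<Rightarrow> real) \<Rightarrow> real \<Rightarrow> real \<Rightarrow>
   (real \<Rightarrow> nat \<Rightarrow> real) \<Rightarrow> (real \<Rightarrow> nat \<Rightarrow> real) \<Rightarrow> real \<Rightarrow> real \<Rightarrow> bool" where
  "error_bound U hL hR uL uR tf b \<longleftrightarrow>
     (let E = (\<lambda>t. (grid_norm hL (err_L U hL uL t))\<^sup>2 + (grid_norm hR (err_R U hR uR t))\<^sup>2)
      in (\<forall>t\<in>{0..tf}. grid_l2 (err_L U hL uL t) \<and> grid_l2 (err_R U hR uR t)) \<and>
         E integrable_on {0..tf} \<and>
         sqrt (integral {0..tf} E) \<le> b)"

end

theory Submission
  imports Defs
begin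

text \<open>
  The time-integrated energy method bounds the norm of a grid function \<open>y\<close> with \<open>y\<^bsub>tt\<^esub> = L y + R\<close> by
  the norms of \<open>y(0)\<close>, \<open>y\<^sub>t(0)\<close> and \<open>R\<close>. Integrating once in time matters because only the norms of
  the initial data enter, not their discrete energy; it also needs no regularity of the infinite
  system beyond local boundedness of the norm. For \<open>lam = 1\<close> it is applied to the error itself: the
  boundary rows have truncation error \<open>O(h\<^sup>p)\<close> in finitely many points, which gives the rate
  \<open>p + 1/2\<close>.

  For \<open>lam > 1\<close> a corrector is first added to the exact solution to cancel the boundary truncation
  errors \<open>h\<^bsup>m-2\<^esup> \<partial>\<^sub>x\<^sup>m U(0, t)\<close>, \<open>m < 2p + 2\<close>, of the boundary rows. It is a static solution of the
  scheme: an exponentially decaying layer plus a smooth decaying profile replacing the constant and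
  linear parts. The layer equations leave one unknown, the jump at the interface, which is multiplied
  by \<open>\<tau> - \<sigma> (1/hL + 1/hR) / 4\<close>, where \<open>\<sigma> = S A\<^sup>+ S\<^sup>T\<close>. Since \<open>\<alpha> \<sigma> \<le> 1\<close>, this factor is positive
  exactly because \<open>\<tau>\<close> exceeds its stability limit.
\<close>

section \<open>Stencils and the boundary form\<close>

text \<open>The obstacle is that every part of the corrector has to be small. A boundary error of
  size h^(m-2) is removed by a layer of size h^m, but the layer equations also force a constant of
  size h^m and a slope of size h^(m-1) away from the interface. The constant is harmless because m
  starts at p + 2, which is at least 2p for p = 1, 2. The slope is harmless for m = 2p + 1, but for
  m = 2p it has to vanish. It does, because it measures the boundary error of the quadrature with
  weights \<open>sbp_H\<close> on x^(m-2), and these weights are exact there up to degree 2p - 2.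
  All errors are measured against one weight exp(-|x|). Derivatives of U obey it because finite
  propagation speed keeps the support of U bounded, layers because h <= 1 gives exp(-j) <= exp(-j
  h), and its discrete norm is bounded uniformly in h. The grid is infinite, so every summation by
  parts is done on a finite section, with an explicit flux through the cut that vanishes as the
  section grows.\<close>

definition int_near :: "nat \<Rightarrow> real" where "int_near ord = (if ord = 2 then 1 else 4/3)"
definition int_far :: "nat \<Rightarrow> real" where "int_far ord = (if ord = 2 then 0 else -1/12)"

lemma sbp_D_scale: "h \<noteq> 0 \<Longrightarrow> sbp_D ord h v j = sbp_D ord 1 v j / h\<^sup>2"
  by (simp add: sbp_D_def Dplus_def Dminus_def field_simps power2_eq_square)

lemma sbp_S0_scale: "sbp_S0 ord h v = sbp_S0 ord 1 v / h"
  by (simp add: sbp_S0_def)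

lemma sbp_ST_e0_scale: "sbp_ST_e0 ord h j = sbp_ST_e0 ord 1 j / h"
  by (simp add: sbp_ST_e0_def)

lemma sbp_H_scale: "sbp_H ord h j = h * sbp_H ord 1 j"
  by (simp add: sbp_H_def)

lemma sbp_A_scale: "h \<noteq> 0 \<Longrightarrow> sbp_A ord h v j = sbp_A ord 1 v j / h"
  unfolding sbp_A_def sbp_D_scale[of h] sbp_S0_scale[of ord h] sbp_H_scale[of ord h]
  by (simp add: field_simps power2_eq_square)

lemma sbp_H_interior: "4 \<le> j \<Longrightarrow> sbp_H ord h j = h"
  by (simp add: sbp_H_def nth_default_def)

lemma sbp_ST_e0_interior: "4 \<le> j \<Longrightarrow> sbp_ST_e0 ord h j = 0"
  by (simp add: sbp_ST_e0_def S_row_def nth_default_def)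

lemma less_4_cases: "(j::nat) < 4 \<Longrightarrow> j = 0 \<or> j = 1 \<or> j = 2 \<or> j = 3"
  by auto

text \<open>\<open>int_near\<close> and \<open>int_far\<close> weight the second differences with
  spacing one and two. In this form both orders share one argument; order two is also given four
  boundary rows, although only its row 0 is special.\<close>

lemma sbp_D_interior:
  assumes "ord \<in> {2, 4}"
  shows "sbp_D ord 1 v (n + 4) =
    int_near ord * (v (n + 5) - 2 * v (n + 4) + v (n + 3)) +
    int_far ord * (v (n + 6) - 2 * v (n + 4) + v (n + 2))"
  using assms
  by (auto simp: sbp_D_def D_rows_def Dplus_def Dminus_def int_near_def int_far_def numeral_eq_Suc field_simps)

lemma sbp_boundary_rows_2:
  "sbp_D 2 1 v 0 = v 0 - 2 * v 1 + v 2"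
  "sbp_D 2 1 v 1 = v 0 - 2 * v 1 + v 2"
  "sbp_D 2 1 v 2 = v 1 - 2 * v 2 + v 3"
  "sbp_D 2 1 v 3 = v 2 - 2 * v 3 + v 4"
  "sbp_S0 2 1 v = -3/2 * v 0 + 2 * v 1 - 1/2 * v 2"
  "sbp_H 2 1 0 = 1/2" "sbp_H 2 1 1 = 1" "sbp_H 2 1 2 = 1" "sbp_H 2 1 3 = 1"
  "sbp_ST_e0 2 1 0 = -3/2" "sbp_ST_e0 2 1 1 = 2" "sbp_ST_e0 2 1 2 = -1/2" "sbp_ST_e0 2 1 3 = 0"
  by (simp_all add: sbp_D_def D_rows_def apply_row_def sbp_S0_def S_row_def Dplus_def Dminus_def
      sbp_H_def sbp_ST_e0_def nth_default_def numeral_eq_Suc field_simps)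

lemma sbp_boundary_rows_4:
  "sbp_D 4 1 v 0 = 2 * v 0 - 5 * v 1 + 4 * v 2 - v 3"
  "sbp_D 4 1 v 1 = v 0 - 2 * v 1 + v 2"
  "sbp_D 4 1 v 2 = -4/43 * v 0 + 59/43 * v 1 - 110/43 * v 2 + 59/43 * v 3 - 4/43 * v 4"
  "sbp_D 4 1 v 3 = -1/49 * v 0 + 59/49 * v 2 - 118/49 * v 3 + 64/49 * v 4 - 4/49 * v 5"
  "sbp_S0 4 1 v = -11/6 * v 0 + 3 * v 1 - 3/2 * v 2 + 1/3 * v 3"
  "sbp_H 4 1 0 = 17/48" "sbp_H 4 1 1 = 59/48" "sbp_H 4 1 2 = 43/48" "sbp_H 4 1 3 = 49/48"
  "sbp_ST_e0 4 1 0 = -11/6" "sbp_ST_e0 4 1 1 = 3" "sbp_ST_e0 4 1 2 = -3/2" "sbp_ST_e0 4 1 3 = 1/3"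
  by (simp_all add: sbp_D_def D_rows_def apply_row_def sbp_S0_def S_row_def
      sbp_H_def sbp_ST_e0_def nth_default_def numeral_eq_Suc field_simps)

lemma e0_simps: "e0 0 = 1" "0 < j \<Longrightarrow> e0 j = 0"
  by (simp_all add: e0_def)

lemma sum_lessThan_4: "(\<Sum>j<4::nat. f j) = f 0 + f 1 + f 2 + (f 3 :: real)"
  by (simp add: numeral_eq_Suc)

lemma sbp_A_interior:
  assumes "ord \<in> {2, 4}"
  shows "sbp_A ord 1 v (n + 4) =
    - int_near ord * (v (n + 5) - 2 * v (n + 4) + v (n + 3)) -
    int_far ord * (v (n + 6) - 2 * v (n + 4) + v (n + 2))"
  unfolding sbp_A_def sbp_D_interior[OF assms] by (simp add: e0_def sbp_H_interior)

lemma sbp_A_boundary_2: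
  "sbp_A 2 1 v 0 = v 0 - v 1"
  "sbp_A 2 1 v 1 = - v 0 + 2 * v 1 - v 2"
  "sbp_A 2 1 v 2 = - v 1 + 2 * v 2 - v 3"
  "sbp_A 2 1 v 3 = - v 2 + 2 * v 3 - v 4"
  unfolding sbp_A_def sbp_boundary_rows_2 by (simp_all add: e0_def field_simps)

lemma sbp_A_boundary_4:
  "sbp_A 4 1 v 0 = 9/8 * v 0 - 59/48 * v 1 + 1/12 * v 2 + 1/48 * v 3"
  "sbp_A 4 1 v 1 = -59/48 * v 0 + 59/24 * v 1 - 59/48 * v 2"
  "sbp_A 4 1 v 2 = 1/12 * v 0 - 59/48 * v 1 + 55/24 * v 2 - 59/48 * v 3 + 1/12 * v 4"
  "sbp_A 4 1 v 3 = 1/48 * v 0 - 59/48 * v 2 + 59/24 * v 3 - 4/3 * v 4 + 1/12 * v 5"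
  unfolding sbp_A_def sbp_boundary_rows_4 by (simp_all add: e0_def field_simps)

text \<open>Minus the sum of \<open>v i * A i k * w k\<close> over the couplings with i < n + 4 <=
  k, where A is the matrix of \<open>sbp_A\<close>: what crosses the cut when a sum over the
  half-line is restricted to its first n + 4 terms.\<close>

definition A_flux :: "nat \<Rightarrow> (nat \<Rightarrow> real) \<Rightarrow> (nat \<Rightarrow> real) \<Rightarrow> nat \<Rightarrow> real" where
  "A_flux ord v w n =
     int_near ord * (v (n + 3) * w (n + 4)) + int_far ord * (v (n + 3) * w (n + 5) + v (n + 2) * w (n + 4))"

text \<open>Couplings inside the section cancel because A is symmetric, and those across the cut
  survive. The boundary rows matter only for n = 0; each further step adds one interior row.\<close>

lemma sbp_A_symmetric:
  assumes "ord \<in> {2, 4}"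
  shows "(\<Sum>j<n + 4. w j * sbp_A ord 1 v j - v j * sbp_A ord 1 w j) = A_flux ord v w n - A_flux ord w v n"
proof (induction n)
  case 0
  show ?case
    using assms unfolding add_0 sum_lessThan_4
    by (auto simp: sbp_A_boundary_2 sbp_A_boundary_4 A_flux_def int_near_def int_far_def field_simps
        simp del: One_nat_def add_2_eq_Suc add_2_eq_Suc')
next
  case (Suc n)
  have "Suc n + 4 = Suc (n + 4)" by simp
  then show ?case
    by (simp only: sum.lessThan_Suc Suc.IH sbp_A_interior[OF assms])
       (simp add: A_flux_def numeral_eq_Suc algebra_simps)
qed

text \<open>Setting the entries beyond the cut to zero changes the form exactly by the flux. This
  carries statements about finitely supported grid functions, such as the definition of
  \<open>sbp_alpha\<close>, over to arbitrary ones.\<close>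

lemma sbp_A_truncated:
  assumes "ord \<in> {2, 4}"
  shows "(\<Sum>j<n + 4. v j * sbp_A ord 1 (\<lambda>i. if i < n + 4 then v i else 0) j) =
    (\<Sum>j<n + 4. v j * sbp_A ord 1 v j) + A_flux ord v v n"
proof -
  let ?w = "\<lambda>i. if i < n + 4 then v i else 0"
  have "(\<Sum>j<n + 4. ?w j * sbp_A ord 1 v j - v j * sbp_A ord 1 ?w j) = A_flux ord v ?w n - A_flux ord ?w v n"
    by (rule sbp_A_symmetric[OF assms])
  moreover have "A_flux ord v ?w n = 0" "A_flux ord ?w v n = A_flux ord v v n"
    by (simp_all add: A_flux_def)
  ultimately have "(\<Sum>j<n + 4. ?w j * sbp_A ord 1 v j - v j * sbp_A ord 1 ?w j) = - A_flux ord v v n"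
    by simp
  moreover have "(\<Sum>j<n + 4. ?w j * sbp_A ord 1 v j - v j * sbp_A ord 1 ?w j) =
      (\<Sum>j<n + 4. v j * sbp_A ord 1 v j) - (\<Sum>j<n + 4. v j * sbp_A ord 1 ?w j)"
    by (subst sum_subtractf[symmetric], rule sum.cong) auto
  ultimately show ?thesis by simp
qed

text \<open>In terms of the differences \<open>v (Suc k) - v k\<close> the form dominates the sum of their squares,
  since the far couplings enter through \<open>(a + b)\<^sup>2 \<le> 2 a\<^sup>2 + 2 b\<^sup>2\<close>; the last summand on the right
  pays for the coupling to the next node.\<close>

lemma sbp_A_coercive_aux:
  assumes "ord \<in> {2, 4}"
  shows "(\<Sum>j<n + 4. v j * sbp_A ord 1 v j) + A_flux ord v v n
      - int_near ord * (v (n + 3))\<^sup>2 - int_far ord * ((v (n + 3))\<^sup>2 + (v (n + 2))\<^sup>2)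
    \<ge> 1/5 * (sbp_S0 ord 1 v)\<^sup>2 + 1/6 * (v (n + 3) - v (n + 2))\<^sup>2"
proof (induction n)
  case 0
  \<comment> \<open>Once the squares left on the diagonal by the cut couplings are subtracted, the
    form annihilates constants, so it is a polynomial in the differences.\<close>
  define a b c where "a = v 1 - v 0" and "b = v 2 - v 1" and "c = v 3 - v 2"
  have v: "v 1 = v 0 + a" "v 2 = v 0 + a + b" "v 3 = v 0 + a + b + c" 
    by (simp_all add: a_def b_def c_def)
  consider "ord = 2" | "ord = 4" using assms by auto
  then show ?case
  proof cases
    case 1
    have S: "sbp_S0 2 1 v = 3/2 * a - 1/2 * b"
      by (simp add: sbp_boundary_rows_2 a_def b_def field_simps del: One_nat_def)
    have "(\<Sum>j<4. v j * sbp_A 2 1 v j) + A_flux 2 v v 0 - (v 3)\<^sup>2 = a\<^sup>2 + b\<^sup>2 + c\<^sup>2"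
      unfolding sum_lessThan_4 sbp_A_boundary_2 A_flux_def int_near_def int_far_def
      by (simp add: v del: One_nat_def) (simp add: power2_eq_square algebra_simps)
    moreover have "a\<^sup>2 + b\<^sup>2 + c\<^sup>2 - (1/5 * (3/2 * a - 1/2 * b)\<^sup>2 + 1/6 * c\<^sup>2) =
       (1/2) * a\<^sup>2 + 1/20 * (a + 3 * b)\<^sup>2 + 1/2 * b\<^sup>2 + 5/6 * c\<^sup>2"
      by (simp add: power2_eq_square field_simps)
    moreover have "\<dots> \<ge> 0" by simp
    ultimately have "(\<Sum>j<4. v j * sbp_A 2 1 v j) + A_flux 2 v v 0 - (v 3)\<^sup>2
        \<ge> 1/5 * (3/2 * a - 1/2 * b)\<^sup>2 + 1/6 * c\<^sup>2" by linarith
    then show ?thesis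
      using 1 by (simp add: S int_near_def int_far_def c_def del: add_2_eq_Suc add_2_eq_Suc')
  next
    case 2
    have S: "sbp_S0 4 1 v = 11/6 * a - 7/6 * b + 1/3 * c"
      by (simp add: sbp_boundary_rows_4 a_def b_def c_def field_simps del: One_nat_def)
    have "(\<Sum>j<4. v j * sbp_A 4 1 v j) + A_flux 4 v v 0 - 4/3 * (v 3)\<^sup>2 + 1/12 * ((v 3)\<^sup>2 + (v 2)\<^sup>2) =
       59/48 * (a\<^sup>2 + b\<^sup>2 + c\<^sup>2) - 1/12 * (a + b)\<^sup>2 - 1/48 * (a + b + c)\<^sup>2"
      unfolding sum_lessThan_4 sbp_A_boundary_4 A_flux_def int_near_def int_far_def
      by (simp add: v del: One_nat_def add_2_eq_Suc add_2_eq_Suc') (simp add: power2_eq_square field_simps)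
    \<comment> \<open>An explicit sum of squares. The constant 1/5 lies below the extremal value
      0.2508..., which leaves room for it and for the reserve 1/6 c^2.\<close>
    moreover have "59/48 * (a\<^sup>2 + b\<^sup>2 + c\<^sup>2) - 1/12 * (a + b)\<^sup>2 - 1/48 * (a + b + c)\<^sup>2 
        - (1/5 * (11/6 * a - 7/6 * b + 1/3 * c)\<^sup>2 + 1/6 * c\<^sup>2) = 
       1/30 * (a\<^sup>2 + b\<^sup>2 + c\<^sup>2) + 1/12 * (a - b)\<^sup>2 + 1/48 * ((a - b)\<^sup>2 + (b - c)\<^sup>2 + (a - c)\<^sup>2)
       + 1/180 * ((7 * a + 11 * b)\<^sup>2 + (2 * a - 11 * c)\<^sup>2 + (2 * b + 7 * c)\<^sup>2)"
      by (simp add: power2_eq_square field_simps)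
    moreover have "\<dots> \<ge> 0" by simp
    ultimately have "(\<Sum>j<4. v j * sbp_A 4 1 v j) + A_flux 4 v v 0 - 4/3 * (v 3)\<^sup>2 + 1/12 * ((v 3)\<^sup>2 + (v 2)\<^sup>2)
        \<ge> 1/5 * (11/6 * a - 7/6 * b + 1/3 * c)\<^sup>2 + 1/6 * c\<^sup>2" by linarith
    then show ?thesis
      using 2 by (simp add: S int_near_def int_far_def c_def del: add_2_eq_Suc add_2_eq_Suc')
  qed
next
  case (Suc n)
  define x y where "x = v (n + 3) - v (n + 2)" and "y = v (n + 4) - v (n + 3)"
  let ?G = "\<lambda>n. (\<Sum>j<n + 4. v j * sbp_A ord 1 v j) + A_flux ord v v n
      - int_near ord * (v (n + 3))\<^sup>2 - int_far ord * ((v (n + 3))\<^sup>2 + (v (n + 2))\<^sup>2)"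
  have eq: "Suc n + 4 = Suc (n + 4)" by simp
  have "?G (Suc n) - ?G n = int_near ord * y\<^sup>2 + int_far ord * (x + y)\<^sup>2"
    unfolding eq sum.lessThan_Suc sbp_A_interior[OF assms] A_flux_def x_def y_def
    by (simp add: numeral_eq_Suc algebra_simps power2_eq_square)
  moreover have "int_near ord * y\<^sup>2 + int_far ord * (x + y)\<^sup>2 \<ge> 1/6 * y\<^sup>2 - 1/6 * x\<^sup>2"
  proof -
    have "4/3 * y\<^sup>2 - 1/12 * (x + y)\<^sup>2 - (1/6 * y\<^sup>2 - 1/6 * x\<^sup>2) = y\<^sup>2 + 1/12 * (x - y)\<^sup>2"
      by (simp add: power2_eq_square field_simps)
    moreover have "y\<^sup>2 + 1/12 * (x - y)\<^sup>2 \<ge> 0" "x\<^sup>2 \<ge> 0" "y\<^sup>2 \<ge> 0" by simp_all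
    ultimately have "1/6 * y\<^sup>2 - 1/6 * x\<^sup>2 \<le> 4/3 * y\<^sup>2 - 1/12 * (x + y)\<^sup>2" "1/6 * y\<^sup>2 - 1/6 * x\<^sup>2 \<le> y\<^sup>2"
      by linarith+
    then show ?thesis
      using assms by (auto simp: int_near_def int_far_def)
  qed
  moreover have "?G n \<ge> 1/5 * (sbp_S0 ord 1 v)\<^sup>2 + 1/6 * x\<^sup>2"
    using Suc.IH by (simp add: x_def)
  ultimately have "?G (Suc n) \<ge> 1/5 * (sbp_S0 ord 1 v)\<^sup>2 + 1/6 * y\<^sup>2" by linarith
  then show ?case by (simp add: y_def numeral_eq_Suc)
qed

section \<open>Attainment and positivity of the extremal constant\<close>

lemma finite_support_sum_eq:
  fixes v :: "nat \<Rightarrow> real"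
  assumes "finite {j. v j \<noteq> 0}" and "\<And>j. j \<ge> N \<Longrightarrow> v j = 0"
  shows "(\<Sum>j | v j \<noteq> 0. v j * g j) = (\<Sum>j<N. v j * g j)"
proof (rule sum.mono_neutral_left)
  show "{j. v j \<noteq> 0} \<subseteq> {..<N}"
    using assms(2) by (auto simp: not_le[symmetric])
qed auto

lemma finite_support_bound:
  fixes v :: "nat \<Rightarrow> real"
  assumes "finite {j. v j \<noteq> 0}"
  obtains N where "\<And>j. j \<ge> N \<Longrightarrow> v j = 0"
proof -
  obtain N where "\<forall>j\<in>{j. v j \<noteq> 0}. j < N" using assms finite_nat_set_iff_bounded by blast
  then show ?thesis using that[of N] by (metis linorder_not_le mem_Collect_eq)
qed

definition psd_shift :: "nat \<Rightarrow> real \<Rightarrow> bool" where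
  "psd_shift ord a \<longleftrightarrow> (\<forall>h>0. \<forall>v. finite {j. v j \<noteq> 0} \<longrightarrow>
        (\<Sum>j | v j \<noteq> 0. v j * sbp_A ord h v j) - h * a * (sbp_S0 ord h v)\<^sup>2 \<ge> 0)"

text \<open>By the scaling of \<open>sbp_A\<close> and \<open>sbp_S0\<close>, mesh size h gives the
  inequality for h = 1 divided by h.\<close>

lemma psd_shift_alt:
  "psd_shift ord a \<longleftrightarrow> (\<forall>v. finite {j. v j \<noteq> 0} \<longrightarrow>
        a * (sbp_S0 ord 1 v)\<^sup>2 \<le> (\<Sum>j | v j \<noteq> 0. v j * sbp_A ord 1 v j))"
proof -
  have "(\<Sum>j | v j \<noteq> 0. v j * sbp_A ord h v j) - h * a * (sbp_S0 ord h v)\<^sup>2 =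
    ((\<Sum>j | v j \<noteq> 0. v j * sbp_A ord 1 v j) - a * (sbp_S0 ord 1 v)\<^sup>2) / h" if "h > 0" for h v
    using that unfolding sbp_S0_scale[of ord h]
    by (simp add: sbp_A_scale[of h] sum_divide_distrib[symmetric] field_simps power2_eq_square)
  then have "h > 0 \<Longrightarrow> (\<Sum>j | v j \<noteq> 0. v j * sbp_A ord h v j) - h * a * (sbp_S0 ord h v)\<^sup>2 \<ge> 0 \<longleftrightarrow>
      a * (sbp_S0 ord 1 v)\<^sup>2 \<le> (\<Sum>j | v j \<noteq> 0. v j * sbp_A ord 1 v j)" for h v
    by (simp add: zero_le_divide_iff)
  moreover have "(0::real) < 1" by simp
  ultimately show ?thesis
    unfolding psd_shift_def by meson
qed

lemma psd_shiftD:
  "psd_shift ord a \<Longrightarrow> finite {j. v j \<noteq> 0} \<Longrightarrow>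
    a * (sbp_S0 ord 1 v)\<^sup>2 \<le> (\<Sum>j | v j \<noteq> 0. v j * sbp_A ord 1 v j)"
  unfolding psd_shift_alt by blast

lemma psd_shiftI:
  "(\<And>v. finite {j. v j \<noteq> 0} \<Longrightarrow>
    a * (sbp_S0 ord 1 v)\<^sup>2 \<le> (\<Sum>j | v j \<noteq> 0. v j * sbp_A ord 1 v j)) \<Longrightarrow> psd_shift ord a"
  unfolding psd_shift_alt by blast

text \<open>Any positive constant would serve. It makes the set of admissible shifts nonempty with
  positive supremum, and it gives semi-definiteness of the form where \<open>sbp_S0\<close>
  vanishes.\<close>

lemma psd_shift_fifth:
  assumes "ord \<in> {2, 4}"
  shows "psd_shift ord (1/5)"
proof (rule psd_shiftI)
  fix v :: "nat \<Rightarrow> real"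
  assume fin: "finite {j. v j \<noteq> 0}"
  obtain n where n: "\<And>j. j \<ge> n \<Longrightarrow> v j = 0" using finite_support_bound[OF fin] by blast
  have z: "v (n + 2) = 0" "v (n + 3) = 0" "v (n + 4) = 0" "v (n + 5) = 0" by (simp_all add: n)
  have "(\<Sum>j | v j \<noteq> 0. v j * sbp_A ord 1 v j) = (\<Sum>j<n + 4. v j * sbp_A ord 1 v j)"
    by (rule finite_support_sum_eq[OF fin]) (simp add: n)
  then show "1/5 * (sbp_S0 ord 1 v)\<^sup>2 \<le> (\<Sum>j | v j \<noteq> 0. v j * sbp_A ord 1 v j)"
    using sbp_A_coercive_aux[OF assms, where v=v and n=n] unfolding A_flux_def z by simp
qed

text \<open>\<open>GREATEST\<close> is meaningful only if the maximum is attained. Admissibility is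
  a family of upper bounds on a, one for each v with nonzero \<open>sbp_S0 ord 1 v\<close>, so the
  supremum is admissible too; \<open>e0\<close> supplies one such bound.\<close>

lemma psd_shift_alpha:
  assumes "ord \<in> {2, 4}"
  shows "psd_shift ord (sbp_alpha ord)" and "sbp_alpha ord > 0"
proof -
  let ?q = "\<lambda>v. \<Sum>j | v j \<noteq> 0. v j * sbp_A ord 1 v j"
  have fin: "finite {j. e0 j \<noteq> 0}" by (rule finite_subset[of _ "{0}"]) (auto simp: e0_def)
  have nz: "sbp_S0 ord 1 e0 \<noteq> 0"
    using assms by (auto simp: sbp_boundary_rows_2 sbp_boundary_rows_4 e0_def)
  have bdd: "bdd_above {a. psd_shift ord a}"
    using fin nz unfolding psd_shift_alt
    by (intro bdd_aboveI[of _ "?q e0 / (sbp_S0 ord 1 e0)\<^sup>2"]) (auto simp: field_simps)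
  let ?s = "Sup {a. psd_shift ord a}"
  have ub: "a \<le> ?s" if "psd_shift ord a" for a
    using that bdd by (intro cSup_upper) auto
  have s: "psd_shift ord ?s"
  proof (rule psd_shiftI)
    fix v :: "nat \<Rightarrow> real" assume v: "finite {j. v j \<noteq> 0}"
    show "?s * (sbp_S0 ord 1 v)\<^sup>2 \<le> ?q v"
    proof (cases "sbp_S0 ord 1 v = 0")
      case True
      then show ?thesis using psd_shiftD[OF psd_shift_fifth[OF assms] v] by simp
    next
      case False
      have "?s \<le> ?q v / (sbp_S0 ord 1 v)\<^sup>2"
      proof (rule cSup_least)
        show "{a. psd_shift ord a} \<noteq> {}" using psd_shift_fifth[OF assms] by blast
        show "a \<le> ?q v / (sbp_S0 ord 1 v)\<^sup>2" if "a \<in> {a. psd_shift ord a}" for a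
          using that False psd_shiftD[OF _ v] by (simp add: field_simps)
      qed
      then show ?thesis using False by (simp add: field_simps)
    qed
  qed
  have "sbp_alpha ord = ?s"
    unfolding sbp_alpha_def psd_shift_def[symmetric] by (rule Greatest_equality[of "psd_shift ord", OF s ub])
  then show "psd_shift ord (sbp_alpha ord)" "sbp_alpha ord > 0"
    using s ub[OF psd_shift_fifth[OF assms]] by auto
qed

text \<open>The boundary row sees only entries below the cut, so cutting v off affects the form
  alone and not \<open>sbp_S0\<close>.\<close>

lemma sbp_alpha_form_bound:
  assumes "ord \<in> {2, 4}"
  shows "sbp_alpha ord * (sbp_S0 ord 1 v)\<^sup>2 \<le> (\<Sum>j<n + 4. v j * sbp_A ord 1 v j) + A_flux ord v v n"
proof -
  let ?w = "\<lambda>i. if i < n + 4 then v i else 0"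
  have fin: "finite {j. ?w j \<noteq> 0}" by (rule finite_subset[of _ "{..<n + 4}"]) auto
  have "sbp_S0 ord 1 ?w = sbp_S0 ord 1 v"
    using assms by (auto simp: sbp_boundary_rows_2 sbp_boundary_rows_4)
  moreover have "(\<Sum>j | ?w j \<noteq> 0. ?w j * sbp_A ord 1 ?w j) = (\<Sum>j<n + 4. ?w j * sbp_A ord 1 ?w j)"
    by (rule finite_support_sum_eq[OF fin]) simp
  moreover have "\<dots> = (\<Sum>j<n + 4. v j * sbp_A ord 1 ?w j)" by (rule sum.cong) auto
  ultimately show ?thesis
    using psd_shiftD[OF psd_shift_alpha(1)[OF assms] fin] sbp_A_truncated[OF assms, where v=v and n=n]
    by simp
qed

lemma A_flux_tendsto_0:
  assumes "v \<longlonglongrightarrow> 0" "w \<longlonglongrightarrow> 0"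
  shows "A_flux ord v w \<longlonglongrightarrow> 0"
proof -
  have "(\<lambda>n. A_flux ord v w n) \<longlonglongrightarrow> int_near ord * (0 * 0) + int_far ord * (0 * 0 + 0 * 0)"
    unfolding A_flux_def by (intro tendsto_intros LIMSEQ_ignore_initial_segment assms)
  then show ?thesis by simp
qed

text \<open>The inequality defining \<open>sbp_alpha\<close> is tested with P itself. As A P is the
  first row of S, the form at P equals s = \<open>sbp_S0 ord 1 P\<close>, and the inequality reads
  \<alpha> s^2 <= s. P decays without having finite support, hence the limit of the flux.\<close>

lemma sbp_alpha_mult_le_1:
  assumes ord: "ord \<in> {2, 4}" and P: "P \<longlonglongrightarrow> 0" and pos: "sbp_S0 ord 1 P > 0"
    and A: "\<And>j. sbp_A ord 1 P j = sbp_ST_e0 ord 1 j"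
  shows "sbp_alpha ord * sbp_S0 ord 1 P \<le> 1"
proof -
  have S: "(\<Sum>j<n + 4. P j * sbp_A ord 1 P j) = sbp_S0 ord 1 P" for n
  proof -
    have "(\<Sum>j<n + 4. P j * sbp_A ord 1 P j) = (\<Sum>j<4. P j * sbp_ST_e0 ord 1 j)"
      unfolding A by (rule sum.mono_neutral_right) (auto simp: sbp_ST_e0_interior)
    also have "\<dots> = sbp_S0 ord 1 P"
      using ord unfolding sum_lessThan_4
      by (auto simp: sbp_boundary_rows_2 sbp_boundary_rows_4 simp del: One_nat_def)
    finally show ?thesis .
  qed
  have "(\<lambda>n. sbp_S0 ord 1 P + A_flux ord P P n) \<longlonglongrightarrow> sbp_S0 ord 1 P + 0"
    by (intro tendsto_intros A_flux_tendsto_0 P)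
  moreover have "sbp_alpha ord * (sbp_S0 ord 1 P)\<^sup>2 \<le> sbp_S0 ord 1 P + A_flux ord P P n" for n
    using sbp_alpha_form_bound[OF ord, of P n] S by simp
  ultimately have "sbp_alpha ord * (sbp_S0 ord 1 P)\<^sup>2 \<le> sbp_S0 ord 1 P"
    by (intro LIMSEQ_le_const) auto
  then show ?thesis using pos by (simp add: power2_eq_square mult.assoc[symmetric])
qed

section \<open>Energy estimate for symmetric dissipative systems\<close>

abbreviation sq_sum :: "('i \<Rightarrow> real) \<Rightarrow> 'i set \<Rightarrow> ('i \<Rightarrow> real) \<Rightarrow> real" where
  "sq_sum m I v \<equiv> \<Sum>i\<in>I. m i * (v i)\<^sup>2"

lemma weighted_Cauchy_Schwarz:
  fixes m a b :: "'i \<Rightarrow> real"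
  assumes "\<And>i. i \<in> I \<Longrightarrow> m i \<ge> 0" "sq_sum m I a \<le> p\<^sup>2" "sq_sum m I b \<le> q\<^sup>2" "p \<ge> 0" "q \<ge> 0"
  shows "\<bar>\<Sum>i\<in>I. m i * a i * b i\<bar> \<le> p * q"
proof -
  have "(\<Sum>i\<in>I. (sqrt (m i) * a i) * (sqrt (m i) * b i))\<^sup>2
      \<le> (\<Sum>i\<in>I. (sqrt (m i) * a i)\<^sup>2) * (\<Sum>i\<in>I. (sqrt (m i) * b i)\<^sup>2)"
    by (rule Cauchy_Schwarz_ineq_sum)
  also have "(\<Sum>i\<in>I. (sqrt (m i) * a i) * (sqrt (m i) * b i)) = (\<Sum>i\<in>I. m i * a i * b i)"
    using assms(1) by (intro sum.cong refl) (simp add: algebra_simps)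
  also have "(\<Sum>i\<in>I. (sqrt (m i) * a i)\<^sup>2) = sq_sum m I a"
    using assms(1) by (intro sum.cong refl) (simp add: power_mult_distrib)
  also have "(\<Sum>i\<in>I. (sqrt (m i) * b i)\<^sup>2) = sq_sum m I b"
    using assms(1) by (intro sum.cong refl) (simp add: power_mult_distrib)
  also have "sq_sum m I a * sq_sum m I b \<le> p\<^sup>2 * q\<^sup>2"
    using assms by (intro mult_mono sum_nonneg) auto
  finally have "(\<Sum>i\<in>I. m i * a i * b i)\<^sup>2 \<le> (p * q)\<^sup>2" by (simp add: power_mult_distrib)
  then show ?thesis using assms(4,5) by (simp add: abs_le_square_iff[symmetric])
qed

text \<open>Turns an estimate whose right side is linear in an unknown supremum into a bound on that
  supremum.\<close>

lemma quadratic_self_bound: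
  fixes x B c :: real
  assumes "x\<^sup>2 \<le> B\<^sup>2 + x * c" "B \<ge> 0" "c \<ge> 0"
  shows "x \<le> B + c"
proof (rule ccontr)
  assume "\<not> x \<le> B + c"
  then have x: "x > B + c" by simp
  have "x * (B + c) < x * x" using x assms by (intro mult_strict_left_mono) auto
  moreover have "B * B \<le> x * B" using x assms by (intro mult_right_mono) auto
  ultimately show False using assms(1) by (simp add: power2_eq_square algebra_simps)
qed

text \<open>An infinite linear system seen through finite sections \<open>I n\<close>. Symmetry and
  dissipativity hold up to a flux across the edge of the section, which vanishes in the limit on
  functions of finite norm. The uniform bound on the flux lets its time integral converge by
  dominated convergence.\<close>

locale symmetric_dissipative =
  fixes m :: "'i \<Rightarrow> real" and I :: "nat \<Rightarrow> 'i set"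
    and L :: "('i \<Rightarrow> real) \<Rightarrow> 'i \<Rightarrow> real"
    and flux :: "nat \<Rightarrow> ('i \<Rightarrow> real) \<Rightarrow> ('i \<Rightarrow> real) \<Rightarrow> real"
  assumes finite_I: "finite (I n)" and mono_I: "n \<le> n' \<Longrightarrow> I n \<subseteq> I n'"
    and m_nonneg: "m i \<ge> 0"
    and L_zero: "L (\<lambda>_. 0) i = 0"
    and L_deriv: "(\<And>k. ((\<lambda>s. V s k) has_real_derivative V' k) (at t within S)) \<Longrightarrow>
        ((\<lambda>s. L (V s) i) has_real_derivative L V' i) (at t within S)"
    and L_symmetric: "(\<Sum>i\<in>I n. m i * (w i * L v i - v i * L w i)) = flux n w v - flux n v w"
    and L_dissipative: "(\<Sum>i\<in>I n. m i * (v i * L v i)) \<le> flux n v v"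
    and flux_tendsto_0: "(\<And>n. sq_sum m (I n) v \<le> K) \<Longrightarrow> (\<And>n. sq_sum m (I n) w \<le> K) \<Longrightarrow>
        (\<lambda>n. flux n v w) \<longlonglongrightarrow> 0"
    and flux_bounded: "\<exists>C. \<forall>n v w. (\<forall>n. sq_sum m (I n) v \<le> K) \<longrightarrow>
        (\<forall>n. sq_sum m (I n) w \<le> K) \<longrightarrow> \<bar>flux n v w\<bar> \<le> C"
    and flux_continuous: "(\<And>i. continuous_on S (\<lambda>t. V t i)) \<Longrightarrow> (\<And>i. continuous_on S (\<lambda>t. W t i)) \<Longrightarrow>
        continuous_on S (\<lambda>t. flux n (V t) (W t))"
begin

text \<open>With Y the time integral of y, one integration of the equation gives y' = L Y +
  \<Theta>, where \<Theta>' = R and \<Theta>(0) = y'(0). The energy is the squared norm of y minus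
  the pairing of Y with L Y. Symmetry cancels L in its derivative, leaving twice the pairing of y
  with \<Theta>; since Y(0) = 0, the form of L does not enter at time zero. The a priori bound M
  still appears on the right.\<close>

lemma energy_identity_limit:
  fixes y :: "real \<Rightarrow> 'i \<Rightarrow> real"
  assumes T: "T \<ge> 0"
    and y: "\<And>t i. t \<in> {0..T} \<Longrightarrow> ((\<lambda>s. y s i) has_real_derivative y' t i) (at t within {0..T})"
    and y': "\<And>t i. t \<in> {0..T} \<Longrightarrow>
        ((\<lambda>s. y' s i) has_real_derivative L (y t) i + R t i) (at t within {0..T})"
    and R: "\<And>t i. t \<in> {0..T} \<Longrightarrow> \<bar>R t i\<bar> \<le> \<rho> i"
    and init: "\<And>i. \<bar>y 0 i\<bar> \<le> \<rho> i" "\<And>i. \<bar>y' 0 i\<bar> \<le> \<rho> i"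
    and \<rho>: "\<And>n. sq_sum m (I n) \<rho> \<le> B\<^sup>2" and B: "B \<ge> 0"
    and M: "\<And>t n. t \<in> {0..T} \<Longrightarrow> sq_sum m (I n) (y t) \<le> M\<^sup>2" and M0: "M \<ge> 0"
    and t: "t \<in> {0..T}"
  shows "sq_sum m (I k) (y t) \<le> B\<^sup>2 + M * (2 * T * (1 + T) * B)"
proof -
  define Y where "Y t i = integral {0..t} (\<lambda>s. y s i)" for t i
  have cont_y: "continuous_on {0..T} (\<lambda>s. y s i)" for i
    by (rule DERIV_continuous_on[OF y])
  have Y: "((\<lambda>s. Y s i) has_real_derivative y s i) (at s within {0..T})" if "s \<in> {0..T}" for s i
    unfolding Y_def using integral_has_real_derivative[OF cont_y that] .
  have cont_Y: "continuous_on {0..T} (\<lambda>s. Y s i)" for i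
    by (rule DERIV_continuous_on[OF Y])
  have Y0: "Y 0 = (\<lambda>_. 0)" by (simp add: Y_def fun_eq_iff)
  \<comment> \<open>Minkowski's inequality for the time integral: as r runs from 0 to s, the pairing
    of the fixed Y(s) with Y(r) changes at rate at most \<open>sqrt G * M\<close>, and at r = s it
    equals G.\<close>
  have YM: "sq_sum m (I n) (Y s) \<le> (T * M)\<^sup>2" if s: "s \<in> {0..T}" for s n
  proof -
    define G where "G = sq_sum m (I n) (Y s)"
    have G0: "G \<ge> 0" unfolding G_def by (intro sum_nonneg) (simp add: m_nonneg)
    have "norm ((\<Sum>i\<in>I n. m i * Y s i * Y s i) - (\<Sum>i\<in>I n. m i * Y s i * Y 0 i)) \<le> (sqrt G * M) * norm (s - 0)"
    proof (rule field_differentiable_bound[where S = "{0..T}" and f = "\<lambda>r. \<Sum>i\<in>I n. m i * Y s i * Y r i"])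
      fix r assume r: "r \<in> {0..T}"
      show "((\<lambda>r. \<Sum>i\<in>I n. m i * Y s i * Y r i) has_field_derivative (\<Sum>i\<in>I n. m i * Y s i * y r i)) (at r within {0..T})"
        by (intro DERIV_sum DERIV_cmult Y r)
      show "norm (\<Sum>i\<in>I n. m i * Y s i * y r i) \<le> sqrt G * M"
        unfolding real_norm_def
        by (rule weighted_Cauchy_Schwarz) (use G0 M[OF r] M0 in \<open>auto simp: m_nonneg G_def[symmetric]\<close>)
    qed (use s T in auto)
    also have "\<dots> \<le> sqrt G * M * T" using s M0 G0 by (intro mult_left_mono) auto
    finally have "sqrt G * sqrt G \<le> sqrt G * (T * M)"
      using G0 by (simp add: Y0 G_def power2_eq_square mult.assoc mult.commute[of T])
    then have "sqrt G \<le> T * M"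
    proof (cases "G = 0")
      case False
      with G0 have "sqrt G > 0" by simp
      with \<open>sqrt G * sqrt G \<le> sqrt G * (T * M)\<close> show ?thesis by (rule mult_left_le_imp_le)
    qed (use T M0 in simp)
    then have "(sqrt G)\<^sup>2 \<le> (T * M)\<^sup>2" using G0 by (intro power_mono) auto
    then show ?thesis using G0 by (simp add: G_def)
  qed
  define \<Theta> where "\<Theta> s i = y' s i - L (Y s) i" for s i
  have \<Theta>_bound: "\<bar>\<Theta> s i\<bar> \<le> (1 + T) * \<rho> i" if s: "s \<in> {0..T}" for s i
  proof -
    have "norm (\<Theta> s i - \<Theta> 0 i) \<le> \<rho> i * norm (s - 0)"
    proof (rule field_differentiable_bound[where S = "{0..T}" and f = "\<lambda>r. \<Theta> r i" and f' = "\<lambda>r. R r i"])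
      fix r assume r: "r \<in> {0..T}"
      have "((\<lambda>r. y' r i - L (Y r) i) has_field_derivative (L (y r) i + R r i) - L (y r) i) (at r within {0..T})"
        by (intro DERIV_diff y' L_deriv Y r)
      then show "((\<lambda>r. \<Theta> r i) has_field_derivative R r i) (at r within {0..T})"
        by (simp add: \<Theta>_def)
      show "norm (R r i) \<le> \<rho> i" using R[OF r] by simp
    qed (use s T in auto)
    also have "\<rho> i * norm (s - 0) \<le> \<rho> i * T"
      using s order_trans[OF abs_ge_zero init(1)[of i]] by (intro mult_left_mono) auto
    finally have "\<bar>\<Theta> s i - \<Theta> 0 i\<bar> \<le> \<rho> i * T" by simp
    moreover have "\<bar>\<Theta> 0 i\<bar> \<le> \<rho> i" using init(2)[of i] by (simp add: \<Theta>_def Y0 L_zero)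
    ultimately show ?thesis by (simp add: algebra_simps)
  qed
  define E where "E n s = (\<Sum>i\<in>I n. m i * ((y s i)\<^sup>2 - Y s i * L (Y s) i))" for n s
  define \<phi> where "\<phi> n s = flux n (y s) (Y s) - flux n (Y s) (y s)" for n s
  have E_deriv: "(E n has_real_derivative 2 * (\<Sum>i\<in>I n. m i * y s i * \<Theta> s i) + \<phi> n s) (at s within {0..T})"
    if s: "s \<in> {0..T}" for n s
  proof -
    have "(E n has_real_derivative (\<Sum>i\<in>I n. m i * (2 * y s i * y' s i - (y s i * L (Y s) i + L (y s) i * Y s i))))
        (at s within {0..T})"
      unfolding E_def
      by (intro DERIV_sum DERIV_cmult DERIV_diff DERIV_mult Y L_deriv s)
         (auto intro!: derivative_eq_intros y s)
    also have "(\<Sum>i\<in>I n. m i * (2 * y s i * y' s i - (y s i * L (Y s) i + L (y s) i * Y s i))) =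
        2 * (\<Sum>i\<in>I n. m i * y s i * \<Theta> s i) + (\<Sum>i\<in>I n. m i * (y s i * L (Y s) i - Y s i * L (y s) i))"
      unfolding sum_distrib_left sum.distrib[symmetric] \<Theta>_def by (intro sum.cong refl) (simp add: algebra_simps)
    finally show ?thesis unfolding L_symmetric \<phi>_def .
  qed
  have sub: "{0..t} \<subseteq> {0..T}" using t by auto
  have \<phi>_cont: "continuous_on {0..t} (\<phi> n)" for n
    unfolding \<phi>_def
    by (intro continuous_intros flux_continuous continuous_on_subset[OF cont_y sub] continuous_on_subset[OF cont_Y sub])
  have \<phi>_int: "\<phi> n integrable_on {0..t}" for n
    using \<phi>_cont by (rule integrable_continuous_real)
  define K where "K = max (M\<^sup>2) ((T * M)\<^sup>2)"
  have K: "sq_sum m (I n) (y s) \<le> K" "sq_sum m (I n) (Y s) \<le> K" if "s \<in> {0..T}" for s n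
    using M[OF that, of n] YM[OF that, of n] by (auto simp: K_def)
  obtain C where C: "\<And>n v w. (\<forall>n. sq_sum m (I n) v \<le> K) \<Longrightarrow>
        (\<forall>n. sq_sum m (I n) w \<le> K) \<Longrightarrow> \<bar>flux n v w\<bar> \<le> C"
    using flux_bounded[of K] by blast
  \<comment> \<open>Convergence is only pointwise in time; the common norm bound \<open>K\<close>
    for y and Y provides the constant majorant.\<close>
  have "(\<lambda>n. integral {0..t} (\<phi> n)) \<longlonglongrightarrow> integral {0..t} (\<lambda>_. 0)"
  proof (rule dominated_convergence(2)[where h = "\<lambda>_. 2 * C"])
    show "norm (\<phi> n s) \<le> 2 * C" if "s \<in> {0..t}" for n s
    proof -
      have s: "s \<in> {0..T}" using that sub by auto
      show ?thesis
        using C[where n = n and v = "y s" and w = "Y s"] C[where n = n and v = "Y s" and w = "y s"] K[OF s] unfolding \<phi>_def by auto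
    qed
    show "(\<lambda>n. \<phi> n s) \<longlonglongrightarrow> 0" if "s \<in> {0..t}" for s
    proof -
      have s: "s \<in> {0..T}" using that sub by auto
      show ?thesis unfolding \<phi>_def
        using tendsto_diff[OF flux_tendsto_0[OF K(1)[OF s] K(2)[OF s]] flux_tendsto_0[OF K(2)[OF s] K(1)[OF s]]] by simp
    qed
  qed (use \<phi>_int in auto)
  then have lim\<phi>: "(\<lambda>n. integral {0..t} (\<phi> n)) \<longlonglongrightarrow> 0" by simp
  have limY: "(\<lambda>n. flux n (Y t) (Y t)) \<longlonglongrightarrow> 0"
    by (rule flux_tendsto_0[OF K(2)[OF t] K(2)[OF t]])
  \<comment> \<open>The norm over the fixed section k is estimated through a larger section n, so
    that n can tend to infinity.\<close>
  have step: "sq_sum m (I k) (y t)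
      \<le> B\<^sup>2 + M * (2 * T * (1 + T) * B) + (integral {0..t} (\<phi> n) + flux n (Y t) (Y t))" if "n \<ge> k" for n
  proof -
    have FTC: "((\<lambda>s. 2 * (\<Sum>i\<in>I n. m i * y s i * \<Theta> s i) + \<phi> n s) has_integral E n t - E n 0) {0..t}"
      using t E_deriv
      by (intro fundamental_theorem_of_calculus)
         (auto simp: has_real_derivative_iff_has_vector_derivative[symmetric] intro!: DERIV_subset[OF E_deriv])
    have "((\<lambda>s. 2 * (M * ((1 + T) * B)) + \<phi> n s) has_integral 2 * (M * ((1 + T) * B)) * t + integral {0..t} (\<phi> n)) {0..t}"
      using has_integral_add[OF has_integral_const_real[of "2 * (M * ((1 + T) * B))" 0 t] integrable_integral[OF \<phi>_int[of n]]] t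
      by (simp add: mult.commute)
    with FTC have "E n t - E n 0 \<le> 2 * (M * ((1 + T) * B)) * t + integral {0..t} (\<phi> n)"
    proof (rule has_integral_le)
      fix s assume "s \<in> {0..t}"
      then have s: "s \<in> {0..T}" using sub by auto
      have "sq_sum m (I n) (\<Theta> s) \<le> (\<Sum>i\<in>I n. (1 + T)\<^sup>2 * (m i * (\<rho> i)\<^sup>2))"
      proof (intro sum_mono)
        fix i
        have "(\<Theta> s i)\<^sup>2 \<le> ((1 + T) * \<rho> i)\<^sup>2"
          using power_mono[OF \<Theta>_bound[OF s, of i], of 2] by simp
        then show "m i * (\<Theta> s i)\<^sup>2 \<le> (1 + T)\<^sup>2 * (m i * (\<rho> i)\<^sup>2)"
          using mult_left_mono[of "(\<Theta> s i)\<^sup>2" "((1 + T) * \<rho> i)\<^sup>2" "m i"] m_nonneg[of i]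
          by (simp add: power_mult_distrib mult.left_commute)
      qed
      also have "\<dots> \<le> ((1 + T) * B)\<^sup>2"
        unfolding sum_distrib_left[symmetric] power_mult_distrib by (intro mult_left_mono \<rho>) auto
      finally have "\<bar>\<Sum>i\<in>I n. m i * y s i * \<Theta> s i\<bar> \<le> M * ((1 + T) * B)"
        by (intro weighted_Cauchy_Schwarz) (use M[OF s] M0 B T in \<open>auto simp: m_nonneg\<close>)
      then show "2 * (\<Sum>i\<in>I n. m i * y s i * \<Theta> s i) + \<phi> n s \<le> 2 * (M * ((1 + T) * B)) + \<phi> n s"
        by simp
    qed
    moreover have "2 * (M * ((1 + T) * B)) * t \<le> 2 * (M * ((1 + T) * B)) * T"
      using t M0 B T by (intro mult_left_mono) auto
    moreover have "E n 0 \<le> B\<^sup>2"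
    proof -
      have "E n 0 \<le> sq_sum m (I n) \<rho>"
        unfolding E_def Y0
        by (intro sum_mono mult_left_mono) (use init(1) m_nonneg in \<open>auto simp: abs_le_square_iff[symmetric] intro: order_trans[OF _ abs_ge_self]\<close>)
      then show ?thesis using \<rho>[of n] by simp
    qed
    moreover have "sq_sum m (I n) (y t) = E n t + (\<Sum>i\<in>I n. m i * (Y t i * L (Y t) i))"
      unfolding E_def sum.distrib[symmetric] by (intro sum.cong refl) (simp add: algebra_simps)
    moreover have "sq_sum m (I k) (y t) \<le> sq_sum m (I n) (y t)"
      by (intro sum_mono2 finite_I mono_I that) (simp add: m_nonneg)
    moreover have "2 * (M * ((1 + T) * B)) * T = M * (2 * T * (1 + T) * B)" by (simp add: algebra_simps)
    ultimately show ?thesis using L_dissipative[where n = n and v = "Y t"] by linarith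
  qed
  have "(\<lambda>n. B\<^sup>2 + M * (2 * T * (1 + T) * B) + (integral {0..t} (\<phi> n) + flux n (Y t) (Y t)))
      \<longlonglongrightarrow> B\<^sup>2 + M * (2 * T * (1 + T) * B) + (0 + 0)"
    by (intro tendsto_intros lim\<phi> limY)
  then show ?thesis
    using step by (intro LIMSEQ_le_const[where a = "\<Sum>i\<in>I k. m i * (y t i)\<^sup>2"]) auto
qed

text \<open>K only makes the supremum of the norms finite. The preceding estimate with M equal to
  that supremum then bounds it independently of K.\<close>

lemma energy_estimate:
  fixes y :: "real \<Rightarrow> 'i \<Rightarrow> real"
  assumes T: "T \<ge> 0"
    and y: "\<And>t i. t \<in> {0..T} \<Longrightarrow> ((\<lambda>s. y s i) has_real_derivative y' t i) (at t within {0..T})"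
    and y': "\<And>t i. t \<in> {0..T} \<Longrightarrow>
        ((\<lambda>s. y' s i) has_real_derivative L (y t) i + R t i) (at t within {0..T})"
    and R: "\<And>t i. t \<in> {0..T} \<Longrightarrow> \<bar>R t i\<bar> \<le> \<rho> i"
    and init: "\<And>i. \<bar>y 0 i\<bar> \<le> \<rho> i" "\<And>i. \<bar>y' 0 i\<bar> \<le> \<rho> i"
    and \<rho>: "\<And>n. sq_sum m (I n) \<rho> \<le> B\<^sup>2" and B: "B \<ge> 0"
    and bdd: "\<And>t n. t \<in> {0..T} \<Longrightarrow> sq_sum m (I n) (y t) \<le> K"
    and t: "t \<in> {0..T}"
  shows "sq_sum m (I n) (y t) \<le> ((1 + 2 * T * (1 + T)) * B)\<^sup>2"
proof -
  define X where "X = (\<lambda>(t, n). \<Sum>i\<in>I n. m i * (y t i)\<^sup>2) ` ({0..T} \<times> UNIV)"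
  define M where "M = sqrt (Sup X)"
  have X: "X \<noteq> {}" "bdd_above X" using t bdd by (auto simp: X_def intro!: bdd_aboveI[of _ K])
  have "sq_sum m (I n) (y t) \<in> X" using t by (force simp: X_def)
  moreover have "sq_sum m (I n) (y t) \<ge> 0" by (intro sum_nonneg) (simp add: m_nonneg)
  ultimately have "Sup X \<ge> 0" using cSup_upper[OF _ X(2)] order_trans by blast
  then have M: "M\<^sup>2 = Sup X" "M \<ge> 0" by (simp_all add: M_def)
  have le: "sq_sum m (I n) (y t) \<le> M\<^sup>2" if "t \<in> {0..T}" for t n
    unfolding M(1) by (rule cSup_upper[OF _ X(2)]) (use that in \<open>force simp: X_def\<close>)
  have "M\<^sup>2 \<le> B\<^sup>2 + M * (2 * T * (1 + T) * B)"
    unfolding M(1)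
  proof (rule cSup_least[OF X(1)])
    fix x assume "x \<in> X"
    then obtain t n where t: "t \<in> {0..T}" and x: "x = sq_sum m (I n) (y t)" by (auto simp: X_def)
    show "x \<le> B\<^sup>2 + M * (2 * T * (1 + T) * B)"
      unfolding x
      by (rule energy_identity_limit[where y = y and y' = y' and R = R and \<rho> = \<rho> and B = B and M = M and T = T])
         (rule T, erule y, erule y', erule R, rule init(1), rule init(2), rule \<rho>, rule B, erule le, rule M(2), rule t)
  qed
  then have "M \<le> B + 2 * T * (1 + T) * B" by (rule quadratic_self_bound) (use B T in simp_all)
  also have "\<dots> = (1 + 2 * T * (1 + T)) * B" by (simp add: algebra_simps)
  finally have "M\<^sup>2 \<le> ((1 + 2 * T * (1 + T)) * B)\<^sup>2" using M(2) by (rule power_mono)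
  then show ?thesis using le[OF t, of n] by simp
qed

end

section \<open>Finite speed of propagation for the wave equation\<close>

text \<open>Derivative witnesses are determined for t >= 0 only, so they have to be exchangeable up
  to their values there.\<close>

lemma Ck_halfplane_cong:
  assumes "Ck_halfplane k f" "\<And>x t. t \<ge> 0 \<Longrightarrow> f x t = g x t"
  shows "Ck_halfplane k g"
proof -
  have cont: "continuous_on (UNIV \<times> {0..}) (\<lambda>(x, t). f x t) \<longleftrightarrow> continuous_on (UNIV \<times> {0..}) (\<lambda>(x, t). g x t)"
    by (rule continuous_on_cong) (auto simp: assms(2))
  have x: "((\<lambda>y. f y t) has_real_derivative d) (at x) \<longleftrightarrow> ((\<lambda>y. g y t) has_real_derivative d) (at x)"
    if "t \<ge> 0" for x t d
    using assms(2)[OF that] by simp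
  have t: "((\<lambda>s. f x s) has_real_derivative d) (at t within {0..}) \<longleftrightarrow>
      ((\<lambda>s. g x s) has_real_derivative d) (at t within {0..})" if "t \<ge> 0" for x t d
    by (rule has_field_derivative_cong_eventually)
       (use that assms(2) in \<open>auto simp: eventually_at_filter\<close>)
  show ?thesis
    using assms(1) by (cases k) (simp_all add: cont x t cong: conj_cong)
qed

lemma at_within_atLeast_neq_bot:
  fixes t :: real
  assumes "t \<ge> 0"
  shows "at t within {0..} \<noteq> bot"
proof
  assume "at t within {0..} = bot"
  moreover have "at_right t \<le> at t within {0..}" using assms by (intro at_le) auto
  ultimately show False by (simp add: bot_unique)
qed

lemma has_real_derivative_unique_atLeast:
  assumes "t \<ge> 0" "(f has_real_derivative a) (at t within {0..})" "(f has_real_derivative b) (at t within {0..})"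
  shows "a = b"
  using assms tendsto_unique[OF at_within_atLeast_neq_bot] unfolding has_field_derivative_iff by blast

text \<open>\<open>Ck_halfplane\<close> asserts its derivatives anew for every k, so the witnesses
  might depend on k. Uniqueness of derivatives makes all of them agree on t >= 0 with those for k =
  0.\<close>

lemma smooth_halfplane_derivatives:
  assumes "smooth_halfplane f"
  obtains fx ft where
    "\<And>x t. t \<ge> 0 \<Longrightarrow> ((\<lambda>y. f y t) has_real_derivative fx x t) (at x)"
    "\<And>x t. t \<ge> 0 \<Longrightarrow> ((\<lambda>s. f x s) has_real_derivative ft x t) (at t within {0..})"
    "smooth_halfplane fx" "smooth_halfplane ft"
proof -
  define P where "P k fx ft \<longleftrightarrow>
        (\<forall>x. \<forall>t\<ge>0. ((\<lambda>y. f y t) has_real_derivative fx x t) (at x)) \<and>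
        (\<forall>x. \<forall>t\<ge>0. ((\<lambda>s. f x s) has_real_derivative ft x t) (at t within {0..})) \<and>
        Ck_halfplane k fx \<and> Ck_halfplane k ft" for k fx ft
  have "Ck_halfplane (Suc k) f" for k using assms unfolding smooth_halfplane_def by blast
  then have "\<exists>fx ft. P k fx ft" for k unfolding P_def Ck_halfplane.simps by blast
  then obtain fx ft where P: "\<And>k. P k (fx k) (ft k)" by metis
  have fx: "\<And>k x t. t \<ge> 0 \<Longrightarrow> ((\<lambda>y. f y t) has_real_derivative fx k x t) (at x)" and
    ft: "\<And>k x t. t \<ge> 0 \<Longrightarrow> ((\<lambda>s. f x s) has_real_derivative ft k x t) (at t within {0..})" and
    C: "\<And>k. Ck_halfplane k (fx k)" "\<And>k. Ck_halfplane k (ft k)"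
    using P unfolding P_def by blast+
  have eqx: "fx k x t = fx 0 x t" if "t \<ge> 0" for k x t
    using DERIV_unique[OF fx[OF that] fx[OF that]] .
  have eqt: "ft k x t = ft 0 x t" if "t \<ge> 0" for k x t
    using has_real_derivative_unique_atLeast[OF that ft[OF that] ft[OF that]] .
  have "smooth_halfplane (fx 0)" "smooth_halfplane (ft 0)"
    unfolding smooth_halfplane_def
    by (rule allI, rule Ck_halfplane_cong[OF C(1) eqx], assumption)
       (rule allI, rule Ck_halfplane_cong[OF C(2) eqt], assumption)
  then show ?thesis
    by (intro that[of "fx 0" "ft 0"] fx ft)
qed

lemma smooth_halfplane_continuous:
  assumes "smooth_halfplane f"
  shows "continuous_on (UNIV \<times> {0..}) (\<lambda>(x, t). f x t)"
  using assms unfolding smooth_halfplane_def by (metis Ck_halfplane.simps(1))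

lemma smooth_halfplane_bounded:
  assumes "smooth_halfplane f"
  obtains M where "M \<ge> 0" "\<And>x t. \<bar>x\<bar> \<le> R \<Longrightarrow> t \<in> {0..T} \<Longrightarrow> \<bar>f x t\<bar> \<le> M"
proof -
  have "compact ((\<lambda>(x, t). f x t) ` ({-R..R} \<times> {0..T}))"
    by (intro compact_continuous_image continuous_on_subset[OF smooth_halfplane_continuous[OF assms]] compact_Times)
       auto
  then obtain M where M: "\<forall>y\<in>(\<lambda>(x, t). f x t) ` ({-R..R} \<times> {0..T}). norm y \<le> M"
    using compact_imp_bounded bounded_iff by metis
  show ?thesis
  proof
    show "\<bar>f x t\<bar> \<le> max M 0" if "\<bar>x\<bar> \<le> R" "t \<in> {0..T}" for x t
    proof -
      have "f x t \<in> (\<lambda>(x, t). f x t) ` ({-R..R} \<times> {0..T})" using that by (force simp: abs_le_iff)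
      then have "norm (f x t) \<le> M" using M by blast
      then show ?thesis by simp
    qed
  qed simp
qed

lemma smooth_halfplane_tower:
  assumes "smooth_halfplane f"
  obtains D where "D 0 = f" "\<And>k. smooth_halfplane (D k)"
    "\<And>k x t. t \<ge> 0 \<Longrightarrow> ((\<lambda>y. D k y t) has_real_derivative D (Suc k) x t) (at x)"
proof -
  let ?P = "\<lambda>k g. smooth_halfplane g \<and> (k = 0 \<longrightarrow> g = f)"
  let ?Q = "\<lambda>k g g'. \<forall>x. \<forall>t\<ge>0. ((\<lambda>y. g y t) has_real_derivative g' x t) (at x)"
  have "\<exists>D. \<forall>k. ?P k (D k) \<and> ?Q k (D k) (D (Suc k))"
  proof (rule dependent_nat_choice)
    show "\<exists>g. ?P 0 g" using assms by blast
    show "\<exists>g'. ?P (Suc k) g' \<and> ?Q k g g'" if "?P k g" for g k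
      using smooth_halfplane_derivatives[of g] that by (metis nat.distinct(1))
  qed
  then show ?thesis using that by blast
qed

lemma integral_represents:
  fixes g :: "real \<Rightarrow> real"
  assumes "\<And>s. s \<ge> 0 \<Longrightarrow> (g has_real_derivative g' s) (at s within {0..})" "t \<ge> 0"
  shows "(g' has_integral g t - g 0) {0..t}"
proof (rule fundamental_theorem_of_calculus[OF assms(2)])
  show "(g has_vector_derivative g' s) (at s within {0..t})" if "s \<in> {0..t}" for s
    unfolding has_real_derivative_iff_has_vector_derivative[symmetric]
    by (rule DERIV_subset[OF assms(1)]) (use that in auto)
qed

text \<open>Differentiating the time integral of \<open>ut\<close> under the integral sign
  represents \<open>ux\<close> as a time integral of \<open>utx\<close>, and the fundamental theorem
  of calculus yields its time derivative. This covers t = 0, where time derivatives are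
  one-sided.\<close>

lemma mixed_partials:
  assumes ux: "\<And>x t. t \<ge> 0 \<Longrightarrow> ((\<lambda>y. u y t) has_real_derivative ux x t) (at x)"
    and ut: "\<And>x t. t \<ge> 0 \<Longrightarrow> ((\<lambda>s. u x s) has_real_derivative ut x t) (at t within {0..})"
    and utx: "\<And>x t. t \<ge> 0 \<Longrightarrow> ((\<lambda>y. ut y t) has_real_derivative utx x t) (at x)"
    and uxt: "\<And>x t. t \<ge> 0 \<Longrightarrow> ((\<lambda>s. ux x s) has_real_derivative uxt x t) (at t within {0..})"
    and cont: "continuous_on (UNIV \<times> {0..}) (\<lambda>(x, t). utx x t)"
    and t: "t \<ge> 0"
  shows "uxt x t = utx x t"
proof -
  have ux_eq: "ux x s - ux x 0 = integral {0..s} (utx x)" if s: "s \<ge> 0" for s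
  proof -
    have "((\<lambda>y. integral (cbox 0 s) (ut y)) has_field_derivative integral (cbox 0 s) (utx x)) (at x within UNIV)"
    proof (rule leibniz_rule_field_derivative)
      show "ut y integrable_on cbox 0 s" for y
        using integral_represents[OF ut s, of y] by auto
      show "continuous_on (UNIV \<times> cbox 0 s) (\<lambda>(x, t). utx x t)"
        by (rule continuous_on_subset[OF cont]) auto
    qed (auto intro: utx)
    moreover have "integral (cbox 0 s) (ut y) = u y s - u y 0" for y
      using integral_represents[OF ut s, of y] by (simp add: integral_unique)
    ultimately have "((\<lambda>y. u y s - u y 0) has_field_derivative integral {0..s} (utx x)) (at x)" by simp
    moreover have "((\<lambda>y. u y s - u y 0) has_field_derivative ux x s - ux x 0) (at x)"
      by (intro DERIV_diff ux s) simp
    ultimately show ?thesis by (rule DERIV_unique[symmetric])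
  qed
  have "continuous_on {0..t + 1} (utx x)"
    using continuous_on_compose2[OF cont, of "{0..t + 1}" "\<lambda>s. (x, s)"] by (force intro!: continuous_intros)
  then have "((\<lambda>s. integral {0..s} (utx x)) has_real_derivative utx x t) (at t within {0..t + 1})"
    by (rule integral_has_real_derivative) (use t in auto)
  then have d1: "((\<lambda>s. ux x 0 + integral {0..s} (utx x)) has_real_derivative utx x t) (at t within {0..t + 1})"
    by (auto intro!: derivative_eq_intros)
  have d2: "((\<lambda>s. ux x 0 + integral {0..s} (utx x)) has_real_derivative uxt x t) (at t within {0..t + 1})"
  proof (rule has_field_derivative_transform_within[where f = "ux x" and d = 1])
    show "(ux x has_real_derivative uxt x t) (at t within {0..t + 1})"
      by (rule DERIV_subset[OF uxt[OF t]]) auto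
    show "ux x s = ux x 0 + integral {0..s} (utx x)" if "s \<in> {0..t + 1}" for s
      using ux_eq[of s] that by simp
  qed (use t in auto)
  have nb: "at t within {0..t + 1} \<noteq> bot"
    using t by (simp add: trivial_limit_within islimpt_Icc)
  show ?thesis
    using tendsto_unique[OF nb d2[unfolded has_field_derivative_iff] d1[unfolded has_field_derivative_iff]] .
qed

text \<open>Continuity of \<open>gt\<close> turns the partial derivatives into a total derivative
  within the closed half-plane, which is then composed with the line, one-sidedly at s = 0.\<close>

lemma chain_rule_halfplane_line:
  assumes gx: "\<And>x t. t \<ge> 0 \<Longrightarrow> ((\<lambda>y. g y t) has_real_derivative gx x t) (at x)"
    and gt: "\<And>x t. t \<ge> 0 \<Longrightarrow> ((\<lambda>s. g x s) has_real_derivative gt x t) (at t within {0..})"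
    and cont: "continuous_on (UNIV \<times> {0..}) (\<lambda>(x, t). gt x t)"
    and s: "s \<ge> 0"
  shows "((\<lambda>s. g (a + c * s) s) has_real_derivative c * gx (a + c * s) s + gt (a + c * s) s) (at s within {0..})"
proof -
  have 1: "((\<lambda>(x, t). g x t) has_derivative
      (\<lambda>(tx, ty). (gx (a + c * s) s * tx) + blinfun_apply (blinfun_mult_right (gt (a + c * s) s)) ty))
      (at (a + c * s, s) within UNIV \<times> {0..})"
  proof (rule has_derivative_partialsI)
    show "((\<lambda>x. g x s) has_derivative (*) (gx (a + c * s) s)) (at (a + c * s))"
      using gx[OF s] by (simp add: has_field_derivative_def)
    show "((\<lambda>t. g x t) has_derivative blinfun_apply (blinfun_mult_right (gt x t))) (at t within {0..})"
      if "t \<in> {0..}" for x t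
      using gt[of t x] that by (simp add: has_field_derivative_def)
    have "continuous_on (UNIV \<times> {0..}) (\<lambda>p. blinfun_mult_right (case p of (x, t) \<Rightarrow> gt x t))"
      by (intro bounded_linear.continuous_on[OF bounded_linear_blinfun_mult_right] cont)
    then show "continuous (at (a + c * s, s) within UNIV \<times> {0..}) (\<lambda>(x, t). blinfun_mult_right (gt x t))"
      using s by (auto simp: continuous_on_eq_continuous_within split_beta' split_beta)
  qed (use s in auto)
  have 2: "((\<lambda>s. (a + c * s, s)) has_derivative (\<lambda>d. (c * d, d))) (at s within {0..})"
    by (auto intro!: derivative_eq_intros)
  have "((\<lambda>s. (\<lambda>(x, t). g x t) (a + c * s, s)) has_derivative
      (\<lambda>d. (\<lambda>(tx, ty). (gx (a + c * s) s * tx) + blinfun_apply (blinfun_mult_right (gt (a + c * s) s)) ty) (c * d, d)))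
      (at s within {0..})"
    by (rule has_derivative_in_compose[OF 2 has_derivative_subset[OF 1]]) auto
  then show ?thesis
    by (simp add: has_field_derivative_def algebra_simps)
       (erule has_derivative_eq_rhs, simp add: fun_eq_iff algebra_simps)
qed

text \<open>Along \<open>dx/dt = c\<close> with \<open>c = \<plusminus>1\<close> the quantity \<open>u\<^sub>t - c u\<^sub>x\<close> has derivative \<open>u\<^bsub>tt\<^esub> - u\<^bsub>xx\<^esub> = F\<close>.\<close>

lemma wave_characteristic:
  assumes u: "smooth_halfplane u"
    and ux: "\<And>x t. t \<ge> 0 \<Longrightarrow> ((\<lambda>y. u y t) has_real_derivative ux x t) (at x)" "smooth_halfplane ux"
    and uxx: "\<And>x t. t \<ge> 0 \<Longrightarrow> ((\<lambda>y. ux y t) has_real_derivative uxx x t) (at x)"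
    and ut: "\<And>x t. t \<ge> 0 \<Longrightarrow> ((\<lambda>s. u x s) has_real_derivative ut x t) (at t within {0..})" "smooth_halfplane ut"
    and utt: "\<And>x t. t \<ge> 0 \<Longrightarrow> ((\<lambda>s. ut x s) has_real_derivative uxx x t + F x t) (at t within {0..})"
    and F0: "\<And>y s. s \<in> {0..t} \<Longrightarrow> \<bar>y - x\<bar> \<le> t \<Longrightarrow> F y s = 0"
    and init: "\<And>y. \<bar>y - x\<bar> \<le> t \<Longrightarrow> ux y 0 = 0" "\<And>y. \<bar>y - x\<bar> \<le> t \<Longrightarrow> ut y 0 = 0"
    and c: "\<bar>c\<bar> = 1" and t: "t \<ge> 0"
  shows "ut x t = c * ux x t"
proof -
  obtain utx utt' where utx: "\<And>x t. t \<ge> 0 \<Longrightarrow> ((\<lambda>y. ut y t) has_real_derivative utx x t) (at x)" "smooth_halfplane utx"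
    and utt': "\<And>x t. t \<ge> 0 \<Longrightarrow> ((\<lambda>s. ut x s) has_real_derivative utt' x t) (at t within {0..})" "smooth_halfplane utt'"
    using smooth_halfplane_derivatives[OF ut(2)] by metis
  obtain uxx' uxt where
    uxt: "\<And>x t. t \<ge> 0 \<Longrightarrow> ((\<lambda>s. ux x s) has_real_derivative uxt x t) (at t within {0..})" "smooth_halfplane uxt"
    using smooth_halfplane_derivatives[OF ux(2)] by metis
  have mixed: "uxt x t = utx x t" if "t \<ge> 0" for x t
    by (rule mixed_partials[OF ux(1) ut(1) utx(1) uxt(1) smooth_halfplane_continuous[OF utx(2)] that])
  have utt_eq: "utt' x t = uxx x t + F x t" if "t \<ge> 0" for x t
    by (rule has_real_derivative_unique_atLeast[OF that utt'(1)[OF that] utt[OF that]])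
  define g where "g y s = ut y s - c * ux y s" for y s
  \<comment> \<open>The foot at time 0 of the characteristic of speed c through (x, t).\<close>
  define a where "a = x - c * t"
  have c2: "c * c = 1" using abs_mult_self_eq[of c] c by simp
  have gd: "((\<lambda>s. g (a + c * s) s) has_real_derivative
      c * (utx (a + c * s) s - c * uxx (a + c * s) s) + (utt' (a + c * s) s - c * uxt (a + c * s) s)) (at s within {0..})"
    if "s \<ge> 0" for s
  proof (rule chain_rule_halfplane_line[OF _ _ _ that])
    show "((\<lambda>y. g y t) has_real_derivative utx x t - c * uxx x t) (at x)" if "t \<ge> 0" for x t
      unfolding g_def by (intro DERIV_diff DERIV_cmult utx uxx that)
    show "((\<lambda>s. g x s) has_real_derivative utt' x t - c * uxt x t) (at t within {0..})" if "t \<ge> 0" for x t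
      unfolding g_def by (intro DERIV_diff DERIV_cmult utt' uxt that)
    show "continuous_on (UNIV \<times> {0..}) (\<lambda>(x, t). utt' x t - c * uxt x t)"
      using smooth_halfplane_continuous[OF utt'(2)] smooth_halfplane_continuous[OF uxt(2)]
      by (auto simp: split_beta intro!: continuous_intros)
  qed
  have gz: "c * (utx (a + c * s) s - c * uxx (a + c * s) s) + (utt' (a + c * s) s - c * uxt (a + c * s) s) = 0"
    if s: "s \<in> {0..t}" for s
  proof -
    have "\<bar>a + c * s - x\<bar> = \<bar>c\<bar> * \<bar>s - t\<bar>"
      unfolding a_def abs_mult[symmetric] by (simp add: algebra_simps)
    then have "F (a + c * s) s = 0" using s c by (intro F0) auto
    moreover have "c * (c * z) = z" for z using c2 by (simp add: mult.assoc[symmetric])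
    ultimately show ?thesis using s by (simp add: mixed utt_eq algebra_simps)
  qed
  have "((\<lambda>s. g (a + c * s) s) has_field_derivative 0) (at s within {0..t})" if s: "s \<in> {0..t}" for s
    using DERIV_subset[OF gd[of s], of "{0..t}"] s by (simp add: gz[OF s])
  then obtain z where z: "\<And>s. s \<in> {0..t} \<Longrightarrow> g (a + c * s) s = z"
    using has_field_derivative_zero_constant[of "{0..t}" "\<lambda>s. g (a + c * s) s"] by auto
  have "g (a + c * t) t = g (a + c * 0) 0" using z[of t] z[of 0] t by simp
  moreover have "\<bar>a - x\<bar> \<le> t" using c t by (simp add: a_def abs_mult)
  ultimately show ?thesis using init by (simp add: g_def a_def)
qed

text \<open>Both characteristics apply at such points and give \<open>ut = ux\<close> and
  \<open>ut = - ux\<close>. Hence \<open>ut\<close> vanishes on the time segment from (x, 0) to (x,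
  t), and u keeps its initial value zero.\<close>

lemma wave_finite_speed:
  assumes u: "smooth_halfplane u"
    and ux: "\<And>x t. t \<ge> 0 \<Longrightarrow> ((\<lambda>y. u y t) has_real_derivative ux x t) (at x)" "smooth_halfplane ux"
    and uxx: "\<And>x t. t \<ge> 0 \<Longrightarrow> ((\<lambda>y. ux y t) has_real_derivative uxx x t) (at x)"
    and ut: "\<And>x t. t \<ge> 0 \<Longrightarrow> ((\<lambda>s. u x s) has_real_derivative ut x t) (at t within {0..})" "smooth_halfplane ut"
    and utt: "\<And>x t. t \<ge> 0 \<Longrightarrow> ((\<lambda>s. ut x s) has_real_derivative uxx x t + F x t) (at t within {0..})"
    and F0: "\<And>y s. s \<in> {0..T} \<Longrightarrow> \<bar>y\<bar> > r \<Longrightarrow> F y s = 0"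
    and init: "\<And>y. \<bar>y\<bar> > r \<Longrightarrow> u y 0 = 0" "\<And>y. \<bar>y\<bar> > r \<Longrightarrow> ut y 0 = 0"
    and t: "t \<in> {0..T}" and x: "\<bar>x\<bar> > r + T"
  shows "u x t = 0"
proof -
  have ux0: "ux y 0 = 0" if y: "\<bar>y\<bar> > r" for y
  proof -
    have "((\<lambda>y. 0) has_real_derivative ux y 0) (at y)"
    proof (rule has_field_derivative_transform_within_open[OF ux(1)])
      show "open {y::real. \<bar>y\<bar> > r}" by (intro open_Collect_less continuous_intros)
    qed (use y init(1) in auto)
    then show ?thesis using DERIV_unique DERIV_const by blast
  qed
  have "ut x s = 0" if s: "s \<in> {0..t}" for s
  proof -
    have *: "\<bar>y\<bar> > r" if "\<bar>y - x\<bar> \<le> s" for y using that s t x by auto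
    have "ut x s = c * ux x s" if "\<bar>c\<bar> = 1" for c
      by (rule wave_characteristic[OF u ux uxx ut utt _ _ _ that])
         (use s t F0 init(2) ux0 * in auto)
    from this[of 1] this[of "-1"] show ?thesis by simp
  qed
  then have "((\<lambda>_. 0) has_integral u x t - u x 0) {0..t}"
    by (rule has_integral_eq[OF _ integral_represents[OF ut(1)]]) (use t in auto)
  then have "u x t - u x 0 = 0" by (rule has_integral_unique) simp
  then show ?thesis using init(1)[of x] x t by simp
qed

section \<open>Exponentially weighted bounds for the exact solution\<close>

lemma compact_support_radius:
  assumes "compact (closure S)"
  obtains r where "\<And>x::real. \<bar>x\<bar> > r \<Longrightarrow> x \<notin> S"
proof -
  obtain r where "\<forall>x\<in>closure S. norm x \<le> r" using assms compact_imp_bounded bounded_iff by metis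
  then show ?thesis using that[of r] closure_subset[of S] by (metis linorder_not_le real_norm_def subsetD)
qed

text \<open>The unnamed derivatives in \<open>cauchy_solution\<close> are identified with the tower
  by uniqueness. Finite speed bounds the support of U on [0, T], and all space derivatives inherit
  it. The result is recorded with the weight exp(-|x|), which layers and profiles satisfy too,
  although their support is not bounded.\<close>

lemma cauchy_solution_tower:
  assumes F: "compact_support_in_space F" and f1: "compact_support f1" and f2: "compact_support f2"
    and U: "smooth_halfplane U" "cauchy_solution F f1 f2 U" and T: "T \<ge> 0"
  obtains D Ut where "D 0 = U" "\<And>k. smooth_halfplane (D k)"
    "\<And>k x t. t \<ge> 0 \<Longrightarrow> ((\<lambda>y. D k y t) has_real_derivative D (Suc k) x t) (at x)"
    "\<And>x t. t \<ge> 0 \<Longrightarrow> ((\<lambda>s. U x s) has_real_derivative Ut x t) (at t within {0..})"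
    "\<And>x t. t \<ge> 0 \<Longrightarrow> ((\<lambda>s. Ut x s) has_real_derivative D 2 x t + F x t) (at t within {0..})"
    "\<And>x. U x 0 = f1 x" "\<And>x. Ut x 0 = f2 x"
    "\<And>k. \<exists>M\<ge>0. \<forall>x. \<forall>t\<in>{0..T}. \<bar>D k x t\<bar> \<le> M * exp (- \<bar>x\<bar>)"
proof -
  obtain D where D: "D 0 = U" "\<And>k. smooth_halfplane (D k)"
    "\<And>k x t. t \<ge> 0 \<Longrightarrow> ((\<lambda>y. D k y t) has_real_derivative D (Suc k) x t) (at x)"
    using smooth_halfplane_tower[OF U(1)] by metis
  obtain Ut Utt Ux Uxx where sol: "\<forall>x. \<forall>t\<ge>0.
           ((\<lambda>s. U x s) has_real_derivative Ut x t) (at t within {0..}) \<and>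
           ((\<lambda>s. Ut x s) has_real_derivative Utt x t) (at t within {0..}) \<and>
           ((\<lambda>y. U y t) has_real_derivative Ux x t) (at x) \<and>
           ((\<lambda>y. Ux y t) has_real_derivative Uxx x t) (at x) \<and>
           Utt x t = Uxx x t + F x t" and init: "\<forall>x. U x 0 = f1 x \<and> Ut x 0 = f2 x"
    using U(2) unfolding cauchy_solution_def by (elim conjE exE) (rule that, assumption+)
  have Ux: "Ux x t = D 1 x t" if "t \<ge> 0" for x t
    by (rule DERIV_unique[where f = "\<lambda>y. U y t" and x = x]) (use sol that D(3)[OF that, of 0] in \<open>auto simp: D(1)\<close>)
  have Uxx: "Uxx x t = D 2 x t" if "t \<ge> 0" for x t
    by (rule DERIV_unique[where f = "\<lambda>y. Ux y t" and x = x])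
       (use sol that D(3)[OF that, of 1] in \<open>auto simp: Ux numeral_2_eq_2\<close>)
  have Ut: "((\<lambda>s. U x s) has_real_derivative Ut x t) (at t within {0..})"
    "((\<lambda>s. Ut x s) has_real_derivative D 2 x t + F x t) (at t within {0..})" if "t \<ge> 0" for x t
    using sol[rule_format, OF that, of x] Uxx[OF that, of x] by auto
  obtain Ux' V where V: "\<And>x t. t \<ge> 0 \<Longrightarrow> ((\<lambda>s. U x s) has_real_derivative V x t) (at t within {0..})"
    "smooth_halfplane V"
    using smooth_halfplane_derivatives[OF U(1)] by metis
  have VUt: "V x t = Ut x t" if "t \<ge> 0" for x t
    by (rule has_real_derivative_unique_atLeast[OF that V(1)[OF that] Ut(1)[OF that]])
  have smooth_Ut: "smooth_halfplane Ut"
    unfolding smooth_halfplane_def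
    by (rule allI, rule Ck_halfplane_cong[OF V(2)[unfolded smooth_halfplane_def, rule_format] VUt], assumption)
  obtain r1 where r1: "\<And>x. \<bar>x\<bar> > r1 \<Longrightarrow> f1 x = 0"
    by (rule compact_support_radius[OF f1[unfolded compact_support_def]], rule that, simp)
  obtain r2 where r2: "\<And>x. \<bar>x\<bar> > r2 \<Longrightarrow> f2 x = 0"
    by (rule compact_support_radius[OF f2[unfolded compact_support_def]], rule that, simp)
  have "compact (closure {x. \<exists>t\<in>{0..T}. F x t \<noteq> 0})" using F T unfolding compact_support_in_space_def by blast
  then obtain r3 where r3: "\<And>x t. \<bar>x\<bar> > r3 \<Longrightarrow> t \<in> {0..T} \<Longrightarrow> F x t = 0"
    by (rule compact_support_radius, intro that, blast)
  define r where "r = max r1 (max r2 r3)"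
  \<comment> \<open>Openness lets the vanishing of \<open>D k\<close> on this set pass to its space
    derivative.\<close>
  define X where "X = {x::real. \<bar>x\<bar> > r + T}"
  have X: "open X" unfolding X_def by (intro open_Collect_less continuous_intros)
  have vanish: "D k x t = 0" if "x \<in> X" "t \<in> {0..T}" for k x t
    using that
  proof (induction k arbitrary: x)
    case 0
    have "U x t = 0"
      by (rule wave_finite_speed[where ux = "D 1" and uxx = "D 2" and F = F and ut = Ut and r = r and T = T])
         (use 0 U(1) D(2) D(3)[of _ 0] D(3)[of _ 1] Ut smooth_Ut r1 r2 r3 init in
           \<open>auto simp: r_def D(1) X_def numeral_2_eq_2\<close>)
    then show ?case by (simp add: D(1))
  next
    case (Suc k)
    have "((\<lambda>y. 0) has_real_derivative D (Suc k) x t) (at x)"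
      by (rule has_field_derivative_transform_within_open[OF D(3) X Suc.prems(1)])
         (use Suc in auto)
    then show ?case using DERIV_unique DERIV_const by blast
  qed
  have bound: "\<exists>M\<ge>0. \<forall>x. \<forall>t\<in>{0..T}. \<bar>D k x t\<bar> \<le> M * exp (- \<bar>x\<bar>)" for k
  proof -
    obtain M where M: "M \<ge> 0" "\<And>x t. \<bar>x\<bar> \<le> r + T \<Longrightarrow> t \<in> {0..T} \<Longrightarrow> \<bar>D k x t\<bar> \<le> M"
      using smooth_halfplane_bounded[OF D(2)] by metis
    have "\<bar>D k x t\<bar> \<le> (M * exp (r + T)) * exp (- \<bar>x\<bar>)" if t: "t \<in> {0..T}" for x t
    proof (cases "x \<in> X")
      case True
      then show ?thesis using vanish t M(1) by simp
    next
      case False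
      then have x: "\<bar>x\<bar> \<le> r + T" by (simp add: X_def)
      have "M * 1 \<le> M * exp (r + T - \<bar>x\<bar>)" using x M(1) by (intro mult_left_mono) auto
      then show ?thesis using M(2)[OF x t] by (simp add: exp_diff exp_minus divide_inverse)
    qed
    then show ?thesis using M(1) by (intro exI[of _ "M * exp (r + T)"]) auto
  qed
  show ?thesis
    by (rule that[OF D Ut _ _ bound]) (use init in auto)
qed

section \<open>The scheme as a symmetric dissipative system\<close>

text \<open>Linear functionals of finitely many coordinates. Induction gives linearity and
  differentiation in time without any topology on grid functions.\<close>

inductive finite_row :: "(('i \<Rightarrow> real) \<Rightarrow> real) \<Rightarrow> bool" where
  finite_row_coordinate: "finite_row (\<lambda>v. v k)"
| finite_row_add: "finite_row f \<Longrightarrow> finite_row g \<Longrightarrow> finite_row (\<lambda>v. f v + g v)"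
| finite_row_cmult: "finite_row f \<Longrightarrow> finite_row (\<lambda>v. c * f v)"

lemma finite_row_zero: "finite_row f \<Longrightarrow> f (\<lambda>_. 0) = 0"
  by (induction rule: finite_row.induct) auto

lemma finite_row_linear: "finite_row f \<Longrightarrow> f (\<lambda>i. a * v i + b * w i) = a * f v + b * f w"
  by (induction rule: finite_row.induct) (simp_all add: algebra_simps)

lemma finite_row_deriv:
  assumes "finite_row f" "\<And>k. ((\<lambda>s. V s k) has_real_derivative V' k) (at t within S)"
  shows "((\<lambda>s. f (V s)) has_real_derivative f V') (at t within S)"
  using assms(1) by induction (auto intro: assms(2) DERIV_add DERIV_cmult)

lemma finite_row_diff: "finite_row f \<Longrightarrow> finite_row g \<Longrightarrow> finite_row (\<lambda>v. f v - g v)"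
  using finite_row_add[OF _ finite_row_cmult[of g "-1"]] by auto

lemma finite_row_divide: "finite_row f \<Longrightarrow> finite_row (\<lambda>v. f v / c)"
  using finite_row_cmult[of f "1 / c"] by auto

lemma finite_row_mult_right: "finite_row f \<Longrightarrow> finite_row (\<lambda>v. f v * c)"
  using finite_row_cmult[of f c] by (auto simp: mult.commute)

lemma finite_row_minus: "finite_row f \<Longrightarrow> finite_row (\<lambda>v. - f v)"
  using finite_row_cmult[of f "-1"] by auto

lemma finite_row_const_0: "finite_row (\<lambda>_. 0)"
  using finite_row_cmult[OF finite_row_coordinate, of 0] by auto

lemma finite_row_sum: "(\<And>k. k \<in> K \<Longrightarrow> finite_row (f k)) \<Longrightarrow> finite_row (\<lambda>v. \<Sum>k\<in>K. f k v)"
  by (induction K rule: infinite_finite_induct) (auto intro: finite_row_add finite_row_const_0)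

lemmas finite_row_intros = finite_row_coordinate finite_row_add finite_row_diff finite_row_minus finite_row_cmult
  finite_row_divide finite_row_mult_right finite_row_sum

lemma finite_row_sbp_D: "finite_row (\<lambda>v. sbp_D ord h (\<lambda>j. v (g j)) j)"
  unfolding sbp_D_def Dplus_def Dminus_def apply_row_def
  by (cases "j < length (D_rows ord)"; cases "ord = 2") (simp_all, (intro finite_row_intros)+)

lemma finite_row_sbp_S0: "finite_row (\<lambda>v. sbp_S0 ord h (\<lambda>j. v (g j)))"
  unfolding sbp_S0_def apply_row_def by (intro finite_row_intros)

text \<open>Left and right grid functions are combined into one function on \<^typ>\<open>nat + nat\<close>.\<close>

definition scheme_op :: "nat \<Rightarrow> real \<Rightarrow> real \<Rightarrow> real \<Rightarrow> (nat + nat \<Rightarrow> real) \<Rightarrow> nat + nat \<Rightarrow> real" where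
  "scheme_op ord hL hR \<tau> v = case_sum (rhs_L ord hL hR \<tau> (\<lambda>j. v (Inl j)) (\<lambda>j. v (Inr j)))
     (rhs_R ord hL hR (- \<tau>) (\<lambda>j. v (Inl j)) (\<lambda>j. v (Inr j)))"

definition scheme_mass :: "nat \<Rightarrow> real \<Rightarrow> real \<Rightarrow> nat + nat \<Rightarrow> real" where
  "scheme_mass ord hL hR = case_sum (sbp_H ord hL) (sbp_H ord hR)"

definition scheme_flux ::
  "nat \<Rightarrow> real \<Rightarrow> real \<Rightarrow> nat \<Rightarrow> (nat + nat \<Rightarrow> real) \<Rightarrow> (nat + nat \<Rightarrow> real) \<Rightarrow> real" where
  "scheme_flux ord hL hR n v w =
     A_flux ord (\<lambda>j. v (Inl j)) (\<lambda>j. w (Inl j)) n / hL + A_flux ord (\<lambda>j. v (Inr j)) (\<lambda>j. w (Inr j)) n / hR"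

definition grid_section :: "nat \<Rightarrow> (nat + nat) set" where
  "grid_section n = {..<n + 4} <+> {..<n + 4}"

lemma sum_grid_section:
  "(\<Sum>i\<in>grid_section n. g i) = (\<Sum>j<n + 4. g (Inl j)) + (\<Sum>j<n + 4. g (Inr j) :: real)"
  by (simp add: grid_section_def sum.Plus)

lemma finite_row_scheme_op: "finite_row (\<lambda>v. scheme_op ord hL hR \<tau> v i)"
  by (cases i) (simp_all add: scheme_op_def rhs_L_def rhs_R_def jump_def jump_S_def,
      (intro finite_row_intros finite_row_sbp_D finite_row_sbp_S0)+)

lemma sbp_H_ge: "h > 0 \<Longrightarrow> sbp_H ord h j \<ge> h / 3"
  by (cases "j < 4")
     (auto simp: sbp_H_interior sbp_H_def nth_default_def dest!: less_4_cases)

lemma sbp_H_le: "h > 0 \<Longrightarrow> sbp_H ord h j \<le> 2 * h"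
  by (cases "j < 4")
     (auto simp: sbp_H_interior sbp_H_def nth_default_def dest!: less_4_cases)

lemma sbp_H_pos: "h > 0 \<Longrightarrow> sbp_H ord h j > 0"
  using sbp_H_ge[of h ord j] by simp

lemma scheme_mass_nonneg: "hL > 0 \<Longrightarrow> hR > 0 \<Longrightarrow> scheme_mass ord hL hR i \<ge> 0"
  by (auto simp: scheme_mass_def sbp_H_pos less_imp_le split: sum.split)

lemma sum_e0: "(\<Sum>j<n + 4. w j * (e0 j * c)) = w 0 * c"
proof -
  have "(\<Sum>j<n + 4. w j * (e0 j * c)) = (\<Sum>j<n + 4. if j = 0 then w 0 * c else 0)"
    by (rule sum.cong) (auto simp: e0_def)
  then show ?thesis by simp
qed

lemma sum_ST_e0:
  assumes "ord \<in> {2, 4}"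
  shows "(\<Sum>j<n + 4. w j * (sbp_ST_e0 ord h j * c)) = sbp_S0 ord h w * c"
proof -
  have "(\<Sum>j<n + 4. w j * (sbp_ST_e0 ord 1 j * k)) = sbp_S0 ord 1 w * k" for k
  proof -
    have "(\<Sum>j<n + 4. w j * (sbp_ST_e0 ord 1 j * k)) = (\<Sum>j<4. w j * (sbp_ST_e0 ord 1 j * k))"
      by (rule sum.mono_neutral_right) (auto simp: sbp_ST_e0_interior)
    also have "\<dots> = sbp_S0 ord 1 w * k"
      using assms unfolding sum_lessThan_4
      by (auto simp: sbp_boundary_rows_2 sbp_boundary_rows_4 algebra_simps simp del: One_nat_def)
    finally show ?thesis .
  qed
  from this[of "c / h"] show ?thesis
    unfolding sbp_S0_scale[of ord h] sbp_ST_e0_scale[of ord h] by simp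
qed

lemma sbp_H_D: "h > 0 \<Longrightarrow> sbp_H ord h j * sbp_D ord h v j = - (sbp_A ord 1 v j / h) - e0 j * sbp_S0 ord h v"
  using sbp_A_scale[of h ord v j] by (simp add: sbp_A_def)

text \<open>When the grids are exchanged \<open>jump\<close> changes sign and \<open>jump_S\<close>
  does not, which matches the opposite signs of the penalties. Estimates for the left grid thus
  transfer to the right one.\<close>

lemma rhs_R_mirror: "rhs_R ord hL hR \<tau> vL vR j = rhs_L ord hR hL (- \<tau>) vR vL j"
  by (simp add: rhs_L_def rhs_R_def jump_def jump_S_def algebra_simps diff_divide_distrib add_divide_distrib)

lemma rhs_L_pairing:
  fixes vL vR wL :: "nat \<Rightarrow> real"
  assumes ord: "ord \<in> {2, 4}" and h: "hL > 0"
  defines "d \<equiv> jump vL vR"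
  shows "(\<Sum>j<n + 4. sbp_H ord hL j * (wL j * rhs_L ord hL hR \<tau> vL vR j)) =
    - (\<Sum>j<n + 4. wL j * sbp_A ord 1 vL j) / hL + wL 0 / 2 * (sbp_S0 ord hR vR - sbp_S0 ord hL vL)
    - sbp_S0 ord hL wL * d / 2 - \<tau> * wL 0 * d"
proof -
  define J where "J = jump_S ord hL hR vL vR"
  have "(\<Sum>j<n + 4. sbp_H ord hL j * (wL j * rhs_L ord hL hR \<tau> vL vR j)) =
    (\<Sum>j<n + 4. - (wL j * sbp_A ord 1 vL j) / hL + wL j * (e0 j * (- sbp_S0 ord hL vL))
      + wL j * (sbp_ST_e0 ord hL j * (- d / 2)) + wL j * (e0 j * (- J / 2)) + wL j * (e0 j * (- \<tau> * d)))"
  proof (rule sum.cong[OF refl])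
    fix j
    have "sbp_H ord hL j * rhs_L ord hL hR \<tau> vL vR j = sbp_H ord hL j * sbp_D ord hL vL j
       - sbp_ST_e0 ord hL j * d / 2 - e0 j * J / 2 - \<tau> * e0 j * d"
      using sbp_H_pos[OF h, of ord j] by (simp add: rhs_L_def d_def J_def field_simps)
    then have "wL j * (sbp_H ord hL j * rhs_L ord hL hR \<tau> vL vR j) = wL j * (- (sbp_A ord 1 vL j / hL) - e0 j * sbp_S0 ord hL vL
       - sbp_ST_e0 ord hL j * d / 2 - e0 j * J / 2 - \<tau> * e0 j * d)"
      unfolding sbp_H_D[OF h] by simp
    then show "sbp_H ord hL j * (wL j * rhs_L ord hL hR \<tau> vL vR j) = - (wL j * sbp_A ord 1 vL j) / hL + wL j * (e0 j * (- sbp_S0 ord hL vL))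
      + wL j * (sbp_ST_e0 ord hL j * (- d / 2)) + wL j * (e0 j * (- J / 2)) + wL j * (e0 j * (- \<tau> * d))"
      by (simp add: algebra_simps)
  qed
  also have "\<dots> = - (\<Sum>j<n + 4. wL j * sbp_A ord 1 vL j) / hL - wL 0 * sbp_S0 ord hL vL
      - sbp_S0 ord hL wL * d / 2 - wL 0 * J / 2 - \<tau> * wL 0 * d"
    unfolding sum.distrib sum_e0 sum_ST_e0[OF ord]
    by (simp add: sum_negf sum_divide_distrib)
  finally show ?thesis by (simp add: J_def jump_S_def algebra_simps diff_divide_distrib add_divide_distrib)
qed

text \<open>Apart from the two forms of \<open>sbp_A\<close> the right side is symmetric in v and w.
  The factors 1/2 in the coupling terms and the opposite penalties on the two grids bring this
  about.\<close>

lemma scheme_pairing: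
  fixes v w :: "nat + nat \<Rightarrow> real"
  assumes ord: "ord \<in> {2, 4}" and h: "hL > 0" "hR > 0"
  defines "vL \<equiv> \<lambda>j. v (Inl j)" and "vR \<equiv> \<lambda>j. v (Inr j)" and "wL \<equiv> \<lambda>j. w (Inl j)" and "wR \<equiv> \<lambda>j. w (Inr j)"
  shows "(\<Sum>i\<in>grid_section n. scheme_mass ord hL hR i * (w i * scheme_op ord hL hR \<tau> v i)) =
    - (\<Sum>j<n + 4. wL j * sbp_A ord 1 vL j) / hL - (\<Sum>j<n + 4. wR j * sbp_A ord 1 vR j) / hR
    + 1/2 * jump vL vR * (sbp_S0 ord hR wR - sbp_S0 ord hL wL)
    + 1/2 * jump wL wR * (sbp_S0 ord hR vR - sbp_S0 ord hL vL)
    - \<tau> * jump vL vR * jump wL wR"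
  unfolding sum_grid_section scheme_mass_def scheme_op_def sum.case rhs_R_mirror minus_minus
    rhs_L_pairing[OF ord h(1), where wL = "\<lambda>j. w (Inl j)"] rhs_L_pairing[OF ord h(2), where wL = "\<lambda>j. w (Inr j)"]
  by (simp add: vL_def vR_def wL_def wR_def jump_def algebra_simps diff_divide_distrib add_divide_distrib)

lemma completed_square_bound:
  fixes \<alpha> d s h :: real
  assumes "\<alpha> > 0" "h > 0"
  shows "d * s / h \<le> \<alpha> * s\<^sup>2 / h + d\<^sup>2 / (4 * \<alpha> * h)"
proof -
  have "\<alpha> * s\<^sup>2 / h + d\<^sup>2 / (4 * \<alpha> * h) - d * s / h = (2 * \<alpha> * s - d)\<^sup>2 / (4 * \<alpha> * h)"
    using assms by (simp add: field_simps power2_eq_square)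
  moreover have "\<dots> \<ge> 0" using assms by simp
  ultimately show ?thesis by linarith
qed

text \<open>Each mixed term d s / h is split by completing a square. The part \<alpha> s^2 / h is
  paid for by the form of \<open>sbp_A\<close>, and the remaining multiples of d^2 on the two grids
  add up to exactly \<open>tau_min\<close>.\<close>

lemma scheme_dissipative:
  assumes ord: "ord \<in> {2, 4}" and h: "hL > 0" "hR > 0" and \<tau>: "\<tau> \<ge> tau_min ord hL hR"
  shows "(\<Sum>i\<in>grid_section n. scheme_mass ord hL hR i * (v i * scheme_op ord hL hR \<tau> v i)) \<le> scheme_flux ord hL hR n v v"
proof -
  define vL vR where "vL = (\<lambda>j. v (Inl j))" and "vR = (\<lambda>j. v (Inr j))"
  define d sL sR where "d = jump vL vR" and "sL = sbp_S0 ord 1 vL" and "sR = sbp_S0 ord 1 vR"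
  define \<alpha> where "\<alpha> = sbp_alpha ord"
  have \<alpha>: "\<alpha> > 0" using psd_shift_alpha[OF ord] by (simp add: \<alpha>_def)
  have "- (\<Sum>j<n + 4. vL j * sbp_A ord 1 vL j) \<le> A_flux ord vL vL n - \<alpha> * sL\<^sup>2"
    using sbp_alpha_form_bound[OF ord, of vL n] by (simp add: \<alpha>_def sL_def)
  then have 1: "- (\<Sum>j<n + 4. vL j * sbp_A ord 1 vL j) / hL \<le> A_flux ord vL vL n / hL - \<alpha> * sL\<^sup>2 / hL"
    unfolding diff_divide_distrib[symmetric] using h by (intro divide_right_mono) auto
  have "- (\<Sum>j<n + 4. vR j * sbp_A ord 1 vR j) \<le> A_flux ord vR vR n - \<alpha> * sR\<^sup>2"
    using sbp_alpha_form_bound[OF ord, of vR n] by (simp add: \<alpha>_def sR_def)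
  then have 2: "- (\<Sum>j<n + 4. vR j * sbp_A ord 1 vR j) / hR \<le> A_flux ord vR vR n / hR - \<alpha> * sR\<^sup>2 / hR"
    unfolding diff_divide_distrib[symmetric] using h by (intro divide_right_mono) auto
  have 3: "d * sR / hR \<le> \<alpha> * sR\<^sup>2 / hR + d\<^sup>2 / (4 * \<alpha> * hR)" "(- d) * sL / hL \<le> \<alpha> * sL\<^sup>2 / hL + (- d)\<^sup>2 / (4 * \<alpha> * hL)"
    using completed_square_bound \<alpha> h by blast+
  have "d\<^sup>2 / (4 * \<alpha> * hR) + d\<^sup>2 / (4 * \<alpha> * hL) = tau_min ord hL hR * d\<^sup>2"
    using h \<alpha> by (simp add: tau_min_def \<alpha>_def[symmetric] field_simps)
  also have "\<dots> \<le> \<tau> * d\<^sup>2" using \<tau> by (intro mult_right_mono) auto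
  finally have 4: "d\<^sup>2 / (4 * \<alpha> * hR) + d\<^sup>2 / (4 * \<alpha> * hL) \<le> \<tau> * d\<^sup>2" .
  have "(\<Sum>i\<in>grid_section n. scheme_mass ord hL hR i * (v i * scheme_op ord hL hR \<tau> v i)) =
    - (\<Sum>j<n + 4. vL j * sbp_A ord 1 vL j) / hL - (\<Sum>j<n + 4. vR j * sbp_A ord 1 vR j) / hR
    + d * sR / hR + (- d) * sL / hL - \<tau> * d\<^sup>2"
    unfolding scheme_pairing[OF ord h] sbp_S0_scale[of ord hL] sbp_S0_scale[of ord hR] d_def sL_def sR_def
    by (simp add: vL_def vR_def power2_eq_square algebra_simps)
  then show ?thesis
    using 1 2 3 4 unfolding scheme_flux_def vL_def[symmetric] vR_def[symmetric] by simp
qed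

lemma scheme_symmetric:
  assumes ord: "ord \<in> {2, 4}" and h: "hL > 0" "hR > 0"
  shows "(\<Sum>i\<in>grid_section n. scheme_mass ord hL hR i *
      (w i * scheme_op ord hL hR \<tau> v i - v i * scheme_op ord hL hR \<tau> w i)) =
    scheme_flux ord hL hR n w v - scheme_flux ord hL hR n v w"
proof -
  have A: "(\<Sum>j<n + 4. a j * sbp_A ord 1 b j) - (\<Sum>j<n + 4. b j * sbp_A ord 1 a j) =
      A_flux ord b a n - A_flux ord a b n" for a b :: "nat \<Rightarrow> real"
    using sbp_A_symmetric[OF ord, where n = n and v = b and w = a] by (simp add: sum_subtractf)
  show ?thesis
    unfolding right_diff_distrib sum_subtractf scheme_pairing[OF ord h] scheme_flux_def
    using A[of "\<lambda>j. w (Inl j)" "\<lambda>j. v (Inl j)"] A[of "\<lambda>j. w (Inr j)" "\<lambda>j. v (Inr j)"]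
    by (simp add: diff_divide_distrib[symmetric] add_divide_distrib[symmetric] algebra_simps)
qed

text \<open>Since \<open>sbp_H\<close> is at least h / 3 (its smallest weight is 17/48 h), uniformly
  bounded section norms control plain square sums.\<close>

lemma grid_section_norm_bounds:
  assumes h: "hL > 0" "hR > 0"
    and K: "\<And>n. sq_sum (scheme_mass ord hL hR) (grid_section n) v \<le> K"
  shows "(\<lambda>j. v (Inl j)) \<longlonglongrightarrow> 0" "(\<lambda>j. v (Inr j)) \<longlonglongrightarrow> 0"
    "\<bar>v i\<bar> \<le> sqrt (3 * K / min hL hR)"
    "summable (\<lambda>j. (v (Inl j))\<^sup>2)" "summable (\<lambda>j. (v (Inr j))\<^sup>2)"
proof -
  let ?h = "min hL hR"
  have m: "scheme_mass ord hL hR i \<ge> ?h / 3" for i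
    using sbp_H_ge[OF h(1), of ord] sbp_H_ge[OF h(2), of ord]
    by (cases i) (force simp: scheme_mass_def intro: order_trans[rotated])+
  have h0: "?h > 0" using h by simp
  have bound: "(\<Sum>i\<in>grid_section n. (v i)\<^sup>2) \<le> 3 * K / ?h" for n
  proof -
    have "(?h / 3) * (\<Sum>i\<in>grid_section n. (v i)\<^sup>2) \<le> sq_sum (scheme_mass ord hL hR) (grid_section n) v"
      unfolding sum_distrib_left by (intro sum_mono mult_right_mono m) simp
    also have "\<dots> \<le> K" by (rule K)
    finally show ?thesis using h0 by (simp add: field_simps)
  qed
  have part: "(\<Sum>j<n. (v (Inl j))\<^sup>2) \<le> 3 * K / ?h" "(\<Sum>j<n. (v (Inr j))\<^sup>2) \<le> 3 * K / ?h" for n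
  proof -
    have "(\<Sum>j<n. (v (Inl j))\<^sup>2) \<le> (\<Sum>j<n + 4. (v (Inl j))\<^sup>2)" "(\<Sum>j<n. (v (Inr j))\<^sup>2) \<le> (\<Sum>j<n + 4. (v (Inr j))\<^sup>2)"
      by (intro sum_mono2; auto)+
    moreover have "(\<Sum>j<n + 4. (v (Inl j))\<^sup>2) \<ge> 0" "(\<Sum>j<n + 4. (v (Inr j))\<^sup>2) \<ge> 0"
      by (simp_all add: sum_nonneg)
    ultimately show "(\<Sum>j<n. (v (Inl j))\<^sup>2) \<le> 3 * K / ?h" "(\<Sum>j<n. (v (Inr j))\<^sup>2) \<le> 3 * K / ?h"
      using bound[of n] unfolding sum_grid_section by linarith+
  qed
  show s: "summable (\<lambda>j. (v (Inl j))\<^sup>2)" "summable (\<lambda>j. (v (Inr j))\<^sup>2)"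
    using part by (auto intro!: summableI_nonneg_bounded)
  show "(\<lambda>j. v (Inl j)) \<longlonglongrightarrow> 0" "(\<lambda>j. v (Inr j)) \<longlonglongrightarrow> 0"
    using s[THEN summable_LIMSEQ_zero] by (simp_all add: power_tendsto_0_iff)
  have "(v i)\<^sup>2 \<le> 3 * K / ?h"
  proof -
    define n where "n = (case i of Inl a \<Rightarrow> a | Inr a \<Rightarrow> a)"
    have "i \<in> grid_section n"
      by (cases i) (auto simp: grid_section_def n_def)
    then have "(v i)\<^sup>2 \<le> (\<Sum>i\<in>grid_section n. (v i)\<^sup>2)"
      by (intro member_le_sum) (auto simp: grid_section_def)
    then show ?thesis using bound[of n] by simp
  qed
  then show "\<bar>v i\<bar> \<le> sqrt (3 * K / ?h)" using real_le_rsqrt[of "\<bar>v i\<bar>"] by simp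
qed

lemma abs_mult_le_square: "\<bar>x\<bar> \<le> b \<Longrightarrow> \<bar>y\<bar> \<le> b \<Longrightarrow> \<bar>x * y\<bar> \<le> b * (b::real)"
  unfolding abs_mult by (intro mult_mono) auto

lemma A_flux_bounded:
  assumes "\<And>j. \<bar>v j\<bar> \<le> b" "\<And>j. \<bar>w j\<bar> \<le> b"
  shows "\<bar>A_flux ord v w n\<bar> \<le> 4 * (b * b)"
proof -
  note * = abs_mult_le_square[OF assms]
  have aux: "\<bar>int_near ord * x + int_far ord * (y + z)\<bar> \<le> 4 * c"
    if c: "\<bar>x\<bar> \<le> c" "\<bar>y\<bar> \<le> c" "\<bar>z\<bar> \<le> c" for x y z c
  proof -
    have "\<bar>int_near ord * x\<bar> \<le> 2 * c" "\<bar>int_far ord * (y + z)\<bar> \<le> 1 * (2 * c)"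
      unfolding abs_mult by (rule mult_mono; use c in \<open>simp add: int_near_def int_far_def\<close>)+
    then show ?thesis by linarith
  qed
  show ?thesis unfolding A_flux_def by (intro aux *)
qed

lemma scheme_symmetric_dissipative:
  assumes ord: "ord \<in> {2, 4}" and h: "hL > 0" "hR > 0" and \<tau>: "\<tau> \<ge> tau_min ord hL hR"
  shows "symmetric_dissipative (scheme_mass ord hL hR) grid_section (scheme_op ord hL hR \<tau>) (scheme_flux ord hL hR)"
proof
  show "finite (grid_section n)" for n by (simp add: grid_section_def)
  show "grid_section n \<subseteq> grid_section n'" if "n \<le> n'" for n n'
    using that by (auto simp: grid_section_def)
  show "0 \<le> scheme_mass ord hL hR i" for i by (rule scheme_mass_nonneg[OF h])
  show "scheme_op ord hL hR \<tau> (\<lambda>_. 0) i = 0" for i by (rule finite_row_zero[OF finite_row_scheme_op])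
  show "((\<lambda>s. scheme_op ord hL hR \<tau> (V s) i) has_real_derivative scheme_op ord hL hR \<tau> V' i) (at t within S)"
    if "\<And>k. ((\<lambda>s. V s k) has_real_derivative V' k) (at t within S)" for V V' t S i
    by (rule finite_row_deriv[OF finite_row_scheme_op that])
  show "(\<lambda>n. scheme_flux ord hL hR n v w) \<longlonglongrightarrow> 0"
    if "\<And>n. sq_sum (scheme_mass ord hL hR) (grid_section n) v \<le> K"
      "\<And>n. sq_sum (scheme_mass ord hL hR) (grid_section n) w \<le> K" for v w K
  proof -
    note lim = A_flux_tendsto_0[OF grid_section_norm_bounds(1)[OF h that(1)] grid_section_norm_bounds(1)[OF h that(2)], of ord]
      A_flux_tendsto_0[OF grid_section_norm_bounds(2)[OF h that(1)] grid_section_norm_bounds(2)[OF h that(2)], of ord]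
    show ?thesis
      unfolding scheme_flux_def
      using tendsto_add[OF lim(1)[THEN tendsto_divide[OF _ tendsto_const[of hL]]] lim(2)[THEN tendsto_divide[OF _ tendsto_const[of hR]]]] h
      by simp
  qed
  show "\<exists>C. \<forall>n v w. (\<forall>n. sq_sum (scheme_mass ord hL hR) (grid_section n) v \<le> K) \<longrightarrow>
        (\<forall>n. sq_sum (scheme_mass ord hL hR) (grid_section n) w \<le> K) \<longrightarrow>
        \<bar>scheme_flux ord hL hR n v w\<bar> \<le> C" for K
  proof -
    define b where "b = sqrt (3 * K / min hL hR)"
    have "\<bar>scheme_flux ord hL hR n v w\<bar> \<le> 4 * (b * b) / hL + 4 * (b * b) / hR"
      if "\<forall>n. sq_sum (scheme_mass ord hL hR) (grid_section n) v \<le> K"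
      "\<forall>n. sq_sum (scheme_mass ord hL hR) (grid_section n) w \<le> K" for n v w
    proof -
      have "\<bar>v i\<bar> \<le> b" "\<bar>w i\<bar> \<le> b" for i
        unfolding b_def using grid_section_norm_bounds(3)[OF h] that by blast+
      then have "\<bar>A_flux ord (\<lambda>j. v (Inl j)) (\<lambda>j. w (Inl j)) n\<bar> \<le> 4 * (b * b)"
        "\<bar>A_flux ord (\<lambda>j. v (Inr j)) (\<lambda>j. w (Inr j)) n\<bar> \<le> 4 * (b * b)"
        by (auto intro!: A_flux_bounded)
      then have "\<bar>A_flux ord (\<lambda>j. v (Inl j)) (\<lambda>j. w (Inl j)) n / hL\<bar> \<le> 4 * (b * b) / hL"
        "\<bar>A_flux ord (\<lambda>j. v (Inr j)) (\<lambda>j. w (Inr j)) n / hR\<bar> \<le> 4 * (b * b) / hR"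
        using h by (auto simp: abs_divide intro!: divide_right_mono)
      then show ?thesis unfolding scheme_flux_def by linarith
    qed
    then show ?thesis by blast
  qed
  show "continuous_on S (\<lambda>t. scheme_flux ord hL hR n (V t) (W t))"
    if "\<And>i. continuous_on S (\<lambda>t. V t i)" "\<And>i. continuous_on S (\<lambda>t. W t i)" for S V W n
    unfolding scheme_flux_def A_flux_def using h by (intro continuous_intros that) auto
qed (use scheme_symmetric[OF ord h] scheme_dissipative[OF ord h \<tau>] in auto)

section \<open>Truncation errors\<close>

definition grid_monomial :: "nat \<Rightarrow> nat \<Rightarrow> real" where
  "grid_monomial m k = real k ^ m / fact m"

text \<open>Truncation errors of the boundary rows on \<open>x\<^sup>m / m!\<close>, whose second derivative is
  \<open>x\<^bsup>m-2\<^esup> / (m-2)!\<close>.\<close>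

definition trunc_D :: "nat \<Rightarrow> nat \<Rightarrow> nat \<Rightarrow> real" where
  "trunc_D ord m j = (if j < 4 then sbp_D ord 1 (grid_monomial m) j - (if m < 2 then 0 else grid_monomial (m - 2) j) else 0)"

definition trunc_S :: "nat \<Rightarrow> nat \<Rightarrow> real" where
  "trunc_S ord m = sbp_S0 ord 1 (grid_monomial m) - (if m = 1 then 1 else 0)"

lemma finite_row_sum_linear:
  assumes "finite_row f" "finite K"
  shows "f (\<lambda>i. \<Sum>k\<in>K. c k * g k i) = (\<Sum>k\<in>K. c k * f (g k))"
  using assms(2)
proof induction
  case empty
  then show ?case using finite_row_zero[OF assms(1)] by simp
next
  case (insert k K)
  have "f (\<lambda>i. c k * g k i + 1 * (\<Sum>k\<in>K. c k * g k i)) = c k * f (g k) + 1 * f (\<lambda>i. \<Sum>k\<in>K. c k * g k i)"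
    by (rule finite_row_linear[OF assms(1)])
  then show ?case using insert by simp
qed

text \<open>The first summand is for boundary rows: 16 for the coefficients of a row of D and 1 for
  the second derivative, times exp 5 * 5^6 for Taylor remainders of order at most 6 at nodes k <= 5,
  times exp 3 to restore the weight exp(-j h) for j < 4. The second is for interior rows, which
  reach two nodes.\<close>

definition trunc_const :: real where
  "trunc_const = 17 * exp 8 * 5 ^ 6 + 3 * exp 2 * 2 ^ 6"

definition smooth_tower :: "(nat \<Rightarrow> real \<Rightarrow> real) \<Rightarrow> bool" where
  "smooth_tower d \<longleftrightarrow> (\<forall>m x. (d m has_real_derivative d (Suc m) x) (at x))"

text \<open>What is left of the truncation error once the terms of degree below ord + 2 at the
  interface are listed explicitly. Unlike the error itself it has the full order in every
  row.\<close>

definition D_defect :: "nat \<Rightarrow> real \<Rightarrow> (nat \<Rightarrow> real \<Rightarrow> real) \<Rightarrow> nat \<Rightarrow> real" where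
  "D_defect ord h d j = sbp_D ord h (\<lambda>k. d 0 (real k * h)) j - d 2 (real j * h)
      - (\<Sum>m<ord + 2. d m 0 * h ^ m / h\<^sup>2 * trunc_D ord m j)"

definition S_defect :: "nat \<Rightarrow> real \<Rightarrow> (nat \<Rightarrow> real \<Rightarrow> real) \<Rightarrow> real" where
  "S_defect ord h d = sbp_S0 ord h (\<lambda>k. d 0 (real k * h)) - d 1 0
      - (\<Sum>m<ord + 2. d m 0 * h ^ m / h * trunc_S ord m)"

text \<open>The weight is one-sided, so moving from a to the intermediate point costs at most a
  factor exp |z|.\<close>

lemma taylor_remainder:
  assumes d: "smooth_tower d" and M: "\<And>x. \<bar>d n x\<bar> \<le> M * exp (- x)"
  shows "\<bar>d 0 (a + z) - (\<Sum>m<n. d m a / fact m * z ^ m)\<bar> \<le> M * exp (\<bar>z\<bar>) * exp (- a) * \<bar>z\<bar> ^ n"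
proof -
  have M0: "M \<ge> 0" using order_trans[OF abs_ge_zero M[of 0]] by simp
  have "\<exists>t. \<bar>t\<bar> \<le> \<bar>z\<bar> \<and> d 0 (a + z) = (\<Sum>m<n. (d m (a + 0) / fact m) * z ^ m) + (d n (a + t) / fact n) * z ^ n"
    by (rule Maclaurin_all_le[where diff = "\<lambda>m z. d m (a + z)"])
       (use d in \<open>auto simp: smooth_tower_def DERIV_shift[symmetric] add.commute[of a]\<close>)
  then obtain t where t: "\<bar>t\<bar> \<le> \<bar>z\<bar>"
    "d 0 (a + z) = (\<Sum>m<n. (d m a / fact m) * z ^ m) + (d n (a + t) / fact n) * z ^ n" by auto
  have "\<bar>d n (a + t) / fact n\<bar> \<le> M * (exp \<bar>z\<bar> * exp (- a)) / 1"
    unfolding abs_divide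
  proof (rule frac_le)
    have "\<bar>d n (a + t)\<bar> \<le> M * exp (- (a + t))" by (rule M)
    also have "\<dots> \<le> M * exp (\<bar>z\<bar> - a)" using t(1) M0 by (intro mult_left_mono) auto
    finally show "\<bar>d n (a + t)\<bar> \<le> M * (exp \<bar>z\<bar> * exp (- a))" by (simp add: exp_diff exp_minus divide_inverse)
  qed (use M0 in auto)
  then have "\<bar>d n (a + t) / fact n * z ^ n\<bar> \<le> (M * (exp \<bar>z\<bar> * exp (- a))) * \<bar>z\<bar> ^ n"
    unfolding abs_mult power_abs by (intro mult_right_mono) auto
  then show ?thesis unfolding t(2) by (simp add: mult.assoc)
qed

text \<open>Odd powers cancel in the symmetric differences and, for order four, the weights
  \<open>int_near\<close> and \<open>int_far\<close> cancel the fourth power. Only Taylor remainders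
  survive, divided by h^2.\<close>

lemma sbp_D_interior_truncation:
  assumes ord: "ord \<in> {2, 4}" and d: "smooth_tower d" and h: "0 < h" "h \<le> 1"
    and M: "\<And>x. \<bar>d (ord + 2) x\<bar> \<le> M * exp (- x)"
  shows "\<bar>sbp_D ord h (\<lambda>k. d 0 (real k * h)) (n + 4) - d 2 (real (n + 4) * h)\<bar>
    \<le> 3 * exp 2 * 2 ^ 6 * M * h ^ ord * exp (- (real (n + 4) * h))"
proof -
  define a where "a = real (n + 4) * h"
  define R where "R z = d 0 (a + z) - (\<Sum>m<ord + 2. d m a / fact m * z ^ m)" for z
  define b where "b = M * exp 2 * exp (- a) * (2 * h) ^ (ord + 2)"
  have M0: "M \<ge> 0" using order_trans[OF abs_ge_zero M[of 0]] by simp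
  have R: "\<bar>R z\<bar> \<le> b" if "\<bar>z\<bar> \<le> 2 * h" for z
  proof -
    have "\<bar>R z\<bar> \<le> M * exp \<bar>z\<bar> * exp (- a) * \<bar>z\<bar> ^ (ord + 2)"
      unfolding R_def by (rule taylor_remainder[OF d M])
    also have "\<dots> \<le> b"
      unfolding b_def using that h M0 by (intro mult_mono power_mono) auto
    finally show ?thesis .
  qed
  have u: "d 0 (a + z) = (\<Sum>m<ord + 2. d m a / fact m * z ^ m) + R z" for z
    by (simp add: R_def)
  have R0: "R 0 = 0"
    by (simp add: R_def zero_power power_0_left sum.remove[of _ 0])
  define E where "E = int_near ord * (R h + R (- h)) + int_far ord * (R (2 * h) + R (- (2 * h)))"
  have pts: "real (n + 5) * h = a + h" "real (n + 3) * h = a + - h" "real (n + 6) * h = a + 2 * h"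
    "real (n + 2) * h = a + - (2 * h)" "real (n + 4) * h = a + 0"
    by (simp_all add: a_def algebra_simps)
  have D1: "sbp_D ord 1 (\<lambda>k. d 0 (real k * h)) (n + 4) = h\<^sup>2 * d 2 a + E"
    unfolding sbp_D_interior[OF ord] pts u E_def R0 using ord
    by (auto simp: int_near_def int_far_def eval_nat_numeral field_simps R0)
  have "\<bar>E\<bar> \<le> 3 * b"
  proof -
    have R4: "\<bar>R h\<bar> \<le> b" "\<bar>R (- h)\<bar> \<le> b" "\<bar>R (2 * h)\<bar> \<le> b" "\<bar>R (- (2 * h))\<bar> \<le> b"
      using h by (auto intro: R)
    have b: "b \<ge> 0" using order_trans[OF abs_ge_zero R4(1)] .
    have R2: "\<bar>R h + R (- h)\<bar> \<le> 2 * b" "\<bar>R (2 * h) + R (- (2 * h))\<bar> \<le> 2 * b"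
      using abs_triangle_ineq[of "R h" "R (- h)"] abs_triangle_ineq[of "R (2 * h)" "R (- (2 * h))"] R4 by simp_all
    have "\<bar>int_near ord * (R h + R (- h))\<bar> \<le> 4/3 * (2 * b)" "\<bar>int_far ord * (R (2 * h) + R (- (2 * h)))\<bar> \<le> 1/12 * (2 * b)"
      unfolding abs_mult by (rule mult_mono; use R2 b in \<open>simp add: int_near_def int_far_def\<close>)+
    then show ?thesis
      unfolding E_def using b abs_triangle_ineq[of "int_near ord * (R h + R (- h))" "int_far ord * (R (2 * h) + R (- (2 * h)))"]
      by simp
  qed
  also have "3 * b = 3 * exp 2 * 2 ^ (ord + 2) * M * h ^ ord * exp (- a) * h\<^sup>2"
    by (simp add: b_def power_add power_mult_distrib power2_eq_square)
  also have "\<dots> \<le> 3 * exp 2 * 2 ^ 6 * M * h ^ ord * exp (- a) * h\<^sup>2"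
    using ord M0 h by (intro mult_right_mono mult_left_mono) auto
  finally have "\<bar>E / h\<^sup>2\<bar> \<le> 3 * exp 2 * 2 ^ 6 * M * h ^ ord * exp (- a)"
    using h by (simp add: divide_le_eq abs_divide)
  moreover have "sbp_D ord h (\<lambda>k. d 0 (real k * h)) (n + 4) - d 2 a = E / h\<^sup>2"
    using h sbp_D_scale[of h ord _ "n + 4"] D1 by (simp add: field_simps)
  ultimately show ?thesis unfolding a_def by simp
qed

lemma sbp_D_boundary_bound:
  assumes "ord \<in> {2, 4}" "j < 4" "\<And>k. k \<le> 5 \<Longrightarrow> \<bar>v k\<bar> \<le> b"
  shows "\<bar>sbp_D ord 1 v j\<bar> \<le> 16 * b"
proof -
  have v: "\<bar>v 0\<bar> \<le> b" "\<bar>v 1\<bar> \<le> b" "\<bar>v 2\<bar> \<le> b" "\<bar>v 3\<bar> \<le> b" "\<bar>v 4\<bar> \<le> b" "\<bar>v 5\<bar> \<le> b"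
    using assms(3) by auto
  consider "ord = 2" | "ord = 4" using assms(1) by auto
  then show ?thesis
    using less_4_cases[OF assms(2)] v
    by cases (elim disjE; simp only: sbp_boundary_rows_2 sbp_boundary_rows_4; linarith)+
qed

lemma sbp_S0_bound:
  assumes "ord \<in> {2, 4}" "\<And>k. k \<le> 5 \<Longrightarrow> \<bar>v k\<bar> \<le> b"
  shows "\<bar>sbp_S0 ord 1 v\<bar> \<le> 7 * b"
proof -
  have v: "\<bar>v 0\<bar> \<le> b" "\<bar>v 1\<bar> \<le> b" "\<bar>v 2\<bar> \<le> b" "\<bar>v 3\<bar> \<le> b"
    using assms(2) by auto
  consider "ord = 2" | "ord = 4" using assms(1) by auto
  then show ?thesis
    by cases (use v in \<open>simp only: sbp_boundary_rows_2 sbp_boundary_rows_4; linarith\<close>)+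
qed

lemma taylor_at_zero_on_grid:
  assumes d: "smooth_tower d" and h: "0 < h" "h \<le> 1" and M: "\<And>x. \<bar>d n x\<bar> \<le> M * exp (- x)" and n: "n \<le> 6" and k: "k \<le> 5"
  shows "\<bar>d 0 (real k * h) - (\<Sum>m<n. d m 0 * h ^ m * grid_monomial m k)\<bar> \<le> exp 5 * 5 ^ 6 * M * h ^ n"
proof -
  have M0: "M \<ge> 0" using order_trans[OF abs_ge_zero M[of 0]] by simp
  have "real k * h \<le> 5 * h" using k h by (intro mult_right_mono) auto
  then have k5: "real k * h \<le> 5 * h" "real k * h \<le> 5" using h by linarith+
  have "\<bar>d 0 (0 + real k * h) - (\<Sum>m<n. d m 0 / fact m * (real k * h) ^ m)\<bar>
      \<le> M * exp \<bar>real k * h\<bar> * exp (- 0) * \<bar>real k * h\<bar> ^ n"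
    by (rule taylor_remainder[OF d M])
  also have "\<dots> \<le> M * exp 5 * 1 * (5 * h) ^ n"
    using k5 h M0 by (intro mult_mono power_mono) auto
  also have "\<dots> = exp 5 * 5 ^ n * M * h ^ n" by (simp add: power_mult_distrib)
  also have "\<dots> \<le> exp 5 * 5 ^ 6 * M * h ^ n"
    using n M0 h by (intro mult_right_mono mult_left_mono power_increasing) auto
  finally show ?thesis by (simp add: grid_monomial_def power_mult_distrib mult_ac)
qed

lemma smooth_tower_shift: "smooth_tower d \<Longrightarrow> smooth_tower (\<lambda>m. d (m + k))"
  by (simp add: smooth_tower_def)

text \<open>By linearity of the row, the Taylor polynomial contributes the tabulated
  \<open>trunc_D\<close> and only its remainder needs an estimate. The expansion is about the
  interface and not about the node, because the correctors are multiplied by derivatives of U at x =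
  0.\<close>

lemma sbp_D_boundary_truncation:
  assumes ord: "ord \<in> {2, 4}" and d: "smooth_tower d" and h: "0 < h" "h \<le> 1"
    and M: "\<And>x. \<bar>d (ord + 2) x\<bar> \<le> M * exp (- x)" and j: "j < 4"
  shows "\<bar>D_defect ord h d j\<bar> \<le> 17 * exp 5 * 5 ^ 6 * M * h ^ ord"
proof -
  let ?n = "ord + 2"
  define c where "c m = d m 0 * h ^ m" for m
  define R where "R k = d 0 (real k * h) - (\<Sum>m<?n. c m * grid_monomial m k)" for k
  define R2 where "R2 = d 2 (real j * h) - (\<Sum>m<ord. d (m + 2) 0 * h ^ m * grid_monomial m j)"
  have n6: "?n \<le> 6" using ord by auto
  have row: "finite_row (\<lambda>v. sbp_D ord 1 v j)" using finite_row_sbp_D[of ord 1 "\<lambda>k. k" j] by simp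
  have R: "\<bar>R k\<bar> \<le> exp 5 * 5 ^ 6 * M * h ^ ?n" if "k \<le> 5" for k
    unfolding R_def c_def by (rule taylor_at_zero_on_grid[OF d h M n6 that])
  have R2: "\<bar>R2\<bar> \<le> exp 5 * 5 ^ 6 * M * h ^ ord"
    unfolding R2_def
    using taylor_at_zero_on_grid[OF smooth_tower_shift[OF d, of 2] h M, of j] n6 j
    by (simp del: add_2_eq_Suc add_2_eq_Suc')
  have "sbp_D ord 1 (\<lambda>k. d 0 (real k * h)) j = sbp_D ord 1 (\<lambda>k. 1 * (\<Sum>m<?n. c m * grid_monomial m k) + 1 * R k) j"
    by (simp add: R_def)
  also have "\<dots> = (\<Sum>m<?n. c m * sbp_D ord 1 (grid_monomial m) j) + sbp_D ord 1 R j"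
    unfolding finite_row_linear[OF row] by (simp only: finite_row_sum_linear[OF row finite_lessThan] mult_1)
  also have "(\<Sum>m<?n. c m * sbp_D ord 1 (grid_monomial m) j) =
      (\<Sum>m<?n. c m * trunc_D ord m j) + (\<Sum>m<?n. c m * (if m < 2 then 0 else grid_monomial (m - 2) j))"
    unfolding sum.distrib[symmetric] using j by (intro sum.cong refl) (simp add: trunc_D_def algebra_simps)
  also have "(\<Sum>m<?n. c m * (if m < 2 then 0 else grid_monomial (m - 2) j)) = (\<Sum>m<ord. c (m + 2) * grid_monomial m j)"
    unfolding sum.lessThan_Suc_shift add_2_eq_Suc' by simp
  also have "\<dots> = h\<^sup>2 * (d 2 (real j * h) - R2)"
    unfolding R2_def c_def by (simp add: sum_distrib_left power_add power2_eq_square mult_ac)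
  finally have eq: "sbp_D ord 1 (\<lambda>k. d 0 (real k * h)) j =
      (\<Sum>m<?n. c m * trunc_D ord m j) + h\<^sup>2 * (d 2 (real j * h) - R2) + sbp_D ord 1 R j" .
  have "sbp_D ord h (\<lambda>k. d 0 (real k * h)) j = (\<Sum>m<?n. c m * trunc_D ord m j) / h\<^sup>2 + d 2 (real j * h) - R2 + sbp_D ord 1 R j / h\<^sup>2"
    unfolding sbp_D_scale[OF less_imp_neq[OF h(1), symmetric]] eq using h by (simp add: field_simps)
  then have "D_defect ord h d j = sbp_D ord 1 R j / h\<^sup>2 - R2"
    unfolding D_defect_def by (simp add: c_def sum_divide_distrib del: add_2_eq_Suc')
  moreover have "\<bar>sbp_D ord 1 R j / h\<^sup>2\<bar> \<le> 16 * (exp 5 * 5 ^ 6 * M * h ^ ord)"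
  proof -
    have "\<bar>sbp_D ord 1 R j\<bar> \<le> 16 * (exp 5 * 5 ^ 6 * M * h ^ ?n)"
      by (rule sbp_D_boundary_bound[OF ord j R])
    then show ?thesis using h by (simp add: abs_divide divide_le_eq power_add power2_eq_square mult_ac)
  qed
  ultimately show ?thesis using R2 by linarith
qed

lemma sbp_D_truncation:
  assumes ord: "ord \<in> {2, 4}" and d: "smooth_tower d" and h: "0 < h" "h \<le> 1"
    and M: "\<And>x. \<bar>d (ord + 2) x\<bar> \<le> M * exp (- x)"
  shows "\<bar>D_defect ord h d j\<bar> \<le> trunc_const * M * h ^ ord * exp (- (real j * h))"
proof -
  have M0: "M \<ge> 0" using order_trans[OF abs_ge_zero M[of 0]] by simp
  show ?thesis
  proof (cases "j < 4")
    case True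
    have "\<bar>D_defect ord h d j\<bar> \<le> 17 * exp 5 * 5 ^ 6 * M * h ^ ord"
      by (rule sbp_D_boundary_truncation[OF ord d h M True])
    also have "\<dots> = (17 * exp 8 * 5 ^ 6) * M * h ^ ord * exp (- 3)"
      by (simp add: exp_minus field_simps flip: exp_add)
    also have "\<dots> \<le> trunc_const * M * h ^ ord * exp (- (real j * h))"
    proof (rule mult_mono)
      have "real j * h \<le> 3 * 1" using True h by (intro mult_mono) auto
      then show "exp (- 3) \<le> exp (- (real j * h))" by simp
      show "(17 * exp 8 * 5 ^ 6) * M * h ^ ord \<le> trunc_const * M * h ^ ord"
        using M0 h by (intro mult_right_mono) (auto simp: trunc_const_def)
    qed (use M0 h in \<open>auto simp: trunc_const_def\<close>)
    finally show ?thesis .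
  next
    case False
    then obtain n where n: "j = n + 4" using le_Suc_ex[of 4 j] by (auto simp: add.commute)
    have "\<bar>D_defect ord h d j\<bar> \<le> 3 * exp 2 * 2 ^ 6 * M * h ^ ord * exp (- (real j * h))"
      using sbp_D_interior_truncation[OF ord d h M, of n] False by (simp add: D_defect_def n trunc_D_def)
    also have "\<dots> \<le> trunc_const * M * h ^ ord * exp (- (real j * h))"
      using M0 h by (intro mult_right_mono) (auto simp: trunc_const_def)
    finally show ?thesis .
  qed
qed

lemma sbp_S0_truncation:
  assumes ord: "ord \<in> {2, 4}" and d: "smooth_tower d" and h: "0 < h" "h \<le> 1"
    and M: "\<And>x. \<bar>d (ord + 2) x\<bar> \<le> M * exp (- x)"
  shows "\<bar>S_defect ord h d\<bar> \<le> trunc_const * M * h ^ ord * h"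
proof -
  let ?n = "ord + 2"
  define c where "c m = d m 0 * h ^ m" for m
  define R where "R k = d 0 (real k * h) - (\<Sum>m<?n. c m * grid_monomial m k)" for k
  have n6: "?n \<le> 6" using ord by auto
  have row: "finite_row (\<lambda>v. sbp_S0 ord 1 v)" using finite_row_sbp_S0[of ord 1 "\<lambda>k. k"] by simp
  have R: "\<bar>R k\<bar> \<le> exp 5 * 5 ^ 6 * M * h ^ ?n" if "k \<le> 5" for k
    unfolding R_def c_def by (rule taylor_at_zero_on_grid[OF d h M n6 that])
  have "sbp_S0 ord 1 (\<lambda>k. d 0 (real k * h)) = sbp_S0 ord 1 (\<lambda>k. 1 * (\<Sum>m<?n. c m * grid_monomial m k) + 1 * R k)"
    by (simp add: R_def)
  also have "\<dots> = (\<Sum>m<?n. c m * sbp_S0 ord 1 (grid_monomial m)) + sbp_S0 ord 1 R"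
    unfolding finite_row_linear[OF row] by (simp only: finite_row_sum_linear[OF row finite_lessThan] mult_1)
  also have "(\<Sum>m<?n. c m * sbp_S0 ord 1 (grid_monomial m)) =
      (\<Sum>m<?n. c m * trunc_S ord m) + (\<Sum>m<?n. if m = 1 then c m else 0)"
    unfolding sum.distrib[symmetric] by (intro sum.cong refl) (simp add: trunc_S_def algebra_simps)
  also have "(\<Sum>m<?n. if m = 1 then c m else 0) = h * d 1 0" by (simp add: c_def)
  finally have eq: "sbp_S0 ord 1 (\<lambda>k. d 0 (real k * h)) =
      (\<Sum>m<?n. c m * trunc_S ord m) + h * d 1 0 + sbp_S0 ord 1 R" .
  have "S_defect ord h d = sbp_S0 ord 1 R / h"
  proof -
    have "(\<Sum>m<ord + 2. d m 0 * h ^ m / h * trunc_S ord m) = (\<Sum>m<?n. c m * trunc_S ord m) / h"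
      by (simp add: c_def sum_divide_distrib del: add_2_eq_Suc')
    then show ?thesis
      unfolding S_defect_def sbp_S0_scale[of ord h] eq using h by (simp add: add_divide_distrib del: add_2_eq_Suc')
  qed
  moreover have "\<bar>sbp_S0 ord 1 R\<bar> \<le> 7 * (exp 5 * 5 ^ 6 * M * h ^ ?n)"
    by (rule sbp_S0_bound[OF ord R])
  ultimately have "\<bar>S_defect ord h d\<bar> \<le> (7 * exp 5 * 5 ^ 6) * M * h ^ ord * h"
    using h by (simp add: abs_divide divide_le_eq power_add mult_ac)
  also have "\<dots> \<le> trunc_const * M * h ^ ord * h"
  proof (intro mult_right_mono)
    have "7 * exp 5 * 5 ^ 6 \<le> 17 * exp 8 * (5::real) ^ 6" by (intro mult_mono) auto
    also have "\<dots> \<le> trunc_const" by (simp add: trunc_const_def)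
    finally show "7 * exp 5 * 5 ^ 6 \<le> trunc_const" .
  qed (use h order_trans[OF abs_ge_zero M[of 0]] in auto)
  finally show ?thesis .
qed

text \<open>The boundary rows are exact on polynomials up to degree p + 1. The first term that can
  survive, m = p + 2, carries h^(m-2) = h^p.\<close>

lemma trunc_consistency:
  assumes "ord \<in> {2, 4}" "m < ord div 2 + 2"
  shows "trunc_D ord m j = 0" "trunc_S ord m = 0"
proof -
  have "ord = 2 \<and> (m = 0 \<or> m = 1 \<or> m = 2) \<or> ord = 4 \<and> (m = 0 \<or> m = 1 \<or> m = 2 \<or> m = 3)"
    using assms by auto
  then show "trunc_S ord m = 0" 
    by (elim disjE conjE) (simp_all add: trunc_S_def sbp_boundary_rows_2 sbp_boundary_rows_4 grid_monomial_def fact_numeral)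
  show "trunc_D ord m j = 0"
  proof (cases "j < 4")
    case True
    then show ?thesis
      using \<open>ord = 2 \<and> (m = 0 \<or> m = 1 \<or> m = 2) \<or> ord = 4 \<and> (m = 0 \<or> m = 1 \<or> m = 2 \<or> m = 3)\<close> less_4_cases[OF True]
      by (elim disjE conjE)
         (simp_all only: trunc_D_def sbp_boundary_rows_2 sbp_boundary_rows_4, simp_all add: grid_monomial_def fact_numeral)
  qed (simp add: trunc_D_def)
qed

section \<open>Boundary layers and correctors\<close>

text \<open>The decaying root of \<open>z + 1/z = 14\<close>, the characteristic equation of the fourth-order interior
  stencil after removing the double root \<open>1\<close>.\<close>

definition layer_root :: real where "layer_root = 7 - 4 * sqrt 3"

text \<open>An interior row j >= 4 reaches down to index j - 2 >= 2, so the values at 0 and 1 are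
  free, while from index 2 on only the decaying root may appear. Order two has no decaying root and
  uses c = 0.\<close>

definition layer :: "real \<Rightarrow> real \<Rightarrow> real \<Rightarrow> nat \<Rightarrow> real" where
  "layer a b c j = (if j = 0 then a else if j = 1 then b else c * layer_root ^ (j - 2))"

lemma sqrt_3_mult: "sqrt 3 * sqrt 3 = (3::real)" "sqrt 3 * (sqrt 3 * x) = 3 * (x::real)"
  by (simp_all flip: mult.assoc)

lemma layer_root_powers: "layer_root ^ 2 = 97 - 56 * sqrt 3" "layer_root ^ 3 = 1351 - 780 * sqrt 3"
  "layer_root ^ 4 = 18817 - 10864 * sqrt 3"
  by (simp_all add: layer_root_def power2_eq_square power3_eq_cube power4_eq_xxxx algebra_simps sqrt_3_mult)

lemma layer_root_bounds: "0 \<le> layer_root" "layer_root \<le> exp (- 1)"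
proof -
  have "sqrt 3 \<le> 7/4" "5/3 \<le> sqrt 3"
    by (rule real_le_lsqrt real_le_rsqrt; simp add: power2_eq_square)+
  moreover have "1/3 \<le> exp (- 1 :: real)"
    using exp_le by (simp add: exp_minus field_simps)
  ultimately show "0 \<le> layer_root" "layer_root \<le> exp (- 1)" by (auto simp: layer_root_def)
qed

lemma layer_values: "layer a b c 0 = a" "layer a b c 1 = b" "layer a b c 2 = c" "layer a b c 3 = c * (7 - 4 * sqrt 3)"
  "layer a b c 4 = c * (97 - 56 * sqrt 3)" "layer a b c 5 = c * (1351 - 780 * sqrt 3)"
  by (simp_all add: layer_def layer_root_powers layer_root_def[symmetric])

lemma layer_bound: "\<bar>layer a b c j\<bar> \<le> (\<bar>a\<bar> + exp 1 * \<bar>b\<bar> + exp 2 * \<bar>c\<bar>) * exp (- real j)"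
proof -
  consider "j = 0" | "j = 1" | n where "j = n + 2"
    by (metis One_nat_def Suc_eq_plus1 add_2_eq_Suc' not0_implies_Suc)
  then have "\<bar>layer a b c j\<bar> \<le> \<bar>a\<bar> * exp (- real j) \<or> \<bar>layer a b c j\<bar> \<le> exp 1 * \<bar>b\<bar> * exp (- real j) \<or>
      \<bar>layer a b c j\<bar> \<le> exp 2 * \<bar>c\<bar> * exp (- real j)"
  proof cases
    case 2
    have "\<bar>layer a b c j\<bar> = exp 1 * \<bar>b\<bar> * exp (- real j)" by (simp add: layer_def 2 exp_minus field_simps)
    then show ?thesis by linarith
  next
    case 3
    have "\<bar>layer a b c j\<bar> = \<bar>c\<bar> * layer_root ^ n"
      using layer_root_bounds by (simp add: layer_def 3 abs_mult)
    also have "\<dots> \<le> \<bar>c\<bar> * exp (- 1) ^ n"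
      using layer_root_bounds by (intro mult_left_mono power_mono) auto
    also have "exp (- 1) ^ n = exp (- real n)" by (simp flip: exp_of_nat_mult)
    also have "\<bar>c\<bar> * exp (- real n) = exp 2 * \<bar>c\<bar> * exp (- real j)"
      by (simp add: 3 exp_diff exp_minus field_simps flip: exp_add)
    finally show ?thesis by simp
  qed (simp_all add: layer_def exp_minus)
  moreover have "0 \<le> \<bar>a\<bar> * exp (- real j)" "0 \<le> exp 1 * \<bar>b\<bar> * exp (- real j)" "0 \<le> exp 2 * \<bar>c\<bar> * exp (- real j)"
    by simp_all
  ultimately show ?thesis unfolding distrib_right by linarith
qed

lemma sbp_D_layer_interior:
  assumes "ord \<in> {2, 4}" "ord = 2 \<longrightarrow> c = 0"
  shows "sbp_D ord 1 (layer a b c) (n + 4) = 0"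
proof -
  have *: "layer a b c (n + 2) = c * layer_root ^ n" "layer a b c (n + 3) = c * layer_root ^ n * layer_root"
    "layer a b c (n + 4) = c * layer_root ^ n * layer_root ^ 2" "layer a b c (n + 5) = c * layer_root ^ n * layer_root ^ 3"
    "layer a b c (n + 6) = c * layer_root ^ n * layer_root ^ 4"
    by (simp_all add: layer_def eval_nat_numeral)
  show ?thesis
    unfolding sbp_D_interior[OF assms(1)] * layer_root_powers using assms
    by (auto simp: int_near_def int_far_def layer_root_def algebra_simps)
qed

lemma less_4_or: obtains (boundary) "(j::nat) = 0 \<or> j = 1 \<or> j = 2 \<or> j = 3" | (interior) n where "j = n + 4"
  by (metis add.commute less_4_cases le_Suc_ex linorder_not_less)

text \<open>The decaying solution of \<open>A P = S\<^sup>T e\<^sub>0\<close>; here \<open>sbp_S0 ord 1 P = 1 / \<alpha>\<close>.\<close>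

lemma flux_layer:
  assumes "ord \<in> {2, 4}"
  obtains P c where "\<And>j. \<bar>P j\<bar> \<le> c * exp (- real j)" "sbp_S0 ord 1 P > 0"
    "\<And>j. sbp_D ord 1 P j = - (sbp_ST_e0 ord 1 j / sbp_H ord 1 j) - e0 j * sbp_S0 ord 1 P / sbp_H ord 1 j"
proof -
  consider (2) "ord = 2" | (4) "ord = 4" using assms by auto
  then show ?thesis
  proof cases
    case 2
    let ?P = "layer (-1) (1/2) 0"
    have S: "sbp_S0 2 1 ?P = 5/2" unfolding sbp_boundary_rows_2 layer_values by simp
    have "sbp_D 2 1 ?P j = - (sbp_ST_e0 2 1 j / sbp_H 2 1 j) - e0 j * sbp_S0 2 1 ?P / sbp_H 2 1 j" for j
    proof (cases j rule: less_4_or)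
      case boundary
      then show ?thesis
        by (elim disjE) (simp_all only: S sbp_boundary_rows_2 layer_values e0_simps, simp_all add: e0_def)
    next
      case (interior n)
      then show ?thesis
        using sbp_D_layer_interior[of 2 0 "-1" "1/2" n] by (simp add: sbp_ST_e0_interior e0_def)
    qed
    then show ?thesis using that[OF layer_bound[of "-1" "1/2" 0]] S 2 by simp
  next
    case 4
    \<comment> \<open>The values solve the boundary rows of A P = S^T e0 with coefficients in Q(sqrt
      3). Four rows are compatible with three unknowns because both sides sum to zero.\<close>
    let ?P = "layer (-1) (31467/69443 + 68/1177 * sqrt 3) (-629/1177 + 136/1177 * sqrt 3)"
    have S: "sbp_S0 4 1 ?P = 476074/208329 + 1156/1177 * sqrt 3"
      unfolding sbp_boundary_rows_4 layer_values by (simp add: algebra_simps sqrt_3_mult) (simp add: field_simps)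
    have "sbp_D 4 1 ?P j = - (sbp_ST_e0 4 1 j / sbp_H 4 1 j) - e0 j * sbp_S0 4 1 ?P / sbp_H 4 1 j" for j
    proof (cases j rule: less_4_or)
      case boundary
      then show ?thesis
        by (elim disjE) (simp_all only: S sbp_boundary_rows_4 layer_values,
            simp_all add: e0_def algebra_simps sqrt_3_mult, (simp add: field_simps)+)
    next
      case (interior n)
      then show ?thesis
        using sbp_D_layer_interior[of 4] by (simp add: sbp_ST_e0_interior e0_def)
    qed
    moreover have "sbp_S0 4 1 ?P > 0" unfolding S by (simp add: add_pos_pos)
    ultimately show ?thesis using that[OF layer_bound[of "-1" "31467/69443 + 68/1177 * sqrt 3" "-629/1177 + 136/1177 * sqrt 3"]] 4 by simp
  qed
qed

lemma trunc_values_2: "trunc_D 2 3 0 = 1" "trunc_D 2 3 1 = 0" "trunc_D 2 3 2 = 0" "trunc_D 2 3 3 = 0"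
  unfolding trunc_D_def sbp_boundary_rows_2 grid_monomial_def by (simp_all add: fact_numeral)

lemma trunc_values_4:
  "trunc_D 4 4 0 = -11/12" "trunc_D 4 4 1 = 1/12" "trunc_D 4 4 2 = -5/516" "trunc_D 4 4 3 = -11/588" "trunc_S 4 4 = 1/4"
  "trunc_D 4 5 0 = -1" "trunc_D 4 5 1 = 1/12" "trunc_D 4 5 2 = -5/258" "trunc_D 4 5 3 = -1/28" "trunc_S 4 5 = 3/10"
  unfolding trunc_D_def trunc_S_def sbp_boundary_rows_4 grid_monomial_def by (simp_all add: fact_numeral)

text \<open>Boundary layers removing the truncation errors of the boundary rows up to a multiple of \<open>e\<^sub>0\<close>.\<close>

lemma truncation_layer:
  assumes "ord \<in> {2, 4}" "ord div 2 + 2 \<le> m" "m < ord + 2"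
  obtains Q \<rho> c where "\<And>j. \<bar>Q j\<bar> \<le> c * exp (- real j)"
    "\<And>j. sbp_D ord 1 Q j = - trunc_D ord m j + \<rho> * e0 j / sbp_H ord 1 j"
    "m \<le> ord \<Longrightarrow> sbp_S0 ord 1 Q + trunc_S ord m + \<rho> = 0"
proof -
  consider (2) "ord = 2" "m = 3" | (44) "ord = 4" "m = 4" | (45) "ord = 4" "m = 5" using assms by force
  then show ?thesis
  proof cases
    case 2
    \<comment> \<open>The only error of order two sits in row 0, so it is already a multiple of
      \<open>e0\<close> and the layer is zero.\<close>
    have "sbp_D 2 1 (layer 0 0 0) j = - trunc_D 2 3 j + 1/2 * e0 j / sbp_H 2 1 j" for j
    proof (cases j rule: less_4_or)
      case boundary
      then show ?thesis
        by (elim disjE) (simp_all only: sbp_boundary_rows_2 layer_values trunc_values_2, simp_all add: e0_def)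
    next
      case (interior n)
      then show ?thesis
        using sbp_D_layer_interior[of 2 0 0 0 n] by (simp add: trunc_D_def e0_def)
    qed
    then show ?thesis using that[where \<rho> = "1/2", OF layer_bound[of 0 0 0]] 2 by simp
  next
    case 44
    \<comment> \<open>Rows 1 to 3 determine the three values, and row 0 then fixes
      \<open>?\<rho>\<close>.\<close>
    let ?Q = "layer (-1/36) (1769/42372 - 32/10593 * sqrt 3) (296/10593 - 64/10593 * sqrt 3)"
    let ?\<rho> = "-13379/28248 + 544/10593 * sqrt 3"
    have "sbp_D 4 1 ?Q j = - trunc_D 4 4 j + ?\<rho> * e0 j / sbp_H 4 1 j" for j
    proof (cases j rule: less_4_or)
      case boundary
      then show ?thesis
        by (elim disjE) (simp_all only: sbp_boundary_rows_4 layer_values trunc_values_4,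
            simp_all add: e0_def algebra_simps sqrt_3_mult, (simp add: field_simps)+)
    next
      case (interior n)
      then show ?thesis
        using sbp_D_layer_interior[of 4] by (simp add: trunc_D_def e0_def)
    qed
    \<comment> \<open>Without this the corrector for m = 4 would carry a slope of size h^3. For m =
      5 the same expression equals -1/180, which explains the restriction to m <= ord.\<close>
    moreover have "sbp_S0 4 1 ?Q + trunc_S 4 4 + ?\<rho> = 0"
      unfolding sbp_boundary_rows_4 layer_values trunc_values_4 by (simp add: algebra_simps sqrt_3_mult) (simp add: field_simps)
    ultimately show ?thesis
      using that[OF layer_bound[of "-1/36" "1769/42372 - 32/10593 * sqrt 3" "296/10593 - 64/10593 * sqrt 3"]] 44 by simp
  next
    case 45
    let ?Q = "layer (1/24) (2561/28248 - 43/7062 * sqrt 3) (1591/28248 - 43/3531 * sqrt 3)"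
    let ?\<rho> = "-50575/84744 + 731/7062 * sqrt 3"
    have "sbp_D 4 1 ?Q j = - trunc_D 4 5 j + ?\<rho> * e0 j / sbp_H 4 1 j" for j
    proof (cases j rule: less_4_or)
      case boundary
      then show ?thesis
        by (elim disjE) (simp_all only: sbp_boundary_rows_4 layer_values trunc_values_4,
            simp_all add: e0_def algebra_simps sqrt_3_mult, (simp add: field_simps)+)
    next
      case (interior n)
      then show ?thesis
        using sbp_D_layer_interior[of 4] by (simp add: trunc_D_def e0_def)
    qed
    then show ?thesis
      using that[where \<rho> = ?\<rho>, OF layer_bound[of "1/24" "2561/28248 - 43/7062 * sqrt 3" "1591/28248 - 43/3531 * sqrt 3"]] 45 by simp
  qed
qed

text \<open>Real and imaginary parts of a multiple of \<open>exp ((\<i> - 1) x)\<close> and its derivatives.\<close>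

primrec osc_coeff :: "real \<Rightarrow> real \<Rightarrow> nat \<Rightarrow> real \<times> real" where
  "osc_coeff a b 0 = (a, b)"
| "osc_coeff a b (Suc m) = (snd (osc_coeff a b m) - fst (osc_coeff a b m), - (fst (osc_coeff a b m) + snd (osc_coeff a b m)))"

definition osc :: "real \<Rightarrow> real \<Rightarrow> nat \<Rightarrow> real \<Rightarrow> real" where
  "osc a b m x = exp (- x) * (fst (osc_coeff a b m) * cos x + snd (osc_coeff a b m) * sin x)"

lemma smooth_tower_osc: "smooth_tower (osc a b)"
  unfolding smooth_tower_def osc_def
  by (auto intro!: derivative_eq_intros simp: algebra_simps)

lemma osc_bound: "\<bar>osc a b m x\<bar> \<le> 2 ^ m * (\<bar>a\<bar> + \<bar>b\<bar>) * exp (- x)"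
proof -
  have coeff: "\<bar>fst (osc_coeff a b m)\<bar> + \<bar>snd (osc_coeff a b m)\<bar> \<le> 2 ^ m * (\<bar>a\<bar> + \<bar>b\<bar>)"
    by (induction m) auto
  have "\<bar>fst (osc_coeff a b m) * cos x + snd (osc_coeff a b m) * sin x\<bar>
      \<le> \<bar>fst (osc_coeff a b m)\<bar> * 1 + \<bar>snd (osc_coeff a b m)\<bar> * 1"
    by (rule order_trans[OF abs_triangle_ineq]) (unfold abs_mult, intro add_mono mult_left_mono; simp)
  also have "\<dots> \<le> 2 ^ m * (\<bar>a\<bar> + \<bar>b\<bar>)" using coeff by simp
  finally have "exp (- x) * \<bar>fst (osc_coeff a b m) * cos x + snd (osc_coeff a b m) * sin x\<bar>
      \<le> exp (- x) * (2 ^ m * (\<bar>a\<bar> + \<bar>b\<bar>))"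
    by (intro mult_left_mono) auto
  then show ?thesis by (simp add: osc_def abs_mult mult.commute)
qed

definition trunc_total :: "nat \<Rightarrow> real" where
  "trunc_total ord = (\<Sum>m<ord + 2. (\<Sum>j<4. \<bar>trunc_D ord m j\<bar>) + \<bar>trunc_S ord m\<bar>)"

lemma trunc_le_total:
  assumes "m < ord + 2"
  shows "\<bar>trunc_D ord m j\<bar> \<le> trunc_total ord" "\<bar>trunc_S ord m\<bar> \<le> trunc_total ord" "trunc_total ord \<ge> 0"
proof -
  let ?t = "\<lambda>m. (\<Sum>j<4. \<bar>trunc_D ord m j\<bar>) + \<bar>trunc_S ord m\<bar>"
  have "?t m \<le> trunc_total ord"
    unfolding trunc_total_def using assms by (intro member_le_sum[of m _ ?t]) (auto intro!: add_nonneg_nonneg sum_nonneg)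
  moreover have "\<bar>trunc_D ord m j\<bar> \<le> (\<Sum>j<4. \<bar>trunc_D ord m j\<bar>)"
  proof (cases "j < 4")
    case True
    then show ?thesis by (intro member_le_sum[of j _ "\<lambda>j. \<bar>trunc_D ord m j\<bar>"]) auto
  next
    case False
    then show ?thesis by (simp add: trunc_D_def sum_nonneg)
  qed
  moreover have "0 \<le> (\<Sum>j<4. \<bar>trunc_D ord m j\<bar>)" by (simp add: sum_nonneg)
  ultimately show "\<bar>trunc_D ord m j\<bar> \<le> trunc_total ord" "\<bar>trunc_S ord m\<bar> \<le> trunc_total ord" "trunc_total ord \<ge> 0"
    by linarith+
qed

lemma exp_weight_lower: "(j::nat) < 4 \<Longrightarrow> h \<le> 1 \<Longrightarrow> 0 \<le> h \<Longrightarrow> 1 \<le> exp 3 * exp (- (real j * h))"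
proof -
  assume "j < 4" "h \<le> 1" "0 \<le> h"
  then have "real j * h \<le> 3 * 1" by (intro mult_mono) auto
  then show ?thesis by (simp flip: exp_add)
qed

text \<open>A smooth decaying profile with prescribed value and slope at the interface stands in for the
  non-decaying part of a static solution.\<close>

lemma decaying_profile:
  assumes ord: "ord \<in> {2, 4}"
  obtains C where "C \<ge> 0" "\<And>h a \<mu>. 0 < h \<Longrightarrow> h \<le> 1 \<Longrightarrow> \<exists>e. e 0 = a \<and>
      (\<forall>j. \<bar>e j\<bar> \<le> C * (\<bar>a\<bar> + \<bar>\<mu>\<bar>) * exp (- (real j * h))) \<and>
      (\<forall>j. \<bar>sbp_D ord h e j\<bar> \<le> C * (\<bar>a\<bar> + \<bar>\<mu>\<bar>) * exp (- (real j * h))) \<and>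
      \<bar>sbp_S0 ord h e - \<mu>\<bar> \<le> C * (\<bar>a\<bar> + \<bar>\<mu>\<bar>) * h"
proof -
  have K: "trunc_const \<ge> 0" by (simp add: trunc_const_def)
  define B where "B = (2::real) ^ 7"
  define G where "G = real (ord + 2) * trunc_total ord"
  have G0: "G \<ge> 0" using trunc_le_total(3)[of 0 ord] by (simp add: G_def)
  define C where "C = B * (1 + G * exp 3 + trunc_const)"
  show ?thesis
  proof (rule that[of C])
    show "C \<ge> 0" using K G0 by (simp add: C_def B_def)
    fix h a \<mu> :: real assume h: "0 < h" "h \<le> 1"
    define N where "N = \<bar>a\<bar> + \<bar>\<mu>\<bar>"
    \<comment> \<open>The slope of \<open>osc a b\<close> at 0 is b - a. An oscillating factor stays
      bounded, so value and slope are matched within the weight exp(-x); a linear factor times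
      exp(-x) would exceed it.\<close>
    define d where "d = osc a (a + \<mu>)"
    have d: "smooth_tower d" unfolding d_def by (rule smooth_tower_osc)
    have dm: "\<bar>d m x\<bar> \<le> B * N * exp (- x)" if "m \<le> ord + 2" for m x
    proof -
      have "\<bar>d m x\<bar> \<le> 2 ^ m * (\<bar>a\<bar> + \<bar>a + \<mu>\<bar>) * exp (- x)" unfolding d_def by (rule osc_bound)
      also have "\<dots> \<le> 2 ^ 6 * (2 * N) * exp (- x)"
        using ord that by (intro mult_mono power_increasing) (auto simp: N_def)
      finally show ?thesis by (simp add: B_def)
    qed
    have N0: "N \<ge> 0" "B * N \<ge> 0" by (auto simp: N_def B_def)
    let ?e = "\<lambda>k. d 0 (real k * h)"
    have hpow: "h ^ k \<le> 1" for k using h by (simp add: power_le_one)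
    show "\<exists>e. e 0 = a \<and>
      (\<forall>j. \<bar>e j\<bar> \<le> C * (\<bar>a\<bar> + \<bar>\<mu>\<bar>) * exp (- (real j * h))) \<and>
      (\<forall>j. \<bar>sbp_D ord h e j\<bar> \<le> C * (\<bar>a\<bar> + \<bar>\<mu>\<bar>) * exp (- (real j * h))) \<and>
      \<bar>sbp_S0 ord h e - \<mu>\<bar> \<le> C * (\<bar>a\<bar> + \<bar>\<mu>\<bar>) * h"
    proof (rule exI[of _ ?e], intro conjI allI)
      show "d 0 (real 0 * h) = a" by (simp add: d_def osc_def)
      show "\<bar>d 0 (real j * h)\<bar> \<le> C * (\<bar>a\<bar> + \<bar>\<mu>\<bar>) * exp (- (real j * h))" for j
      proof -
        have "B * N * exp (- (real j * h)) \<le> C * N * exp (- (real j * h))"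
          using K G0 N0 by (intro mult_right_mono) (auto simp: C_def B_def)
        then show ?thesis using dm[of 0 "real j * h"] by (simp add: N_def)
      qed
      show "\<bar>sbp_D ord h ?e j\<bar> \<le> C * (\<bar>a\<bar> + \<bar>\<mu>\<bar>) * exp (- (real j * h))" for j
      proof -
        let ?E = "exp (- (real j * h))"
        have "\<bar>\<Sum>m<ord + 2. d m 0 * h ^ m / h\<^sup>2 * trunc_D ord m j\<bar> \<le> (\<Sum>m<ord + 2. B * N * trunc_total ord * exp 3 * ?E)"
        proof (rule order_trans[OF sum_abs sum_mono])
          fix m assume m: "m \<in> {..<ord + 2}"
          show "\<bar>d m 0 * h ^ m / h\<^sup>2 * trunc_D ord m j\<bar> \<le> B * N * trunc_total ord * exp 3 * ?E"
          proof (cases "m < 2 \<or> j \<ge> 4")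
            case True
            then have "trunc_D ord m j = 0"
              using trunc_consistency(1)[OF ord, of m j] by (auto simp: trunc_D_def)
            then show ?thesis using N0 trunc_le_total(3)[of 0 ord] by simp
          next
            case False
            then obtain k where k: "m = k + 2" by (metis add.commute le_Suc_ex linorder_not_less)
            have "\<bar>d m 0 * h ^ m / h\<^sup>2 * trunc_D ord m j\<bar> = \<bar>d m 0\<bar> * h ^ k * \<bar>trunc_D ord m j\<bar>"
              using h by (simp add: k abs_mult power_add power2_eq_square)
            also have "\<dots> \<le> B * N * 1 * trunc_total ord"
              using dm[of m 0] m hpow h N0 trunc_le_total(1)[of m ord j]
              by (intro mult_mono) auto
            also have "\<dots> \<le> (B * N * trunc_total ord) * (exp 3 * ?E)"
              using mult_left_mono[OF exp_weight_lower[of j h], of "B * N * trunc_total ord"] False h N0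
                trunc_le_total(3)[of 0 ord] by simp
            finally show ?thesis by (simp add: mult.assoc)
          qed
        qed
        also have "\<dots> = B * N * (G * exp 3) * ?E" by (simp add: G_def)
        finally have 1: "\<bar>\<Sum>m<ord + 2. d m 0 * h ^ m / h\<^sup>2 * trunc_D ord m j\<bar> \<le> B * N * (G * exp 3) * ?E" .
        have "\<bar>D_defect ord h d j\<bar> \<le> trunc_const * (B * N) * h ^ ord * ?E"
          by (rule sbp_D_truncation[OF ord d h dm]) simp
        also have "\<dots> \<le> trunc_const * (B * N) * 1 * ?E"
          using K N0 hpow by (intro mult_right_mono mult_left_mono) auto
        finally have 2: "\<bar>D_defect ord h d j\<bar> \<le> trunc_const * (B * N) * ?E" by simp
        have 3: "\<bar>d 2 (real j * h)\<bar> \<le> B * N * ?E" using dm[of 2] by simp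
        have "C * N * ?E = B * N * ?E + B * N * (G * exp 3) * ?E + trunc_const * (B * N) * ?E"
          by (simp add: C_def algebra_simps)
        then show ?thesis using 1 2 3 unfolding N_def[symmetric] D_defect_def by linarith
      qed
      show "\<bar>sbp_S0 ord h ?e - \<mu>\<bar> \<le> C * (\<bar>a\<bar> + \<bar>\<mu>\<bar>) * h"
      proof -
        have "\<bar>\<Sum>m<ord + 2. d m 0 * h ^ m / h * trunc_S ord m\<bar> \<le> (\<Sum>m<ord + 2. B * N * trunc_total ord * h)"
        proof (rule order_trans[OF sum_abs sum_mono])
          fix m assume m: "m \<in> {..<ord + 2}"
          show "\<bar>d m 0 * h ^ m / h * trunc_S ord m\<bar> \<le> B * N * trunc_total ord * h"
          proof (cases "m < 2")
            case True
            then have "trunc_S ord m = 0"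
              using trunc_consistency(2)[OF ord, of m] by auto
            then show ?thesis using N0 trunc_le_total(3)[of 0 ord] h by simp
          next
            case False
            then obtain k where k: "m = k + 2" by (metis add.commute le_Suc_ex linorder_not_less)
            have "\<bar>d m 0 * h ^ m / h * trunc_S ord m\<bar> = \<bar>d m 0\<bar> * h ^ k * \<bar>trunc_S ord m\<bar> * h"
              using h by (simp add: k abs_mult power_add power2_eq_square)
            also have "\<dots> \<le> B * N * 1 * trunc_total ord * h"
              using dm[of m 0] m hpow h N0 trunc_le_total(2)[of m ord]
              by (intro mult_mono) auto
            finally show ?thesis by simp
          qed
        qed
        also have "\<dots> = B * N * G * h" by (simp add: G_def)
        also have "\<dots> \<le> B * N * (G * exp 3) * h"
          using N0 G0 h by (intro mult_right_mono mult_left_mono) (auto simp: mult_le_cancel_left1)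
        finally have 1: "\<bar>\<Sum>m<ord + 2. d m 0 * h ^ m / h * trunc_S ord m\<bar> \<le> B * N * (G * exp 3) * h" .
        have "\<bar>S_defect ord h d\<bar> \<le> trunc_const * (B * N) * h ^ ord * h"
          using sbp_S0_truncation[OF ord d h dm[OF order_refl]] .
        also have "\<dots> \<le> trunc_const * (B * N) * 1 * h"
          using N0 hpow h K by (intro mult_right_mono mult_left_mono) auto
        finally have 2: "\<bar>S_defect ord h d\<bar> \<le> trunc_const * (B * N) * h" by simp
        have 3: "d 1 0 = \<mu>" by (simp add: d_def osc_def)
        have 4: "0 \<le> B * N * h" using N0 h by auto
        have "C * N * h = B * N * h + B * N * (G * exp 3) * h + trunc_const * (B * N) * h"
          by (simp add: C_def algebra_simps)
        then show ?thesis using 1 2 3 4 unfolding N_def[symmetric] S_defect_def by linarith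
      qed
    qed
  qed
qed

section \<open>Correctors of the coupled scheme\<close>

definition grid_point :: "real \<Rightarrow> real \<Rightarrow> nat + nat \<Rightarrow> real" where
  "grid_point hL hR = case_sum (\<lambda>j. - real j * hL) (\<lambda>j. real j * hR)"

abbreviation grid_decay :: "real \<Rightarrow> real \<Rightarrow> nat + nat \<Rightarrow> real" where
  "grid_decay hL hR i \<equiv> exp (- \<bar>grid_point hL hR i\<bar>)"

lemma exp_grid_point:
  assumes "hL > 0" "hR > 0"
  shows "grid_decay hL hR (Inl j) = exp (- (real j * hL))"
    "grid_decay hL hR (Inr j) = exp (- (real j * hR))"
  using assms by (simp_all add: grid_point_def abs_mult)

text \<open>Contribution of \<open>x\<^sup>m / m!\<close> to the truncation error of the scheme. Left grid functions are indexed
  away from the interface, hence the factor \<open>(- hL)\<^sup>m\<close>.\<close>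

definition trunc_L :: "nat \<Rightarrow> real \<Rightarrow> real \<Rightarrow> nat \<Rightarrow> nat \<Rightarrow> real" where
  "trunc_L ord hL hR m j = (- hL) ^ m / hL\<^sup>2 * trunc_D ord m j
     - 1/2 * inverse (sbp_H ord hL j) * e0 j * (- ((- hL) ^ m / hL * trunc_S ord m) - hR ^ m / hR * trunc_S ord m)"

text \<open>The right block is the reflected left one with the mesh sizes exchanged; reflection
  multiplies x^m by (-1)^m.\<close>

definition scheme_trunc :: "nat \<Rightarrow> real \<Rightarrow> real \<Rightarrow> nat \<Rightarrow> nat + nat \<Rightarrow> real" where
  "scheme_trunc ord hL hR m = case_sum (trunc_L ord hL hR m) (\<lambda>j. (- 1) ^ m * trunc_L ord hR hL m j)"

abbreviation corrects ::
  "nat \<Rightarrow> real \<Rightarrow> real \<Rightarrow> real \<Rightarrow> nat \<Rightarrow> (nat + nat \<Rightarrow> real) \<Rightarrow> (nat + nat \<Rightarrow> real) \<Rightarrow> bool" where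
  "corrects ord lam hL hR m W b \<equiv> \<forall>i. \<bar>W i\<bar> \<le> b i \<and>
     \<bar>scheme_op ord hL hR (lam * tau_min ord hL hR) W i + scheme_trunc ord hL hR m i\<bar> \<le> b i"

text \<open>In the interface row a slope error is divided by \<open>sbp_H\<close>, which is of size
  h', so it has to bring its own factor h'.\<close>

lemma inverse_sbp_H_e0_bound:
  assumes h': "h' > 0" and x: "\<bar>x\<bar> \<le> K * h'"
  shows "\<bar>1/2 * inverse (sbp_H ord h' j) * e0 j * x\<bar> \<le> 3/2 * K * exp (- (real j * h'))" (is "_ \<le> ?r")
    and "4 \<le> j \<Longrightarrow> 1/2 * inverse (sbp_H ord h' j) * e0 j * x = 0"
proof -
  have K: "K \<ge> 0" using order_trans[OF abs_ge_zero x] h' by (simp add: zero_le_mult_iff)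
  show "\<bar>1/2 * inverse (sbp_H ord h' j) * e0 j * x\<bar> \<le> ?r"
  proof (cases "j = 0")
    case True
    have pos: "sbp_H ord h' j > 0" by (rule sbp_H_pos[OF h'])
    have "inverse (sbp_H ord h' j) \<le> inverse (h' / 3)"
      using sbp_H_ge[OF h'] h' by (intro le_imp_inverse_le) auto
    then have i: "inverse (sbp_H ord h' j) \<le> 3 / h'" by simp
    have "\<bar>1/2 * inverse (sbp_H ord h' j) * e0 j * x\<bar> = 1/2 * inverse (sbp_H ord h' j) * \<bar>x\<bar>"
      using True pos by (simp add: e0_def abs_mult)
    also have "\<dots> \<le> 1/2 * (3 / h') * (K * h')"
      using x i pos h' by (intro mult_mono) auto
    also have "\<dots> = ?r" using True h' by simp
    finally show ?thesis .
  qed (use K in \<open>simp add: e0_def\<close>)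
qed (simp add: e0_def)

lemma finite_row_combination:
  assumes "finite_row f"
  shows "f (\<lambda>j. a * x j + b * y j + z j) = a * f x + b * f y + f z"
proof -
  have "f (\<lambda>j. 1 * (a * x j + b * y j) + 1 * z j) = 1 * f (\<lambda>j. a * x j + b * y j) + 1 * f z"
    by (rule finite_row_linear[OF assms])
  then show ?thesis by (simp add: finite_row_linear[OF assms])
qed

lemma sbp_D_combination:
  "sbp_D ord h (\<lambda>j. a * x j + b * y j + z j) i = a * sbp_D ord h x i + b * sbp_D ord h y i + sbp_D ord h z i"
  using finite_row_combination[OF finite_row_sbp_D[of ord h "\<lambda>k. k" i]] by simp

lemma sbp_S0_combination:
  "sbp_S0 ord h (\<lambda>j. a * x j + b * y j + z j) = a * sbp_S0 ord h x + b * sbp_S0 ord h y + sbp_S0 ord h z"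
  using finite_row_combination[OF finite_row_sbp_S0[of ord h "\<lambda>k. k"]] by simp

text \<open>\<open>Q\<close> cancels the boundary truncation terms, and \<open>P\<close> with
  weights -d/2 and d/2 cancels the penalty through S^T of the jump d. A multiple of
  \<open>e0\<close> is left, and \<open>balance\<close> says that it vanishes; of the profiles only
  their D and their slope errors remain. Since d is also the jump of the sum itself, the values of
  the profiles at the interface have to be adjusted to it.\<close>

lemma corrector_identity:
  fixes Q P eL eR :: "nat \<Rightarrow> real"
  assumes h: "hL > 0" "hR > 0"
    and Q: "sbp_D ord 1 Q j = - g + \<rho> * e0 j / sbp_H ord 1 j"
    and P: "sbp_D ord 1 P j = - (sbp_ST_e0 ord 1 j / sbp_H ord 1 j) - e0 j * sbp_S0 ord 1 P / sbp_H ord 1 j"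
    and SL: "sbp_S0 ord hL eL = \<epsilon>L - YL / hL * (sbp_S0 ord 1 Q + s + \<rho>)"
    and SR: "sbp_S0 ord hR eR = \<epsilon>R - YR / hR * (sbp_S0 ord 1 Q + s + \<rho>)"
    and balance: "1/2 * (YR * \<rho> / hR - YL * \<rho> / hL) - d * sbp_S0 ord 1 P / 4 * (1 / hL + 1 / hR) + \<tau> * d = 0"
  defines "WL \<equiv> \<lambda>j. YL * Q j + (- d / 2) * P j + eL j" and "WR \<equiv> \<lambda>j. YR * Q j + (d / 2) * P j + eR j"
  assumes jump: "jump WL WR = d"
  shows "rhs_L ord hL hR \<tau> WL WR j + (YL / hL\<^sup>2 * g - 1/2 * inverse (sbp_H ord hL j) * e0 j * (- (YL / hL * s) - YR / hR * s))
      = sbp_D ord hL eL j + 1/2 * inverse (sbp_H ord hL j) * e0 j * (\<epsilon>L + \<epsilon>R)"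
proof -
  define iL iR k where "iL = inverse hL" and "iR = inverse hR" and "k = inverse (sbp_H ord 1 j)"
  define e T \<sigma> where "e = e0 j" and "T = sbp_ST_e0 ord 1 j" and "\<sigma> = sbp_S0 ord 1 P"
  have D1: "sbp_D ord 1 Q j = - g + \<rho> * e * k" "sbp_D ord 1 P j = - (T * k) - e * \<sigma> * k"
    using Q P by (simp_all add: e_def k_def T_def \<sigma>_def divide_inverse)
  have sc: "sbp_D ord h v j = inverse h ^ 2 * sbp_D ord 1 v j" if "h > 0" for h v
    using sbp_D_scale[of h ord v j] that by (simp add: divide_inverse power_inverse mult.commute)
  have DL: "sbp_D ord hL WL j = iL\<^sup>2 * (YL * (- g + \<rho> * e * k) + (- d / 2) * (- (T * k) - e * \<sigma> * k)) + sbp_D ord hL eL j"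
    unfolding WL_def sbp_D_combination sc[OF h(1), of Q] sc[OF h(1), of P] D1 iL_def by (simp add: algebra_simps)
  have S: "sbp_S0 ord hL WL = \<epsilon>L - YL * iL * (s + \<rho>) - d / 2 * iL * \<sigma>" "sbp_S0 ord hR WR = \<epsilon>R - YR * iR * (s + \<rho>) + d / 2 * iR * \<sigma>"
    unfolding WL_def WR_def sbp_S0_combination SL SR sbp_S0_scale[of ord hL Q] sbp_S0_scale[of ord hL P]
      sbp_S0_scale[of ord hR Q] sbp_S0_scale[of ord hR P]
    using h by (simp_all add: iL_def iR_def \<sigma>_def field_simps)
  have H: "inverse (sbp_H ord hL j) = iL * k"
    unfolding sbp_H_scale[of ord hL] by (simp add: iL_def k_def)
  have ST: "sbp_ST_e0 ord hL j = T * iL"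
    unfolding sbp_ST_e0_scale[of ord hL] by (simp add: T_def iL_def divide_inverse)
  have bal: "\<tau> * d = d * \<sigma> / 4 * (iL + iR) - 1/2 * (YR * \<rho> * iR - YL * \<rho> * iL)"
    using balance h by (simp add: \<sigma>_def iL_def iR_def field_simps)
  have div: "YL / hL\<^sup>2 = YL * iL\<^sup>2" "YL / hL = YL * iL" "YR / hR = YR * iR"
    by (simp_all add: iL_def iR_def divide_inverse power_inverse)
  define b where "b = d * \<sigma> / 4 * (iL + iR) - 1/2 * (YR * \<rho> * iR - YL * \<rho> * iL) - \<tau> * d"
  have b: "b = 0" using bal by (simp add: b_def)
  have "rhs_L ord hL hR \<tau> WL WR j + (YL / hL\<^sup>2 * g - 1/2 * inverse (sbp_H ord hL j) * e0 j * (- (YL / hL * s) - YR / hR * s))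
      - (sbp_D ord hL eL j + 1/2 * inverse (sbp_H ord hL j) * e0 j * (\<epsilon>L + \<epsilon>R)) = iL * k * e * b"
    unfolding rhs_L_def jump jump_S_def DL S H ST div e_def[symmetric] b_def
    by (simp add: field_simps power2_eq_square)
  then show ?thesis unfolding b by simp
qed

text \<open>Layers and interface values have size h^m with m >= ord. Slopes have size h^(m-1), but
  their coefficient is zero unless m > ord. So every part is O(h^ord), with a constant depending on
  r and lam and not on h.\<close>

lemma corrector:
  assumes ord: "ord \<in> {2, 4}" and m: "ord div 2 + 2 \<le> m" "m < ord + 2" and r: "r > 0" and lam: "lam > 1"
  shows "\<exists>C\<ge>0. \<forall>h. 0 < h \<longrightarrow> h \<le> 1 \<longrightarrow> h / r \<le> 1 \<longrightarrow> (\<exists>W. corrects ord lam h (h / r) m W (\<lambda>i. C * h ^ ord * grid_decay h (h / r) i))"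
proof -
  obtain P cP where P: "\<And>j. \<bar>P j\<bar> \<le> cP * exp (- real j)" "sbp_S0 ord 1 P > 0"
    "\<And>j. sbp_D ord 1 P j = - (sbp_ST_e0 ord 1 j / sbp_H ord 1 j) - e0 j * sbp_S0 ord 1 P / sbp_H ord 1 j"
    using flux_layer[OF ord] by metis
  obtain Q \<rho> cQ where Q: "\<And>j. \<bar>Q j\<bar> \<le> cQ * exp (- real j)"
    "\<And>j. sbp_D ord 1 Q j = - trunc_D ord m j + \<rho> * e0 j / sbp_H ord 1 j"
    "m \<le> ord \<Longrightarrow> sbp_S0 ord 1 Q + trunc_S ord m + \<rho> = 0"
    using truncation_layer[OF ord m] by metis
  obtain CE where CE: "CE \<ge> 0" "\<And>h a \<mu>. 0 < h \<Longrightarrow> h \<le> 1 \<Longrightarrow> \<exists>e. e 0 = a \<and>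
      (\<forall>j. \<bar>e j\<bar> \<le> CE * (\<bar>a\<bar> + \<bar>\<mu>\<bar>) * exp (- (real j * h))) \<and>
      (\<forall>j. \<bar>sbp_D ord h e j\<bar> \<le> CE * (\<bar>a\<bar> + \<bar>\<mu>\<bar>) * exp (- (real j * h))) \<and>
      \<bar>sbp_S0 ord h e - \<mu>\<bar> \<le> CE * (\<bar>a\<bar> + \<bar>\<mu>\<bar>) * h"
    using decaying_profile[OF ord] by metis
  have cP0: "cP \<ge> 0" and cQ0: "cQ \<ge> 0"
    using order_trans[OF abs_ge_zero P(1)[of 0]] order_trans[OF abs_ge_zero Q(1)[of 0]] by simp_all
  define \<sigma> where "\<sigma> = sbp_S0 ord 1 P"
  define \<alpha> where "\<alpha> = sbp_alpha ord"
  have \<alpha>: "\<alpha> > 0" using psd_shift_alpha[OF ord] by (simp add: \<alpha>_def)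
  have "P \<longlonglongrightarrow> 0"
  proof (rule Lim_null_comparison)
    show "\<forall>\<^sub>F j in sequentially. norm (P j) \<le> cP * exp (- 1) ^ j"
      using P(1) by (simp flip: exp_of_nat_mult)
    show "(\<lambda>j. cP * exp (- 1) ^ j) \<longlonglongrightarrow> 0"
      using tendsto_mult_right_zero[OF LIMSEQ_power_zero[of "exp (- 1 :: real)"]] by simp
  qed
  moreover have "sbp_A ord 1 P j = sbp_ST_e0 ord 1 j" for j
    using sbp_H_pos[of 1 ord j] unfolding sbp_A_def P(3) by (simp add: field_simps)
  ultimately have "\<alpha> * \<sigma> \<le> 1"
    unfolding \<alpha>_def \<sigma>_def using sbp_alpha_mult_le_1[OF ord _ P(2)] by blast
  then have "\<sigma> \<le> 1 / \<alpha>" using \<alpha> by (simp add: field_simps)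
  also have "\<dots> < lam / \<alpha>" using lam \<alpha> by (intro divide_strict_right_mono) auto
  finally have "\<sigma> < lam / \<alpha>" .
  define k where "k = lam / \<alpha> - \<sigma>"
  have k: "k > 0" using \<open>\<sigma> < lam / \<alpha>\<close> by (simp add: k_def)
  \<comment> \<open>The slope, up to the factor h^(m-1) and the side, that the profiles have to
    supply to the interface row.\<close>
  define \<theta> where "\<theta> = - (sbp_S0 ord 1 Q + trunc_S ord m + \<rho>)"
  \<comment> \<open>For hR = h / r every term of the balance is a multiple of h^m / h, which leaves
    a linear equation for d1 = d / h^m with coefficient (1 + r) * k / 4. The interface value
    \<open>a1\<close> makes the jump of the sum equal to d; the left profile carries all of
    it.\<close>
  define yL yR d1 a1 where "yL = (- 1 :: real) ^ m" and "yR = (1 / r) ^ m"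
    and "d1 = - (2 * \<rho> * (r * yR - yL)) / ((1 + r) * k)" and "a1 = d1 + d1 * P 0 + (yR - yL) * Q 0"
  define N where "N = \<bar>a1\<bar> + \<bar>\<theta>\<bar> + \<bar>yR * \<theta> * r\<bar>"
  define C where "C = (1 + yR) * cQ + \<bar>d1\<bar> * cP + CE * N * (1 + 3/2 * (1 + 1 / r) * (1 + r))"
  have yR: "yR > 0" using r by (simp add: yR_def)
  have N0: "N \<ge> 0" by (simp add: N_def)
  have m_ge: "ord \<le> m" using ord m by auto
  show ?thesis
  proof (rule exI[of _ C], intro conjI allI impI)
    show C0: "C \<ge> 0" using cP0 cQ0 CE(1) yR N0 r by (simp add: C_def)
    fix h :: real assume h: "0 < h" "h \<le> 1" "h / r \<le> 1"
    define hR where "hR = h / r"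
    have hR: "hR > 0" "hR \<le> 1" using h r by (simp_all add: hR_def)
    define B where "B = h ^ m"
    have B0: "B \<ge> 0" using h by (simp add: B_def)
    have B: "B \<le> h ^ ord" unfolding B_def using h m_ge by (intro power_decreasing) auto
    \<comment> \<open>For m <= ord the left side is zero; otherwise B / h = h^(m-1) with m - 1 >=
      ord.\<close>
    have \<theta>B: "\<bar>\<theta> * B / h\<bar> \<le> \<bar>\<theta>\<bar> * h ^ ord"
    proof (cases "m \<le> ord")
      case True
      then show ?thesis using Q(3) by (simp add: \<theta>_def)
    next
      case False
      then obtain i where "m = ord + 1 + i" using le_Suc_ex[of "ord + 1" m] by auto
      then have "B / h = h ^ ord * h ^ i" using h by (simp add: B_def power_add)
      moreover have "h ^ ord * h ^ i \<le> h ^ ord * 1" using h by (intro mult_left_mono) (auto simp: power_le_one)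
      moreover have "h ^ ord * h ^ i \<ge> 0" using h by simp
      ultimately have "\<bar>B / h\<bar> \<le> h ^ ord" by simp
      then have "\<bar>\<theta>\<bar> * \<bar>B / h\<bar> \<le> \<bar>\<theta>\<bar> * h ^ ord" by (intro mult_left_mono) auto
      then show ?thesis by (simp add: abs_mult)
    qed
    define YL YR d where "YL = (- h) ^ m" and "YR = hR ^ m" and "d = d1 * B"
    have YL: "YL = yL * B" by (simp add: YL_def yL_def B_def power_minus[of h])
    have YR: "YR = yR * B" by (simp add: YR_def yR_def B_def hR_def power_divide)
    define \<mu>L \<mu>R where "\<mu>L = YL * \<theta> / h" and "\<mu>R = YR * \<theta> / hR"
    have \<mu>L: "\<bar>\<mu>L\<bar> \<le> \<bar>\<theta>\<bar> * h ^ ord"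
      using \<theta>B by (simp add: \<mu>L_def YL yL_def abs_mult mult.commute)
    have \<mu>R: "\<bar>\<mu>R\<bar> \<le> \<bar>yR * \<theta> * r\<bar> * h ^ ord"
    proof -
      have "\<mu>R = (yR * r) * (\<theta> * B / h)" using r by (simp add: \<mu>R_def YR hR_def)
      then have "\<bar>\<mu>R\<bar> = (yR * r) * \<bar>\<theta> * B / h\<bar>" using yR r by (simp add: abs_mult)
      also have "\<dots> \<le> (yR * r) * (\<bar>\<theta>\<bar> * h ^ ord)" using \<theta>B yR r by (intro mult_left_mono) auto
      finally show ?thesis using yR r by (simp add: abs_mult mult_ac)
    qed
    have a1: "\<bar>a1 * B\<bar> \<le> \<bar>a1\<bar> * h ^ ord" using B B0 by (simp add: abs_mult mult_left_mono)
    obtain eL where eL: "eL 0 = a1 * B" "\<And>j. \<bar>eL j\<bar> \<le> CE * (\<bar>a1 * B\<bar> + \<bar>\<mu>L\<bar>) * exp (- (real j * h))"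
      "\<And>j. \<bar>sbp_D ord h eL j\<bar> \<le> CE * (\<bar>a1 * B\<bar> + \<bar>\<mu>L\<bar>) * exp (- (real j * h))"
      "\<bar>sbp_S0 ord h eL - \<mu>L\<bar> \<le> CE * (\<bar>a1 * B\<bar> + \<bar>\<mu>L\<bar>) * h"
      using CE(2)[OF h(1,2), of "a1 * B" \<mu>L] by metis
    obtain eR where eR: "eR 0 = 0" "\<And>j. \<bar>eR j\<bar> \<le> CE * (\<bar>0\<bar> + \<bar>\<mu>R\<bar>) * exp (- (real j * hR))"
      "\<And>j. \<bar>sbp_D ord hR eR j\<bar> \<le> CE * (\<bar>0\<bar> + \<bar>\<mu>R\<bar>) * exp (- (real j * hR))"
      "\<bar>sbp_S0 ord hR eR - \<mu>R\<bar> \<le> CE * (\<bar>0\<bar> + \<bar>\<mu>R\<bar>) * hR"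
      using CE(2)[OF hR, of 0 \<mu>R] by metis
    have NL: "CE * (\<bar>a1 * B\<bar> + \<bar>\<mu>L\<bar>) \<le> CE * N * h ^ ord"
    proof -
      have "\<bar>a1 * B\<bar> + \<bar>\<mu>L\<bar> \<le> (\<bar>a1\<bar> + \<bar>\<theta>\<bar>) * h ^ ord" using a1 \<mu>L by (simp add: distrib_right)
      also have "\<dots> \<le> N * h ^ ord" using h by (intro mult_right_mono) (auto simp: N_def)
      finally show ?thesis using CE(1) by (simp add: mult.assoc mult_left_mono)
    qed
    have NR: "CE * (\<bar>0\<bar> + \<bar>\<mu>R\<bar>) \<le> CE * N * h ^ ord"
    proof -
      have "\<bar>0\<bar> + \<bar>\<mu>R\<bar> \<le> \<bar>yR * \<theta> * r\<bar> * h ^ ord" using \<mu>R by simp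
      also have "\<dots> \<le> N * h ^ ord" using h by (intro mult_right_mono) (auto simp: N_def)
      finally show ?thesis using CE(1) by (simp add: mult.assoc mult_left_mono)
    qed
    define WL WR where "WL = (\<lambda>j. YL * Q j + (- d / 2) * P j + eL j)" and "WR = (\<lambda>j. YR * Q j + (- (- d) / 2) * P j + eR j)"
    define \<epsilon>L \<epsilon>R where "\<epsilon>L = sbp_S0 ord h eL - \<mu>L" and "\<epsilon>R = sbp_S0 ord hR eR - \<mu>R"
    have jump: "jump WL WR = d" "jump WR WL = - d"
      unfolding jump_def WL_def WR_def eL(1) eR(1) d_def a1_def YL YR by (simp_all add: algebra_simps)
    define \<tau> where "\<tau> = lam * tau_min ord h hR"
    have \<tau>: "\<tau> = lam * (1 + r) / (4 * \<alpha> * h)"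
      using h r \<alpha> by (simp add: \<tau>_def tau_min_def hR_def \<alpha>_def[symmetric] field_simps)
    have balance: "1/2 * (YR * \<rho> / hR - YL * \<rho> / h) - d * sbp_S0 ord 1 P / 4 * (1 / h + 1 / hR) + \<tau> * d = 0"
    proof -
      have "d1 * ((1 + r) * k) = - (2 * \<rho> * (r * yR - yL))" using k r by (simp add: d1_def)
      moreover have "\<rho> * (r * yR - yL) / 2 + d1 * (1 + r) * k / 4 = (2 * \<rho> * (r * yR - yL) + d1 * ((1 + r) * k)) / 4"
        by (simp add: field_simps)
      ultimately have eq: "\<rho> * (r * yR - yL) / 2 + d1 * (1 + r) * k / 4 = 0" by simp
      have "1/2 * (YR * \<rho> / hR - YL * \<rho> / h) - d * sbp_S0 ord 1 P / 4 * (1 / h + 1 / hR) + \<tau> * d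
        = (\<rho> * (r * yR - yL) / 2 + d1 * (1 + r) * k / 4) * (B / h)"
        unfolding \<tau> k_def \<sigma>_def[symmetric] YL YR d_def hR_def using h r \<alpha> by (simp add: field_simps)
      then show ?thesis unfolding eq by simp
    qed
    have SL: "sbp_S0 ord h eL = \<epsilon>L - YL / h * (sbp_S0 ord 1 Q + trunc_S ord m + \<rho>)"
      and SR: "sbp_S0 ord hR eR = \<epsilon>R - YR / hR * (sbp_S0 ord 1 Q + trunc_S ord m + \<rho>)"
      by (simp_all add: \<epsilon>L_def \<epsilon>R_def \<mu>L_def \<mu>R_def \<theta>_def minus_add_distrib[symmetric] del: minus_add_distrib)
    have "1/2 * (YL * \<rho> / h - YR * \<rho> / hR) - (- d) * sbp_S0 ord 1 P / 4 * (1 / hR + 1 / h) + \<tau> * (- d) = 0"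
      using balance by (simp add: algebra_simps diff_divide_distrib add_divide_distrib)
    note ident = corrector_identity[OF h(1) hR(1) Q(2) P(3) SL SR balance, folded WL_def WR_def]
      corrector_identity[OF hR(1) h(1) Q(2) P(3) SR SL this]
    have "\<bar>\<epsilon>L\<bar> \<le> CE * N * h ^ ord * h" "\<bar>\<epsilon>R\<bar> \<le> CE * N * h ^ ord * hR"
      using eL(4) mult_right_mono[OF NL, of h] eR(4) mult_right_mono[OF NR, of hR] h hR
      unfolding \<epsilon>L_def \<epsilon>R_def by linarith+
    then have "\<bar>\<epsilon>L + \<epsilon>R\<bar> \<le> CE * N * h ^ ord * ((1 + 1 / r) * h)" by (simp add: hR_def algebra_simps)
    moreover have "h \<le> (1 + r) * h" "h \<le> (1 + r) * hR" using h r by (simp_all add: hR_def field_simps)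
    then have "CE * N * h ^ ord * ((1 + 1 / r) * h) \<le> CE * N * h ^ ord * ((1 + 1 / r) * ((1 + r) * h'))" if "h' = h \<or> h' = hR" for h'
      using that h r CE(1) N0 by (intro mult_left_mono) auto
    ultimately have \<epsilon>: "\<bar>\<epsilon>L + \<epsilon>R\<bar> \<le> (CE * N * h ^ ord * ((1 + 1 / r) * (1 + r))) * h'" if "h' = h \<or> h' = hR" for h'
      using order_trans that by (fastforce simp: mult.assoc)
    have side: "\<bar>y * B * Q j + (- (c * d1 * B) / 2) * P j + e j\<bar> \<le> C * h ^ ord * exp (- (real j * h'))" (is ?V)
      "\<bar>sbp_D ord h' e j + 1/2 * inverse (sbp_H ord h' j) * e0 j * (\<epsilon>L + \<epsilon>R)\<bar> \<le> C * h ^ ord * exp (- (real j * h'))" (is ?R)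
      if y: "\<bar>y\<bar> \<le> 1 + yR" and c: "\<bar>c\<bar> = 1" and h': "h' = h \<or> h' = hR"
        and e: "\<And>j. \<bar>e j\<bar> \<le> K * exp (- (real j * h'))" "\<And>j. \<bar>sbp_D ord h' e j\<bar> \<le> K * exp (- (real j * h'))"
        and K: "K \<le> CE * N * h ^ ord" for y c h' e j K
    proof -
      let ?E = "exp (- (real j * h'))"
      have h'1: "0 < h'" "h' \<le> 1" using h' h hR by auto
      have E: "exp (- real j) \<le> ?E"
        using mult_left_mono[OF h'1(2), of "real j"] by simp
      have Qj: "\<bar>Q j\<bar> \<le> cQ * ?E" and Pj: "\<bar>P j\<bar> \<le> cP * ?E"
        using Q(1)[of j] P(1)[of j] mult_left_mono[OF E cQ0] mult_left_mono[OF E cP0] by linarith+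
      have ej: "\<bar>e j\<bar> \<le> CE * N * h ^ ord * ?E" "\<bar>sbp_D ord h' e j\<bar> \<le> CE * N * h ^ ord * ?E"
      proof -
        have "K * ?E \<le> CE * N * h ^ ord * ?E" using K by (intro mult_right_mono) auto
        then show "\<bar>e j\<bar> \<le> CE * N * h ^ ord * ?E" "\<bar>sbp_D ord h' e j\<bar> \<le> CE * N * h ^ ord * ?E"
          using e[of j] by linarith+
      qed
      have "\<bar>y * B * Q j\<bar> \<le> (1 + yR) * h ^ ord * (cQ * ?E)"
        unfolding abs_mult using y Qj B B0 yR h by (intro mult_mono) auto
      moreover have "\<bar>(- (c * d1 * B) / 2) * P j\<bar> \<le> 1 * \<bar>d1\<bar> * h ^ ord * (cP * ?E)"
      proof -
        have "\<bar>(- (c * d1 * B) / 2) * P j\<bar> \<le> \<bar>c\<bar> * \<bar>d1\<bar> * B * \<bar>P j\<bar>" using B0 by (simp add: abs_mult)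
        also have "\<dots> \<le> 1 * \<bar>d1\<bar> * h ^ ord * (cP * ?E)"
          using c Pj B B0 h by (intro mult_mono) auto
        finally show ?thesis .
      qed
      moreover have "0 \<le> CE * N * h ^ ord * (3/2 * (1 + 1 / r) * (1 + r)) * ?E"
        using CE(1) N0 h r by simp
      moreover have "C * h ^ ord * ?E = (1 + yR) * h ^ ord * (cQ * ?E) + 1 * \<bar>d1\<bar> * h ^ ord * (cP * ?E)
          + CE * N * h ^ ord * ?E + CE * N * h ^ ord * (3/2 * (1 + 1 / r) * (1 + r)) * ?E"
        by (simp add: C_def algebra_simps)
      moreover have "\<bar>1/2 * inverse (sbp_H ord h' j) * e0 j * (\<epsilon>L + \<epsilon>R)\<bar>
          \<le> CE * N * h ^ ord * (3/2 * (1 + 1 / r) * (1 + r)) * ?E"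
        using inverse_sbp_H_e0_bound(1)[OF h'1(1) \<epsilon>[OF h'], of ord j] by (simp add: mult_ac)
      moreover have "0 \<le> (1 + yR) * h ^ ord * (cQ * ?E)" "0 \<le> 1 * \<bar>d1\<bar> * h ^ ord * (cP * ?E)"
        using yR cQ0 cP0 h by simp_all
      ultimately show ?V ?R using ej by linarith+
    qed
    show "\<exists>W. corrects ord lam h (h / r) m W (\<lambda>i. C * h ^ ord * grid_decay h (h / r) i)"
      unfolding hR_def[symmetric] \<tau>_def[symmetric]
    proof (rule exI[of _ "case_sum WL WR"], rule allI)
      fix i
      show "\<bar>case_sum WL WR i\<bar> \<le> C * h ^ ord * grid_decay h hR i \<and>
        \<bar>scheme_op ord h hR \<tau> (case_sum WL WR) i + scheme_trunc ord h hR m i\<bar>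
          \<le> C * h ^ ord * grid_decay h hR i"
      proof (cases i)
        case (Inl j)
        have "WL j = yL * B * Q j + (- (1 * d1 * B) / 2) * P j + eL j" by (simp add: WL_def YL d_def)
        moreover have "rhs_L ord h hR \<tau> WL WR j + trunc_L ord h hR m j = sbp_D ord h eL j + 1/2 * inverse (sbp_H ord h j) * e0 j * (\<epsilon>L + \<epsilon>R)"
          using ident(1) jump(1) by (simp add: trunc_L_def YL_def YR_def WR_def)
        ultimately show ?thesis
          using side[of yL 1 h eL, OF _ _ _ eL(2,3) NL, of j] yR
          by (simp add: Inl scheme_op_def scheme_trunc_def exp_grid_point[OF h(1) hR(1)] yL_def)
      next
        case (Inr j)
        have "WR j = yR * B * Q j + (- (- 1 * d1 * B) / 2) * P j + eR j" by (simp add: WR_def YR d_def)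
        moreover have sign: "(- 1) ^ m * ((- 1) ^ m * z) = z" for z :: real
          by (simp flip: mult.assoc power_mult_distrib)
        have "(- 1) ^ m * trunc_L ord hR h m j = YR / hR\<^sup>2 * trunc_D ord m j - 1/2 * inverse (sbp_H ord hR j) * e0 j *
            (- (YR / hR * trunc_S ord m) - YL / h * trunc_S ord m)"
          by (simp add: trunc_L_def YL_def YR_def power_minus[of hR] power_minus[of h] algebra_simps sign)
        then have "rhs_R ord h hR (- \<tau>) WL WR j + (- 1) ^ m * trunc_L ord hR h m j
            = sbp_D ord hR eR j + 1/2 * inverse (sbp_H ord hR j) * e0 j * (\<epsilon>L + \<epsilon>R)"
          using ident(2) jump(2) by (simp add: rhs_R_mirror WL_def WR_def add.commute[of \<epsilon>R])
        ultimately show ?thesis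
          using side[of yR "- 1" hR eR, OF _ _ _ eR(2,3) NR, of j] yR
          by (simp add: Inr scheme_op_def scheme_trunc_def exp_grid_point[OF h(1) hR(1)])
      qed
    qed
  qed
qed

section \<open>Residual of the corrected solution\<close>

lemma smooth_tower_reflect:
  assumes "smooth_tower d"
  shows "smooth_tower (\<lambda>m x. (- 1) ^ m * d m (- x))"
  unfolding smooth_tower_def
proof (intro allI)
  fix m x
  have "((\<lambda>x. d m (- x)) has_real_derivative - d (Suc m) (- x)) (at x)"
    using assms by (simp add: smooth_tower_def DERIV_mirror[symmetric])
  from DERIV_cmult[OF this, of "(- 1) ^ m"]
  show "((\<lambda>x. (- 1) ^ m * d m (- x)) has_real_derivative (- 1) ^ Suc m * d (Suc m) (- x)) (at x)" by simp
qed

text \<open>A smooth function restricted to both grids has no jump at the interface. The terms with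
  S^T and \<tau> therefore drop out, and the bound is free of \<tau>, which grows like 1 /
  h.\<close>

lemma rhs_L_truncation:
  assumes ord: "ord \<in> {2, 4}" and d: "smooth_tower d" and hL: "0 < hL" "hL \<le> 1" and hR: "0 < hR" "hR \<le> 1"
    and M: "\<And>x. \<bar>d (ord + 2) x\<bar> \<le> M * exp (- \<bar>x\<bar>)"
  shows "\<bar>rhs_L ord hL hR \<tau> (\<lambda>j. d 0 (- real j * hL)) (\<lambda>j. d 0 (real j * hR)) j - d 2 (- real j * hL)
        - (\<Sum>m<ord + 2. d m 0 * trunc_L ord hL hR m j)\<bar>
    \<le> 3 * trunc_const * M * (hL ^ ord + hR ^ ord) * (1 + hR / hL) * exp (- (real j * hL))"
proof -
  have M0: "M \<ge> 0" using order_trans[OF abs_ge_zero M[of 0]] by simp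
  have K: "trunc_const \<ge> 0" by (simp add: trunc_const_def)
  define dL where "dL m x = (- 1) ^ m * d m (- x)" for m x
  have dL: "smooth_tower dL" unfolding dL_def by (rule smooth_tower_reflect[OF d])
  have M': "M * exp (- \<bar>x\<bar>) \<le> M * exp (- x)" for x using M0 by (intro mult_left_mono) auto
  have bL: "\<bar>dL (ord + 2) x\<bar> \<le> M * exp (- x)" for x
    using M[of "- x"] M'[of x] by (simp add: dL_def abs_mult)
  have bR: "\<bar>d (ord + 2) x\<bar> \<le> M * exp (- x)" for x
    using M[of x] M'[of x] by simp
  define vL vR where "vL = (\<lambda>j. d 0 (- real j * hL))" and "vR = (\<lambda>j. d 0 (real j * hR))"
  have vL: "vL = (\<lambda>j. dL 0 (real j * hL))" by (simp add: vL_def dL_def)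
  define \<epsilon>L \<epsilon>R where "\<epsilon>L = S_defect ord hL dL" and "\<epsilon>R = S_defect ord hR d"
  define k where "k = trunc_const * M * (hL ^ ord + hR ^ ord) * (1 + hR / hL)"
  have "\<bar>\<epsilon>L\<bar> \<le> trunc_const * M * hL ^ ord * hL" "\<bar>\<epsilon>R\<bar> \<le> trunc_const * M * hR ^ ord * hR"
    unfolding \<epsilon>L_def \<epsilon>R_def by (rule sbp_S0_truncation[OF ord dL hL bL] sbp_S0_truncation[OF ord d hR bR])+
  moreover have "trunc_const * M * hL ^ ord * hL \<le> trunc_const * M * (hL ^ ord + hR ^ ord) * hL"
    "trunc_const * M * hR ^ ord * hR \<le> trunc_const * M * (hL ^ ord + hR ^ ord) * hR"
    using K M0 hL hR by (intro mult_right_mono mult_left_mono; simp)+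
  moreover have "trunc_const * M * (hL ^ ord + hR ^ ord) * hL + trunc_const * M * (hL ^ ord + hR ^ ord) * hR = k * hL"
    using hL by (simp add: k_def field_simps)
  ultimately have \<epsilon>: "\<bar>\<epsilon>L + \<epsilon>R\<bar> \<le> k * hL" by linarith
  have pow: "dL m 0 * hL ^ m = d m 0 * (- hL) ^ m" for m by (simp add: dL_def power_minus[of hL])
  let ?c = "1/2 * inverse (sbp_H ord hL j) * e0 j"
  have "(\<Sum>m<ord + 2. d m 0 * trunc_L ord hL hR m j) =
      (\<Sum>m<ord + 2. dL m 0 * hL ^ m / hL\<^sup>2 * trunc_D ord m j)
      + ?c * ((\<Sum>m<ord + 2. dL m 0 * hL ^ m / hL * trunc_S ord m) + (\<Sum>m<ord + 2. d m 0 * hR ^ m / hR * trunc_S ord m))"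
    unfolding pow trunc_L_def sum_distrib_left sum.distrib[symmetric]
    by (intro sum.cong refl) (simp add: algebra_simps)
  moreover have "rhs_L ord hL hR \<tau> vL vR j = sbp_D ord hL vL j + ?c * (sbp_S0 ord hL vL + sbp_S0 ord hR vR)"
    by (simp add: rhs_L_def jump_def jump_S_def vL_def vR_def algebra_simps)
  moreover have "d 2 (- real j * hL) = dL 2 (real j * hL)" "dL 1 0 = - d 1 0" by (simp_all add: dL_def)
  ultimately have "rhs_L ord hL hR \<tau> vL vR j - d 2 (- real j * hL) - (\<Sum>m<ord + 2. d m 0 * trunc_L ord hL hR m j) =
      D_defect ord hL dL j + ?c * (\<epsilon>L + \<epsilon>R)"
    unfolding D_defect_def \<epsilon>L_def \<epsilon>R_def S_defect_def vL vR_def by (simp add: algebra_simps)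
  moreover have "\<bar>D_defect ord hL dL j\<bar> \<le> k * exp (- (real j * hL))"
  proof -
    have "\<bar>D_defect ord hL dL j\<bar> \<le> trunc_const * M * hL ^ ord * 1 * exp (- (real j * hL))"
      using sbp_D_truncation[OF ord dL hL bL] by simp
    also have "\<dots> \<le> k * exp (- (real j * hL))"
      unfolding k_def using K M0 hL hR by (intro mult_right_mono mult_mono) auto
    finally show ?thesis .
  qed
  moreover have "3/2 * k * exp (- (real j * hL)) + k * exp (- (real j * hL)) \<le> 3 * k * exp (- (real j * hL))"
    using K M0 hL hR by (simp add: k_def)
  ultimately have "\<bar>rhs_L ord hL hR \<tau> vL vR j - d 2 (- real j * hL) - (\<Sum>m<ord + 2. d m 0 * trunc_L ord hL hR m j)\<bar>
      \<le> 3 * k * exp (- (real j * hL))"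
    using inverse_sbp_H_e0_bound(1)[OF hL(1) \<epsilon>, of ord j] by linarith
  also have "3 * k * exp (- (real j * hL)) = 3 * trunc_const * M * (hL ^ ord + hR ^ ord) * (1 + hR / hL) * exp (- (real j * hL))"
    by (simp add: k_def)
  finally show ?thesis unfolding vL_def vR_def .
qed

abbreviation scheme_defect ::
  "nat \<Rightarrow> real \<Rightarrow> real \<Rightarrow> real \<Rightarrow> (nat \<Rightarrow> real \<Rightarrow> real) \<Rightarrow> nat + nat \<Rightarrow> real" where
  "scheme_defect ord hL hR \<tau> d i \<equiv> scheme_op ord hL hR \<tau> (\<lambda>i. d 0 (grid_point hL hR i)) i
     - d 2 (grid_point hL hR i) - (\<Sum>m<ord + 2. d m 0 * scheme_trunc ord hL hR m i)"

lemma scheme_truncation: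
  assumes ord: "ord \<in> {2, 4}" and r: "r > 0"
  shows "\<exists>C\<ge>0. \<forall>d h M \<tau> i. smooth_tower d \<longrightarrow> 0 < h \<longrightarrow> h \<le> 1 \<longrightarrow> h / r \<le> 1 \<longrightarrow>
      (\<forall>x. \<bar>d (ord + 2) x\<bar> \<le> M * exp (- \<bar>x\<bar>)) \<longrightarrow>
      \<bar>scheme_defect ord h (h / r) \<tau> d i\<bar> \<le> C * M * h ^ ord * grid_decay h (h / r) i"
proof -
  define y where "y = 3 * trunc_const * (1 + (1 / r) ^ ord)"
  have y: "y \<ge> 0" using r by (simp add: y_def trunc_const_def)
  show ?thesis
  proof (rule exI[of _ "y * (1 + 1 / r + (1 + r))"], intro conjI allI impI)
    show "y * (1 + 1 / r + (1 + r)) \<ge> 0" using y r by simp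
    fix d :: "nat \<Rightarrow> real \<Rightarrow> real" and h M \<tau> :: real and i :: "nat + nat"
    assume d: "smooth_tower d" and h: "0 < h" "h \<le> 1" "h / r \<le> 1" and M: "\<forall>x. \<bar>d (ord + 2) x\<bar> \<le> M * exp (- \<bar>x\<bar>)"
    have M0: "M \<ge> 0" using order_trans[OF abs_ge_zero M[rule_format, of 0]] by simp
    define hR where "hR = h / r"
    have hR: "hR > 0" "hR \<le> 1" using h r by (simp_all add: hR_def)
    let ?E = "grid_decay h hR i"
    have pow: "h ^ ord + hR ^ ord = (1 + (1 / r) ^ ord) * h ^ ord" by (simp add: hR_def power_divide algebra_simps)
    have fin: "3 * trunc_const * M * (h ^ ord + hR ^ ord) * z * ?E \<le> y * (1 + 1 / r + (1 + r)) * M * h ^ ord * ?E"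
      if "z \<le> 1 + 1 / r + (1 + r)" for z
    proof -
      have "3 * trunc_const * M * (h ^ ord + hR ^ ord) * z * ?E = (y * M * h ^ ord * ?E) * z"
        unfolding pow y_def by simp
      also have "\<dots> \<le> (y * M * h ^ ord * ?E) * (1 + 1 / r + (1 + r))"
        using y M0 h by (intro mult_left_mono that) auto
      finally show ?thesis by (simp add: mult_ac)
    qed
    have "\<bar>scheme_defect ord h hR \<tau> d i\<bar> \<le> y * (1 + 1 / r + (1 + r)) * M * h ^ ord * ?E"
    proof (cases i)
      case (Inl j)
      have "hR / h = 1 / r" using h by (simp add: hR_def)
      then show ?thesis
        using rhs_L_truncation[OF ord d h(1,2) hR M[rule_format], of \<tau> j] fin[of "1 + hR / h"] r
        by (simp add: Inl scheme_op_def scheme_trunc_def exp_grid_point[OF h(1) hR(1)]) (simp add: grid_point_def)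
    next
      case (Inr j)
      define d' where "d' m x = (- 1) ^ m * d m (- x)" for m x
      have d': "smooth_tower d'" unfolding d'_def by (rule smooth_tower_reflect[OF d])
      have "\<bar>d' (ord + 2) x\<bar> \<le> M * exp (- \<bar>x\<bar>)" for x using M[rule_format, of "- x"] by (simp add: d'_def abs_mult)
      note L = rhs_L_truncation[OF ord d' hR h(1,2) this, of \<tau> j]
      have "h / hR = r" using h by (simp add: hR_def)
      moreover have "(\<Sum>m<ord + 2. d' m 0 * trunc_L ord hR h m j) = (\<Sum>m<ord + 2. d m 0 * scheme_trunc ord h hR m i)"
        by (intro sum.cong refl) (simp add: d'_def scheme_trunc_def Inr)
      ultimately show ?thesis
        using L fin[of "1 + h / hR"] r
        by (simp add: Inr scheme_op_def rhs_R_mirror exp_grid_point[OF h(1) hR(1)] d'_def add.commute[of "hR ^ ord"])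
          (simp add: grid_point_def)
    qed
    then show "\<bar>scheme_defect ord h (h / r) \<tau> d i\<bar> \<le> y * (1 + 1 / r + (1 + r)) * M * h ^ ord * grid_decay h (h / r) i"
      by (simp only: hR_def)
  qed
qed

section \<open>Discrete norms of the weights\<close>

lemma geometric_weight_sum:
  assumes "0 < h" "h \<le> 1"
  shows "(\<Sum>j<n. h * (exp (- (real j * h)))\<^sup>2) \<le> 3/2"
proof -
  define x where "x = exp (- 2 * h)"
  have x: "0 < x" "x < 1" using assms by (simp_all add: x_def)
  have "(\<Sum>j<n. x ^ j) * (1 - x) = 1 - x ^ n"
    using x by (subst sum_gp_strict) (simp add: field_simps)
  also have "\<dots> \<le> 1" using x by simp
  finally have gp: "(\<Sum>j<n. x ^ j) * (1 - x) \<le> 1" .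
  \<comment> \<open>Bernoulli's inequality for exp gives 1 - exp(-2h) >= 2h / (1 + 2h) >= 2h / 3,
    the lower bound that the geometric series needs.\<close>
  have "(1 + 2 * h) * x \<le> exp (2 * h) * x" using x exp_ge_add_one_self[of "2 * h"] by (intro mult_right_mono) auto
  then have "(1 + 2 * h) * x \<le> 1" by (simp add: x_def flip: exp_add)
  then have "2 * h \<le> (1 - x) * (1 + 2 * h)" by (simp add: algebra_simps)
  also have "\<dots> \<le> (1 - x) * 3" using x assms by (intro mult_left_mono) auto
  finally have h: "h \<le> (1 - x) * (3/2)" by simp
  have "(\<Sum>j<n. h * (exp (- (real j * h)))\<^sup>2) = (\<Sum>j<n. x ^ j) * h"
    unfolding sum_distrib_right x_def
    by (intro sum.cong refl) (simp add: mult_ac flip: exp_of_nat_mult exp_double)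
  also have "\<dots> \<le> (\<Sum>j<n. x ^ j) * ((1 - x) * (3/2))" using h x by (intro mult_left_mono sum_nonneg) auto
  also have "\<dots> = ((\<Sum>j<n. x ^ j) * (1 - x)) * (3/2)" by simp
  also have "\<dots> \<le> 1 * (3/2)" using gp by (intro mult_right_mono) auto
  finally show ?thesis by simp
qed

lemma sbp_H_geometric_sum:
  assumes "0 < h" "h \<le> 1"
  shows "(\<Sum>j<n. sbp_H ord h j * (exp (- (real j * h)))\<^sup>2) \<le> 3"
proof -
  have "(\<Sum>j<n. sbp_H ord h j * (exp (- (real j * h)))\<^sup>2) \<le> (\<Sum>j<n. 2 * (h * (exp (- (real j * h)))\<^sup>2))"
    using sbp_H_le[OF assms(1), of ord] by (intro sum_mono) (simp add: mult_right_mono flip: mult.assoc)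
  also have "\<dots> = 2 * (\<Sum>j<n. h * (exp (- (real j * h)))\<^sup>2)" by (rule sum_distrib_left[symmetric])
  finally show ?thesis using geometric_weight_sum[OF assms, of n] by linarith
qed

lemma scheme_mass_exp_sum:
  assumes "0 < hL" "hL \<le> 1" "0 < hR" "hR \<le> 1"
  shows "sq_sum (scheme_mass ord hL hR) (grid_section n) (\<lambda>i. grid_decay hL hR i) \<le> 6"
  unfolding sum_grid_section scheme_mass_def sum.case exp_grid_point[OF assms(1,3)]
  using sbp_H_geometric_sum[OF assms(1,2), where ord = ord and n = "n + 4"]
    sbp_H_geometric_sum[OF assms(3,4), where ord = ord and n = "n + 4"] by simp

lemma sum_mass_add:
  assumes "\<And>i. i \<in> I \<Longrightarrow> m i \<ge> 0" "sq_sum m I f \<le> a" "sq_sum m I g \<le> b"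
  shows "sq_sum m I (\<lambda>i. f i + g i) \<le> 2 * a + 2 * (b::real)"
proof -
  have "sq_sum m I (\<lambda>i. f i + g i) \<le> (\<Sum>i\<in>I. 2 * (m i * (f i)\<^sup>2) + 2 * (m i * (g i)\<^sup>2))"
  proof (rule sum_mono)
    fix i assume "i \<in> I"
    have "(f i + g i)\<^sup>2 \<le> 2 * (f i)\<^sup>2 + 2 * (g i)\<^sup>2"
      using zero_le_power2[of "f i - g i"] by (simp add: power2_eq_square algebra_simps)
    then have "m i * (f i + g i)\<^sup>2 \<le> m i * (2 * (f i)\<^sup>2 + 2 * (g i)\<^sup>2)"
      using assms(1)[OF \<open>i \<in> I\<close>] by (rule mult_left_mono)
    then show "m i * (f i + g i)\<^sup>2 \<le> 2 * (m i * (f i)\<^sup>2) + 2 * (m i * (g i)\<^sup>2)" by (simp add: algebra_simps)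
  qed
  also have "\<dots> = 2 * sq_sum m I f + 2 * sq_sum m I g"
    by (simp add: sum.distrib sum_distrib_left)
  finally show ?thesis using assms(2,3) by linarith
qed

lemma sum_mass_mono:
  assumes "\<And>i. i \<in> I \<Longrightarrow> m i \<ge> 0" "\<And>i. i \<in> I \<Longrightarrow> \<bar>f i\<bar> \<le> K * w i" "sq_sum m I w \<le> a"
  shows "sq_sum m I f \<le> K\<^sup>2 * (a::real)"
proof -
  have "sq_sum m I f \<le> sq_sum m I (\<lambda>i. K * w i)"
  proof (intro sum_mono mult_left_mono assms(1))
    fix i assume "i \<in> I"
    have "\<bar>f i\<bar>\<^sup>2 \<le> (K * w i)\<^sup>2" using assms(2)[OF \<open>i \<in> I\<close>] by (intro power_mono) auto
    then show "(f i)\<^sup>2 \<le> (K * w i)\<^sup>2" by simp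
  qed
  also have "\<dots> = K\<^sup>2 * sq_sum m I w" by (simp add: sum_distrib_left power_mult_distrib mult_ac)
  also have "\<dots> \<le> K\<^sup>2 * a" using assms(3) by (intro mult_left_mono) auto
  finally show ?thesis .
qed

definition boundary_nodes :: "(nat + nat) set" where
  "boundary_nodes = {..<4} <+> {..<4}"

text \<open>Pointwise size of the remaining residual. For \<open>lam = 1\<close> no corrector is available and the truncation
  error of the boundary rows, of order \<open>p\<close>, remains.\<close>

definition residual_weight :: "nat \<Rightarrow> real \<Rightarrow> real \<Rightarrow> real \<Rightarrow> nat + nat \<Rightarrow> real" where
  "residual_weight ord lam hL hR i = hL ^ ord * grid_decay hL hR i
     + (if lam = 1 \<and> i \<in> boundary_nodes then hL ^ (ord div 2) else 0)"

lemma residual_weight_nonneg: "hL > 0 \<Longrightarrow> residual_weight ord lam hL hR i \<ge> 0"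
  by (simp add: residual_weight_def)

text \<open>The constants are 12 = 2 * 6 and 16 = 2 * 8: the bound 6 for the exponential weight,
  mass at most 2 h or 2 c h on four nodes of each grid, and a factor 2 for splitting the square of a
  sum.\<close>

lemma residual_weight_sum:
  assumes ord: "ord \<in> {2, 4}" and h: "0 < h" "h \<le> 1" and hR: "0 < hR" "hR \<le> 1" "hR \<le> c * h" and c: "c \<ge> 0"
    and q: "q = (if lam = 1 then (real ord + 1) / 2 else real ord)"
  shows "sq_sum (scheme_mass ord h hR) (grid_section n) (\<lambda>i. residual_weight ord lam h hR i)
    \<le> (12 + 16 * (1 + c)) * (h powr q)\<^sup>2"
proof -
  let ?m = "scheme_mass ord h hR"
  let ?b = "\<lambda>i. if lam = 1 \<and> i \<in> boundary_nodes then h ^ (ord div 2) else 0"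
  have m: "?m i \<ge> 0" for i by (rule scheme_mass_nonneg[OF h(1) hR(1)])
  have b: "sq_sum ?m (grid_section n) ?b \<le> (if lam = 1 then 8 * (1 + c) * h * h ^ ord else 0)"
  proof (cases "lam = 1")
    case True
    have sq: "(h ^ (ord div 2))\<^sup>2 = h ^ ord" using ord by (auto simp flip: power_mult)
    have "sq_sum ?m (grid_section n) ?b = (\<Sum>i\<in>grid_section 0. ?m i * h ^ ord)"
      by (rule sum.mono_neutral_cong_right) (use True sq in \<open>auto simp: grid_section_def boundary_nodes_def\<close>)
    also have "\<dots> = (\<Sum>j<4. sbp_H ord h j * h ^ ord) + (\<Sum>j<4. sbp_H ord hR j * h ^ ord)"
      by (simp add: sum_grid_section scheme_mass_def)
    also have "\<dots> \<le> (\<Sum>j<4::nat. 2 * h * h ^ ord) + (\<Sum>j<4::nat. 2 * (c * h) * h ^ ord)"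
    proof (intro add_mono sum_mono mult_right_mono)
      show "sbp_H ord h j \<le> 2 * h" "sbp_H ord hR j \<le> 2 * (c * h)" for j
        using sbp_H_le[OF h(1), of ord j] sbp_H_le[OF hR(1), of ord j] hR(3) by linarith+
    qed (use h in simp_all)
    finally show ?thesis using True by (simp add: algebra_simps)
  qed simp
  have "sq_sum ?m (grid_section n) (\<lambda>i. h ^ ord * grid_decay h hR i) \<le> (h ^ ord)\<^sup>2 * 6"
    by (intro sum_mass_mono[where w = "\<lambda>i. grid_decay h hR i"] m scheme_mass_exp_sum h hR) (use h in simp)
  from sum_mass_add[OF m this b]
  have "sq_sum ?m (grid_section n) (\<lambda>i. residual_weight ord lam h hR i)
      \<le> 2 * ((h ^ ord)\<^sup>2 * 6) + 2 * (if lam = 1 then 8 * (1 + c) * h * h ^ ord else 0)"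
    unfolding residual_weight_def .
  also have "\<dots> \<le> (12 + 16 * (1 + c)) * (h powr q)\<^sup>2"
  proof (cases "lam = 1")
    case True
    have "q + q = real (ord + 1)" using True by (simp add: q field_simps)
    then have "(h powr q)\<^sup>2 = h powr (real (ord + 1))"
      by (metis power2_eq_square powr_add)
    also have "\<dots> = h ^ (ord + 1)" using h by (intro powr_realpow)
    finally have qq: "(h powr q)\<^sup>2 = h * h ^ ord" by simp
    have "(h ^ ord)\<^sup>2 \<le> h * h ^ ord"
      using power_decreasing[of "ord + 1" "ord * 2" h] h ord by (auto simp flip: power_mult)
    then show ?thesis using True by (simp add: qq algebra_simps)
  next
    case False
    then have "(h powr q)\<^sup>2 = (h ^ ord)\<^sup>2" using h by (simp add: q powr_realpow)
    then show ?thesis using False c by (simp add: mult_right_mono)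
  qed
  finally show ?thesis .
qed

lemma trunc_L_boundary_bound:
  assumes ord: "ord \<in> {2, 4}" and m: "ord div 2 + 2 \<le> m" "m < ord + 2" and hL: "0 < hL" "hL \<le> 1" and hR: "0 < hR" "hR \<le> 1"
  shows "\<bar>trunc_L ord hL hR m j\<bar> \<le> (if j < 4 then 3 * trunc_total ord * (hL ^ (ord div 2) + hR ^ (ord div 2)) * (1 + hR / hL) else 0)"
proof (cases "j < 4")
  case True
  define G where "G = trunc_total ord"
  have G: "\<bar>trunc_D ord m j\<bar> \<le> G" "\<bar>trunc_S ord m\<bar> \<le> G" "G \<ge> 0"
    unfolding G_def by (rule trunc_le_total[OF m(2)])+
  obtain i where i: "m = i + 2" "ord div 2 \<le> i" using m le_Suc_ex[of 2 m] ord by auto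
  define p where "p = hL ^ (ord div 2) + hR ^ (ord div 2)"
  have "hL ^ i \<le> hL ^ (ord div 2)" "hR ^ i \<le> hR ^ (ord div 2)" using hL hR i by (auto intro!: power_decreasing)
  moreover have "hL ^ (ord div 2) \<ge> 0" "hR ^ (ord div 2) \<ge> 0" using hL hR by auto
  ultimately have pi: "hL ^ i \<le> p" "hR ^ i \<le> p" "p \<ge> 0" unfolding p_def by linarith+
  have div: "(- hL) ^ m / hL\<^sup>2 = (- 1) ^ m * hL ^ i" "(- hL) ^ m / hL = (- 1) ^ m * (hL * hL ^ i)" "hR ^ m / hR = hR * hR ^ i"
    using hL hR by (simp_all add: i power_minus[of hL] power_add power2_eq_square)
  have "\<bar>(- 1) ^ m * (hL * hL ^ i) * trunc_S ord m\<bar> \<le> hL * p * G" "\<bar>hR * hR ^ i * trunc_S ord m\<bar> \<le> hR * p * G"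
    unfolding abs_mult using hL hR pi G by (auto intro!: mult_mono)
  moreover define X where "X = G * p * (1 + hR / hL)"
  have "hL * p * G + hR * p * G = X * hL" using hL by (simp add: X_def field_simps)
  ultimately have JS: "\<bar>- ((- 1) ^ m * (hL * hL ^ i) * trunc_S ord m) - hR * hR ^ i * trunc_S ord m\<bar> \<le> X * hL"
    by linarith
  have X: "p * G \<le> X" "0 \<le> X" using pi G hL hR by (simp_all add: X_def algebra_simps)
  have D: "\<bar>(- 1) ^ m * hL ^ i * trunc_D ord m j\<bar> \<le> p * G"
    unfolding abs_mult using hL pi G by (auto intro!: mult_mono)
  have "\<bar>trunc_L ord hL hR m j\<bar> \<le> p * G + 3/2 * X * exp (- (real j * hL))"
    unfolding trunc_L_def div using D inverse_sbp_H_e0_bound(1)[OF hL(1) JS, of ord j]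
    by (intro order_trans[OF abs_triangle_ineq4] add_mono)
  also have "\<dots> \<le> X + 3/2 * X * 1" using X hL by (intro add_mono mult_left_mono) auto
  also have "\<dots> \<le> 3 * X" using X by simp
  finally show ?thesis using True by (simp add: X_def p_def G_def)
qed (simp add: trunc_L_def trunc_D_def e0_def)

text \<open>Brings both regimes into one form. For lam = 1 the corrector is zero, and the boundary
  part of \<open>residual_weight\<close> absorbs the truncation error itself.\<close>

lemma scheme_corrector:
  assumes ord: "ord \<in> {2, 4}" and m: "ord div 2 + 2 \<le> m" "m < ord + 2" and r: "r > 0" and lam: "lam \<ge> 1"
  shows "\<exists>C\<ge>0. \<forall>h. 0 < h \<longrightarrow> h \<le> 1 \<longrightarrow> h / r \<le> 1 \<longrightarrow> (\<exists>W. corrects ord lam h (h / r) m W (\<lambda>i. C * residual_weight ord lam h (h / r) i))"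
proof (cases "lam = 1")
  case False
  with lam have "lam > 1" by simp
  from corrector[OF ord m r this] show ?thesis
    by (simp add: residual_weight_def False mult.assoc)
next
  case True
  let ?n = "ord div 2"
  define y where "y = 3 * trunc_total ord * (1 + (1 / r) ^ ?n)"
  have y: "y \<ge> 0" using r trunc_le_total(3)[of 0 ord] by (simp add: y_def)
  define C where "C = y * (1 + 1 / r + (1 + r))"
  have C: "C \<ge> 0" using y r by (simp add: C_def)
  show ?thesis
  proof (rule exI[of _ C], intro conjI allI impI)
    fix h :: real assume h: "0 < h" "h \<le> 1" "h / r \<le> 1"
    define hR where "hR = h / r"
    have hR: "hR > 0" "hR \<le> 1" using h r by (simp_all add: hR_def)
    have pow: "h ^ ?n + hR ^ ?n = (1 + (1 / r) ^ ?n) * h ^ ?n" by (simp add: hR_def power_divide algebra_simps)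
    have fin: "(if j < 4 then 3 * trunc_total ord * (h ^ ?n + hR ^ ?n) * z else 0) \<le> C * residual_weight ord lam h hR i"
      if "z \<le> 1 + 1 / r + (1 + r)" "i \<in> boundary_nodes \<longleftrightarrow> j < 4" for z i and j :: nat
    proof (cases "j < 4")
      case j: True
      have "3 * trunc_total ord * (h ^ ?n + hR ^ ?n) * z = (y * h ^ ?n) * z"
        unfolding pow y_def by simp
      also have "\<dots> \<le> (y * h ^ ?n) * (1 + 1 / r + (1 + r))"
        using y h by (intro mult_left_mono that) auto
      also have "\<dots> = C * h ^ ?n" by (simp add: C_def)
      also have "\<dots> \<le> C * residual_weight ord lam h hR i"
        using C h that(2) j by (intro mult_left_mono) (simp_all add: residual_weight_def True)
      finally show ?thesis using j by simp
    qed (use C h in \<open>simp add: residual_weight_nonneg\<close>)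
    have trunc: "\<bar>scheme_trunc ord h hR m i\<bar> \<le> C * residual_weight ord lam h hR i" for i
    proof (cases i)
      case (Inl j)
      have "i \<in> boundary_nodes \<longleftrightarrow> j < 4" by (auto simp: Inl boundary_nodes_def)
      moreover have "1 + hR / h \<le> 1 + 1 / r + (1 + r)" using h r by (simp add: hR_def)
      ultimately show ?thesis
        using trunc_L_boundary_bound[OF ord m h(1,2) hR, of j] fin[of "1 + hR / h" i j] by (simp add: Inl scheme_trunc_def)
    next
      case (Inr j)
      have "i \<in> boundary_nodes \<longleftrightarrow> j < 4" by (auto simp: Inr boundary_nodes_def)
      moreover have "1 + h / hR \<le> 1 + 1 / r + (1 + r)" using h r by (simp add: hR_def)
      ultimately show ?thesis
        using trunc_L_boundary_bound[OF ord m hR h(1,2), of j, unfolded add.commute[of "hR ^ ?n" "h ^ ?n"]]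
          fin[of "1 + h / hR" i j]
        by (simp add: Inr scheme_trunc_def abs_mult)
    qed
    show "\<exists>W. corrects ord lam h (h / r) m W (\<lambda>i. C * residual_weight ord lam h (h / r) i)"
      unfolding hR_def[symmetric]
      by (rule exI[of _ "\<lambda>_. 0"])
         (use trunc C h in \<open>simp add: residual_weight_nonneg finite_row_zero[OF finite_row_scheme_op]\<close>)
  qed (rule C)
qed

section \<open>Convergence\<close>

text \<open>Passes from section norms with weights \<open>sbp_H\<close> to the plain grid norm; the
  factor 3 comes from \<open>sbp_H\<close> >= h / 3. The integrand is a dominated limit of
  continuous partial sums, which gives its integrability.\<close>

lemma error_boundI:
  assumes h: "hL > 0" "hR > 0" and tf: "tf > 0" and X: "X \<ge> 0"
    and cont: "\<And>j. continuous_on {0..tf} (\<lambda>t. err_L U hL uL t j)" "\<And>j. continuous_on {0..tf} (\<lambda>t. err_R U hR uR t j)"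
    and bound: "\<And>t n. t \<in> {0..tf} \<Longrightarrow> (\<Sum>i\<in>grid_section n. scheme_mass ord hL hR i *
        (case i of Inl j \<Rightarrow> err_L U hL uL t j | Inr j \<Rightarrow> err_R U hR uR t j)\<^sup>2) \<le> X"
    and b: "sqrt (tf * (3 * X)) \<le> b"
  shows "error_bound U hL hR uL uR tf b"
proof -
  let ?eL = "err_L U hL uL" and ?eR = "err_R U hR uR"
  define S where "S n t = hL * (\<Sum>j<n. (?eL t j)\<^sup>2) + hR * (\<Sum>j<n. (?eR t j)\<^sup>2)" for n t
  define E where "E t = (grid_norm hL (?eL t))\<^sup>2 + (grid_norm hR (?eR t))\<^sup>2" for t
  have summable: "summable (\<lambda>j. (?eL t j)\<^sup>2)" "summable (\<lambda>j. (?eR t j)\<^sup>2)" if "t \<in> {0..tf}" for t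
    using grid_section_norm_bounds(4,5)[OF h bound[OF that]] by simp_all
  have norm: "(grid_norm h' v)\<^sup>2 = h' * (\<Sum>j. (v j)\<^sup>2)" if "h' > 0" "summable (\<lambda>j. (v j)\<^sup>2)" for h' v
    using that by (simp add: grid_norm_def suminf_nonneg)
  have E_lim: "(\<lambda>n. S n t) \<longlonglongrightarrow> E t" if t: "t \<in> {0..tf}" for t
    unfolding S_def E_def norm[OF h(1) summable(1)[OF t]] norm[OF h(2) summable(2)[OF t]]
    by (intro tendsto_intros summable_LIMSEQ summable t)
  have S_bound: "S n t \<le> 3 * X" if t: "t \<in> {0..tf}" for n t
  proof -
    have *: "h' * (\<Sum>j<n. (v j)\<^sup>2) \<le> 3 * (\<Sum>j<n + 4. sbp_H ord h' j * (v j)\<^sup>2)" if "h' > 0" for h' v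
    proof -
      have "h' * (\<Sum>j<n. (v j)\<^sup>2) = (\<Sum>j<n. 3 * (h' / 3 * (v j)\<^sup>2))" by (simp add: sum_distrib_left)
      also have "\<dots> \<le> (\<Sum>j<n. 3 * (sbp_H ord h' j * (v j)\<^sup>2))"
        using sbp_H_ge[OF that] by (intro sum_mono mult_left_mono mult_right_mono) auto
      also have "\<dots> \<le> (\<Sum>j<n + 4. 3 * (sbp_H ord h' j * (v j)\<^sup>2))"
        using sbp_H_pos[OF that, of ord] by (intro sum_mono2) (auto simp: less_imp_le)
      finally show ?thesis by (simp add: sum_distrib_left)
    qed
    show ?thesis
      using bound[OF t, of n] *[OF h(1), of "?eL t"] *[OF h(2), of "?eR t"]
      unfolding S_def sum_grid_section scheme_mass_def sum.case by linarith
  qed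
  have S_nonneg: "S n t \<ge> 0" for n t
    unfolding S_def using h by (intro add_nonneg_nonneg mult_nonneg_nonneg sum_nonneg) auto
  have S_int: "S n integrable_on {0..tf}" for n
    unfolding S_def by (intro integrable_continuous_real continuous_intros cont)
  have E_int: "E integrable_on {0..tf}"
    by (rule dominated_convergence(1)[where f = S and h = "\<lambda>_. 3 * X"])
       (use S_int S_bound S_nonneg E_lim in auto)
  have E_bound: "E t \<le> 3 * X" if t: "t \<in> {0..tf}" for t
    using E_lim[OF t] S_bound[OF t] by (intro LIMSEQ_le_const2) auto
  have "integral {0..tf} E \<le> integral {0..tf} (\<lambda>_. 3 * X)"
    by (rule integral_le) (use E_int E_bound in auto)
  also have "\<dots> = tf * (3 * X)" using tf by simp
  finally have "sqrt (integral {0..tf} E) \<le> sqrt (tf * (3 * X))" by simp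
  then have "sqrt (integral {0..tf} E) \<le> b" using b by linarith
  moreover have "grid_l2 (?eL t) \<and> grid_l2 (?eR t)" if "t \<in> {0..tf}" for t
    using summable[OF that] by (simp add: grid_l2_def)
  ultimately show ?thesis
    using E_int unfolding error_bound_def Let_def E_def by blast
qed

lemma scheme_trunc_low_order:
  assumes "ord \<in> {2, 4}" "m < ord div 2 + 2"
  shows "scheme_trunc ord hL hR m i = 0"
  using trunc_consistency[OF assms] by (cases i) (simp_all add: scheme_trunc_def trunc_L_def)

lemma grid_norm_partial_sum:
  assumes "h > 0" "grid_l2 v" "grid_norm h v \<le> K"
  shows "(\<Sum>j<n. sbp_H ord h j * (v j)\<^sup>2) \<le> 2 * K\<^sup>2"
proof -
  have s: "summable (\<lambda>j. (v j)\<^sup>2)" using assms(2) by (simp add: grid_l2_def)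
  have "(\<Sum>j<n. sbp_H ord h j * (v j)\<^sup>2) \<le> (\<Sum>j<n. 2 * h * (v j)\<^sup>2)"
    using sbp_H_le[OF assms(1), of ord] by (intro sum_mono mult_right_mono) auto
  also have "\<dots> = 2 * h * (\<Sum>j<n. (v j)\<^sup>2)" by (simp add: sum_distrib_left)
  also have "\<dots> \<le> 2 * h * (\<Sum>j. (v j)\<^sup>2)"
    using assms(1) by (intro mult_left_mono sum_le_suminf s) auto
  also have "\<dots> = 2 * (grid_norm h v)\<^sup>2" using assms(1) s by (simp add: grid_norm_def suminf_nonneg)
  also have "(grid_norm h v)\<^sup>2 \<le> K\<^sup>2"
    using assms s by (intro power_mono) (auto simp: grid_norm_def suminf_nonneg)
  finally show ?thesis by simp
qed

section \<open>Energy estimate for the corrected error\<close>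

context symmetric_dissipative
begin

text \<open>The estimate is applied to the corrected error y = v + sum of \<open>a k * W k\<close> -
  u. Because \<open>W k\<close> is static, its time-dependent amplitude adds the residual
  \<open>a'' k * W k\<close> and the initial data \<open>a k * W k\<close> and
  \<open>a' k * W k\<close>, all bounded by w. In \<open>CT + 2 * S\<close> one S comes from this
  residual and one from the defect of \<open>W k\<close>; the last S pays for removing the corrector
  from y again.\<close>

lemma corrected_energy_estimate:
  fixes u v :: "real \<Rightarrow> 'i \<Rightarrow> real" and a :: "'k \<Rightarrow> real \<Rightarrow> real" and W tr :: "'k \<Rightarrow> 'i \<Rightarrow> real"
  assumes row: "\<And>i. finite_row (\<lambda>v. L v i)" and Ks: "finite Ks" and T: "T \<ge> 0"
    and v: "\<And>t i. t \<in> {0..T} \<Longrightarrow> ((\<lambda>s. v s i) has_real_derivative v' t i) (at t within {0..T})"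
      "\<And>t i. t \<in> {0..T} \<Longrightarrow> ((\<lambda>s. v' s i) has_real_derivative v'' t i + F t i) (at t within {0..T})"
    and u: "\<And>t i. t \<in> {0..T} \<Longrightarrow> ((\<lambda>s. u s i) has_real_derivative u' t i) (at t within {0..T})"
      "\<And>t i. t \<in> {0..T} \<Longrightarrow> ((\<lambda>s. u' s i) has_real_derivative L (u t) i + F t i) (at t within {0..T})"
    and init: "\<And>i. u 0 i = v 0 i" "\<And>i. u' 0 i = v' 0 i"
    and a: "\<And>k t. k \<in> Ks \<Longrightarrow> t \<in> {0..T} \<Longrightarrow> (a k has_real_derivative a' k t) (at t within {0..T})"
      "\<And>k t. k \<in> Ks \<Longrightarrow> t \<in> {0..T} \<Longrightarrow> (a' k has_real_derivative a'' k t) (at t within {0..T})"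
    and A: "\<And>k t. k \<in> Ks \<Longrightarrow> t \<in> {0..T} \<Longrightarrow> \<bar>a k t\<bar> \<le> A k \<and> \<bar>a' k t\<bar> \<le> A k \<and> \<bar>a'' k t\<bar> \<le> A k"
    and W: "\<And>k i. k \<in> Ks \<Longrightarrow> \<bar>W k i\<bar> \<le> C k * w i" "\<And>k i. k \<in> Ks \<Longrightarrow> \<bar>L (W k) i + tr k i\<bar> \<le> C k * w i"
    and trunc: "\<And>t i. t \<in> {0..T} \<Longrightarrow> \<bar>L (v t) i - v'' t i - (\<Sum>k\<in>Ks. a k t * tr k i)\<bar> \<le> CT * w i"
    and pos: "\<And>k. k \<in> Ks \<Longrightarrow> C k \<ge> 0" "CT \<ge> 0" "\<And>i. w i \<ge> 0" "b \<ge> 0"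
    and w: "\<And>n. sq_sum m (I n) w \<le> b\<^sup>2"
    and bdd: "\<And>t n. t \<in> {0..T} \<Longrightarrow> sq_sum m (I n) (\<lambda>i. v t i - u t i) \<le> K"
    and t: "t \<in> {0..T}"
  defines "S \<equiv> \<Sum>k\<in>Ks. A k * C k"
  shows "sq_sum m (I n) (\<lambda>i. v t i - u t i) \<le> (2 * ((1 + 2 * T * (1 + T)) * (CT + 2 * S) + S) * b)\<^sup>2"
proof -
  have zero: "0 \<in> {0..T}" using T by simp
  have A0: "A k \<ge> 0" if "k \<in> Ks" for k using A[OF that zero] by linarith
  have S0: "S \<ge> 0" unfolding S_def using A0 pos(1) by (intro sum_nonneg) auto
  have comb: "\<bar>\<Sum>k\<in>Ks. c k * z k\<bar> \<le> S * w i"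
    if "\<And>k. k \<in> Ks \<Longrightarrow> \<bar>c k\<bar> \<le> A k" "\<And>k. k \<in> Ks \<Longrightarrow> \<bar>z k\<bar> \<le> C k * w i" for c z i
  proof -
    have "\<bar>\<Sum>k\<in>Ks. c k * z k\<bar> \<le> (\<Sum>k\<in>Ks. A k * (C k * w i))"
      by (rule order_trans[OF sum_abs sum_mono]) (unfold abs_mult, use that A0 in \<open>intro mult_mono; auto\<close>)
    then show ?thesis by (simp add: S_def sum_distrib_right mult.assoc)
  qed
  define z where "z t i = (\<Sum>k\<in>Ks. a k t * W k i)" for t i
  define y where "y t i = v t i + z t i - u t i" for t i
  define y' where "y' t i = v' t i + (\<Sum>k\<in>Ks. a' k t * W k i) - u' t i" for t i
  define R where "R t i = v'' t i + (\<Sum>k\<in>Ks. a'' k t * W k i) - (L (v t) i + (\<Sum>k\<in>Ks. a k t * L (W k) i))" for t i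
  have z_bound: "\<bar>z t i\<bar> \<le> S * w i" if "t \<in> {0..T}" for t i
    unfolding z_def by (rule comb) (use A that W in auto)
  have Ly: "L (y t) i = L (v t) i + (\<Sum>k\<in>Ks. a k t * L (W k) i) - L (u t) i" for t i
  proof -
    have "L (\<lambda>i. 1 * (1 * v t i + 1 * (\<Sum>k\<in>Ks. a k t * W k i)) + (- 1) * u t i) i =
        1 * (1 * L (v t) i + 1 * (\<Sum>k\<in>Ks. a k t * L (W k) i)) + (- 1) * L (u t) i"
      unfolding finite_row_linear[OF row] finite_row_sum_linear[OF row Ks] ..
    then show ?thesis by (simp add: y_def[abs_def] z_def)
  qed
  define \<rho> where "\<rho> i = (CT + 2 * S) * w i" for i
  have S\<rho>: "S * w i \<le> \<rho> i" for i
    unfolding \<rho>_def using pos S0 by (intro mult_right_mono) auto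
  define B where "B = (CT + 2 * S) * b"
  have y_est: "sq_sum m (I n) (y t) \<le> ((1 + 2 * T * (1 + T)) * B)\<^sup>2"
  proof (rule energy_estimate[where y' = y' and R = R and \<rho> = \<rho> and K = "2 * K + 2 * (S\<^sup>2 * b\<^sup>2)"])
    fix t i assume t: "t \<in> {0..T}"
    show "((\<lambda>s. y s i) has_real_derivative y' t i) (at t within {0..T})"
      unfolding y_def y'_def z_def by (intro DERIV_add DERIV_diff DERIV_sum DERIV_cmult_right v u a t)
    have "((\<lambda>s. y' s i) has_real_derivative (v'' t i + F t i) + (\<Sum>k\<in>Ks. a'' k t * W k i) - (L (u t) i + F t i)) (at t within {0..T})"
      unfolding y'_def by (intro DERIV_add DERIV_diff DERIV_sum DERIV_cmult_right v u a t)
    then show "((\<lambda>s. y' s i) has_real_derivative L (y t) i + R t i) (at t within {0..T})"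
      by (simp add: Ly R_def algebra_simps)
    have "R t i = (\<Sum>k\<in>Ks. a'' k t * W k i) - (\<Sum>k\<in>Ks. a k t * (L (W k) i + tr k i))
        - (L (v t) i - v'' t i - (\<Sum>k\<in>Ks. a k t * tr k i))"
      by (simp add: R_def distrib_left sum.distrib)
    moreover have "\<bar>\<Sum>k\<in>Ks. a'' k t * W k i\<bar> \<le> S * w i" by (rule comb) (use A t W in auto)
    moreover have "\<bar>\<Sum>k\<in>Ks. a k t * (L (W k) i + tr k i)\<bar> \<le> S * w i" by (rule comb) (use A t W in auto)
    ultimately have "\<bar>R t i\<bar> \<le> S * w i + S * w i + CT * w i" using trunc[OF t, of i] by linarith
    then show "\<bar>R t i\<bar> \<le> \<rho> i" by (simp add: \<rho>_def algebra_simps)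
  next
    fix i
    show "\<bar>y 0 i\<bar> \<le> \<rho> i" using z_bound[OF zero, of i] S\<rho>[of i] by (simp add: y_def init)
    have "\<bar>\<Sum>k\<in>Ks. a' k 0 * W k i\<bar> \<le> S * w i" by (rule comb) (use A zero W in auto)
    then show "\<bar>y' 0 i\<bar> \<le> \<rho> i" using S\<rho>[of i] by (simp add: y'_def init)
  next
    fix n
    have "sq_sum m (I n) \<rho> \<le> (CT + 2 * S)\<^sup>2 * b\<^sup>2"
      by (rule sum_mass_mono[where w = w]) (use m_nonneg pos S0 w in \<open>auto simp: \<rho>_def\<close>)
    then show "sq_sum m (I n) \<rho> \<le> B\<^sup>2" by (simp add: B_def power_mult_distrib)
  next
    show "B \<ge> 0" using pos S0 by (simp add: B_def)
  next
    fix t n assume t: "t \<in> {0..T}"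
    have "sq_sum m (I n) (\<lambda>i. (v t i - u t i) + z t i) \<le> 2 * K + 2 * (S\<^sup>2 * b\<^sup>2)"
      by (intro sum_mass_add bdd t sum_mass_mono[where w = w] m_nonneg z_bound w)
    then show "sq_sum m (I n) (y t) \<le> 2 * K + 2 * (S\<^sup>2 * b\<^sup>2)"
      by (simp add: y_def algebra_simps)
  qed (use T t in auto)
  define p q where "p = (1 + 2 * T * (1 + T)) * B" and "q = S * b"
  have pq: "p \<ge> 0" "q \<ge> 0" using T pos S0 by (simp_all add: p_def q_def B_def)
  have "sq_sum m (I n) (\<lambda>i. y t i + (- z t i)) \<le> 2 * p\<^sup>2 + 2 * (S\<^sup>2 * b\<^sup>2)"
    unfolding p_def by (intro sum_mass_add y_est sum_mass_mono[where w = w] m_nonneg w) (use z_bound[OF t] in simp)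
  also have "\<dots> = 2 * p\<^sup>2 + 2 * q\<^sup>2" by (simp add: q_def power_mult_distrib)
  also have "\<dots> \<le> (2 * (p + q))\<^sup>2"
    using mult_nonneg_nonneg[OF pq] by (simp add: power2_eq_square algebra_simps)
  also have "2 * (p + q) = 2 * ((1 + 2 * T * (1 + T)) * (CT + 2 * S) + S) * b"
    by (simp add: p_def q_def B_def algebra_simps)
  finally show ?thesis by (simp add: y_def)
qed

end

text \<open>Supplies the amplitudes of the correctors, which are space derivatives of U at x = 0 as
  functions of time, with bounds on two time derivatives.\<close>

lemma smooth_halfplane_time_derivatives:
  assumes "smooth_halfplane f"
  shows "\<exists>a1 a2 A. A \<ge> 0 \<and> (\<forall>t\<ge>0. ((\<lambda>s. f x s) has_real_derivative a1 t) (at t within {0..}) \<and>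
      (a1 has_real_derivative a2 t) (at t within {0..})) \<and>
      (\<forall>t\<in>{0..T}. \<bar>f x t\<bar> \<le> A \<and> \<bar>a1 t\<bar> \<le> A \<and> \<bar>a2 t\<bar> \<le> A)"
proof -
  obtain fx g where g: "\<And>x t. t \<ge> 0 \<Longrightarrow> ((\<lambda>s. f x s) has_real_derivative g x t) (at t within {0..})" "smooth_halfplane g"
    using smooth_halfplane_derivatives[OF assms] by metis
  obtain gx k where k: "\<And>x t. t \<ge> 0 \<Longrightarrow> ((\<lambda>s. g x s) has_real_derivative k x t) (at t within {0..})" "smooth_halfplane k"
    using smooth_halfplane_derivatives[OF g(2)] by metis
  obtain M1 M2 M3 where M: "M1 \<ge> 0" "M2 \<ge> 0" "M3 \<ge> 0"
    "\<And>t. t \<in> {0..T} \<Longrightarrow> \<bar>f x t\<bar> \<le> M1" "\<And>t. t \<in> {0..T} \<Longrightarrow> \<bar>g x t\<bar> \<le> M2" "\<And>t. t \<in> {0..T} \<Longrightarrow> \<bar>k x t\<bar> \<le> M3"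
    using smooth_halfplane_bounded[OF assms, of "\<bar>x\<bar>" T] smooth_halfplane_bounded[OF g(2), of "\<bar>x\<bar>" T]
      smooth_halfplane_bounded[OF k(2), of "\<bar>x\<bar>" T] by (metis order_refl)
  show ?thesis
  proof (rule exI[of _ "g x"], rule exI[of _ "k x"], rule exI[of _ "M1 + M2 + M3"], intro conjI allI impI ballI)
    show "0 \<le> M1 + M2 + M3" using M by simp
    fix t assume "t \<in> {0..T}"
    then show "\<bar>f x t\<bar> \<le> M1 + M2 + M3" "\<bar>g x t\<bar> \<le> M1 + M2 + M3" "\<bar>k x t\<bar> \<le> M1 + M2 + M3"
      using M(1-3) M(4-6)[of t] by linarith+
  qed (use g(1) k(1) in auto)
qed

theorem theorem4p1:
  fixes ord :: nat
    and F U :: "real \<Rightarrow> real \<Rightarrow> real" and f1 f2 :: "real \<Rightarrow> real"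
    and r lam q tf :: real
    and \<tau> :: "real \<Rightarrow> real"
  assumes ord: "ord \<in> {2, 4}"
    and F: "smooth_halfplane F" "compact_support_in_space F"
    and f1: "smooth f1" "compact_support f1"
    and f2: "smooth f2" "compact_support f2"
    and U: "smooth_halfplane U" "cauchy_solution F f1 f2 U"
    and r: "r > 0"
    and lam_ge: "lam \<ge> 1"
    and tau: "\<And>h. h > 0 \<Longrightarrow> \<tau> h = lam * tau_min ord h (h / r)"
    and q: "q = (if ord = 2 then (if lam > 1 then 2 else 3/2) else (if lam > 1 then 4 else 5/2))"
    and tf: "tf > 0"
  shows "\<exists>C. \<forall>\<^sub>F h in at_right 0. \<forall>uL uR.
           scheme_solution ord h (h / r) (\<tau> h) (- \<tau> h) F f1 f2 uL uR \<longrightarrow>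
           error_bound U h (h / r) uL uR tf (C * h powr q)"
proof -
  have tf0: "tf \<ge> 0" using tf by simp
  have q': "q = (if lam = 1 then (real ord + 1) / 2 else real ord)"
    using ord lam_ge q by auto
  obtain D Ut where D: "D 0 = U" "\<And>k. smooth_halfplane (D k)"
    "\<And>k x t. t \<ge> 0 \<Longrightarrow> ((\<lambda>y. D k y t) has_real_derivative D (Suc k) x t) (at x)"
    and Ut: "\<And>x t. t \<ge> 0 \<Longrightarrow> ((\<lambda>s. U x s) has_real_derivative Ut x t) (at t within {0..})"
    "\<And>x t. t \<ge> 0 \<Longrightarrow> ((\<lambda>s. Ut x s) has_real_derivative D 2 x t + F x t) (at t within {0..})"
    and U_init: "\<And>x. U x 0 = f1 x" "\<And>x. Ut x 0 = f2 x"
    and D_bound: "\<And>k. \<exists>M\<ge>0. \<forall>x. \<forall>t\<in>{0..tf}. \<bar>D k x t\<bar> \<le> M * exp (- \<bar>x\<bar>)"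
    using cauchy_solution_tower[OF F(2) f1(2) f2(2) U tf0] by blast
  obtain M where M: "M \<ge> 0" "\<And>x t. t \<in> {0..tf} \<Longrightarrow> \<bar>D (ord + 2) x t\<bar> \<le> M * exp (- \<bar>x\<bar>)"
    using D_bound[of "ord + 2"] by blast
  obtain M0 where M0: "M0 \<ge> 0" "\<And>x t. t \<in> {0..tf} \<Longrightarrow> \<bar>D 0 x t\<bar> \<le> M0 * exp (- \<bar>x\<bar>)"
    using D_bound[of 0] by blast
  \<comment> \<open>Below p + 2 the boundary rows are exact, and from 2p + 2 on the Taylor remainder
    is already of order h^(2p).\<close>
  define Ms where "Ms = {ord div 2 + 2..<ord + 2}"
  obtain a1 a2 A where a: "\<And>m. A m \<ge> 0"
    "\<And>m t. t \<ge> 0 \<Longrightarrow> ((\<lambda>s. D m 0 s) has_real_derivative a1 m t) (at t within {0..})"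
    "\<And>m t. t \<ge> 0 \<Longrightarrow> (a1 m has_real_derivative a2 m t) (at t within {0..})"
    "\<And>m t. t \<in> {0..tf} \<Longrightarrow> \<bar>D m 0 t\<bar> \<le> A m \<and> \<bar>a1 m t\<bar> \<le> A m \<and> \<bar>a2 m t\<bar> \<le> A m"
  proof -
    define P where "P m a1 a2 A \<longleftrightarrow> A \<ge> 0 \<and> (\<forall>t\<ge>0. ((\<lambda>s. D m 0 s) has_real_derivative a1 t) (at t within {0..}) \<and>
      (a1 has_real_derivative a2 t) (at t within {0..})) \<and>
      (\<forall>t\<in>{0..tf}. \<bar>D m 0 t\<bar> \<le> A \<and> \<bar>a1 t\<bar> \<le> A \<and> \<bar>a2 t\<bar> \<le> A)" for m a1 a2 A
    have "\<exists>a1 a2 A. P m a1 a2 A" for m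
      unfolding P_def by (rule smooth_halfplane_time_derivatives[OF D(2)])
    then obtain a1 a2 A where "\<And>m. P m (a1 m) (a2 m) (A m)" by metis
    then show thesis by (intro that[of A a1 a2]) (simp_all add: P_def)
  qed
  define good where "good m C h W \<longleftrightarrow> corrects ord lam h (h / r) m W (\<lambda>i. C * residual_weight ord lam h (h / r) i)" for m C h W
  have "\<exists>C\<ge>0. \<forall>h. 0 < h \<longrightarrow> h \<le> 1 \<longrightarrow> h / r \<le> 1 \<longrightarrow> (\<exists>W. good m C h W)" if "m \<in> Ms" for m
    unfolding good_def by (rule scheme_corrector[OF ord _ _ r lam_ge]) (use that in \<open>simp_all add: Ms_def\<close>)
  then obtain C where C: "\<And>m. m \<in> Ms \<Longrightarrow> C m \<ge> 0"
    "\<And>m h. m \<in> Ms \<Longrightarrow> 0 < h \<Longrightarrow> h \<le> 1 \<Longrightarrow> h / r \<le> 1 \<Longrightarrow> \<exists>W. good m (C m) h W"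
    by metis
  obtain CT where CT: "CT \<ge> 0" "\<forall>d h M \<tau> i. smooth_tower d \<longrightarrow> 0 < h \<longrightarrow> h \<le> 1 \<longrightarrow> h / r \<le> 1 \<longrightarrow>
      (\<forall>x. \<bar>d (ord + 2) x\<bar> \<le> M * exp (- \<bar>x\<bar>)) \<longrightarrow>
      \<bar>scheme_defect ord h (h / r) \<tau> d i\<bar> \<le> CT * M * h ^ ord * grid_decay h (h / r) i"
    using scheme_truncation[OF ord r] by blast
  define S where "S = (\<Sum>m\<in>Ms. A m * C m)"
  define c0 where "c0 = sqrt (12 + 16 * (1 + 1 / r))"
  \<comment> \<open>No ingredient depends on h or on the numerical solution, so one constant serves
    all small h.\<close>
  define Z where "Z = 2 * ((1 + 2 * tf * (1 + tf)) * (CT * M + 2 * S) + S) * c0"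
  have S0: "S \<ge> 0" unfolding S_def using a(1) C(1) by (intro sum_nonneg) auto
  have c0: "c0 \<ge> 0" "c0\<^sup>2 = 12 + 16 * (1 + 1 / r)" using r by (simp_all add: c0_def)
  have Z0: "Z \<ge> 0" using S0 c0 CT(1) M(1) tf by (simp add: Z_def)
  have main: "error_bound U h (h / r) uL uR tf (sqrt (3 * tf) * Z * h powr q)"
    if h: "0 < h" "h \<le> 1" "h / r \<le> 1"
      and sol: "scheme_solution ord h (h / r) (\<tau> h) (- \<tau> h) F f1 f2 uL uR" for h uL uR
  proof -
    define hR where "hR = h / r"
    have hR: "0 < hR" "hR \<le> 1" using h r by (simp_all add: hR_def)
    define \<tau>h where "\<tau>h = lam * tau_min ord h hR"
    have \<tau>h: "\<tau> h = \<tau>h" using tau[OF h(1)] by (simp add: \<tau>h_def hR_def)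
    have "tau_min ord h hR \<ge> 0"
      using h hR psd_shift_alpha(2)[OF ord] by (simp add: tau_min_def)
    then have stable: "\<tau>h \<ge> tau_min ord h hR"
      unfolding \<tau>h_def using mult_right_mono[OF lam_ge] by fastforce
    interpret symmetric_dissipative "scheme_mass ord h hR" grid_section "scheme_op ord h hR \<tau>h" "scheme_flux ord h hR"
      by (rule scheme_symmetric_dissipative[OF ord h(1) hR(1) stable])
    define x where "x = grid_point h hR"
    define w where "w = residual_weight ord lam h hR"
    define ex where "ex i = exp (- \<bar>x i\<bar>)" for i
    define tr where "tr = scheme_trunc ord h hR"
    have ex_w: "h ^ ord * ex i \<le> w i" for i
      using h by (simp add: w_def ex_def x_def residual_weight_def)
    have w_nonneg: "w i \<ge> 0" for i using residual_weight_nonneg[OF h(1)] by (simp add: w_def)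
    have w_sum: "sq_sum (scheme_mass ord h hR) (grid_section n) w \<le> (c0 * h powr q)\<^sup>2" for n
      unfolding power_mult_distrib c0(2) w_def
      by (rule residual_weight_sum[OF ord h(1,2) hR _ _ q']) (use r in \<open>simp_all add: hR_def\<close>)
    obtain W where "\<And>m. m \<in> Ms \<Longrightarrow> good m (C m) h (W m)"
      using C(2)[OF _ h] by metis
    then have W_bound: "\<bar>W m i\<bar> \<le> C m * w i" "\<bar>scheme_op ord h hR \<tau>h (W m) i + tr m i\<bar> \<le> C m * w i" if "m \<in> Ms" for m i
      using that unfolding good_def hR_def[symmetric] \<tau>h_def[symmetric] w_def tr_def by blast+
    define v where "v t i = U (x i) t" for t i
    define u where "u t = case_sum (uL t) (uR t)" for t
    obtain uLt uRt where ode: "\<forall>t\<ge>0. \<forall>j.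
           ((\<lambda>s. uL s j) has_real_derivative uLt t j) (at t within {0..}) \<and>
           ((\<lambda>s. uLt s j) has_real_derivative
              rhs_L ord h hR \<tau>h (uL t) (uR t) j + F (- real j * h) t) (at t within {0..}) \<and>
           ((\<lambda>s. uR s j) has_real_derivative uRt t j) (at t within {0..}) \<and>
           ((\<lambda>s. uRt s j) has_real_derivative
              rhs_R ord h hR (- \<tau>h) (uL t) (uR t) j + F (real j * hR) t) (at t within {0..})"
      and u_init: "\<forall>j. uL 0 j = f1 (- real j * h) \<and> uLt 0 j = f2 (- real j * h) \<and>
             uR 0 j = f1 (real j * hR) \<and> uRt 0 j = f2 (real j * hR)"
      using sol unfolding scheme_solution_def \<tau>h hR_def[symmetric] by (elim conjE exE) (rule that, assumption+)
    define u' where "u' t = case_sum (uLt t) (uRt t)" for t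
    have restrict: "(f has_real_derivative d) (at t within {0..tf})"
      if "\<And>t. t \<ge> 0 \<Longrightarrow> (f has_real_derivative g t) (at t within {0..})" "d = g t" "t \<in> {0..tf}" for f g d t
      unfolding that(2) by (rule DERIV_subset[OF that(1)]) (use that(3) in auto)
    have u_deriv: "((\<lambda>s. u s i) has_real_derivative u' t i) (at t within {0..})"
      "((\<lambda>s. u' s i) has_real_derivative scheme_op ord h hR \<tau>h (u t) i + F (x i) t) (at t within {0..})" if "t \<ge> 0" for t i
      using ode[rule_format, OF that] by (cases i; simp add: u_def u'_def scheme_op_def x_def grid_point_def)+
    obtain Ku where Ku: "\<And>t. t \<in> {0..tf} \<Longrightarrow> grid_l2 (uL t) \<and> grid_norm h (uL t) \<le> Ku \<and> grid_l2 (uR t) \<and> grid_norm hR (uR t) \<le> Ku"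
      using sol tf0 unfolding scheme_solution_def hR_def[symmetric] by blast
    have ex_sum: "sq_sum (scheme_mass ord h hR) (grid_section n) ex \<le> 6" for n
      unfolding ex_def x_def by (rule scheme_mass_exp_sum[OF h(1,2) hR])
    \<comment> \<open>This bound may depend on h and on the solution; it enters the energy estimate
      only through its finiteness.\<close>
    have bdd: "sq_sum (scheme_mass ord h hR) (grid_section n) (\<lambda>i. v t i - u t i) \<le> 2 * (M0\<^sup>2 * 6) + 2 * (4 * Ku\<^sup>2)"
      if t: "t \<in> {0..tf}" for t n
    proof -
      have "sq_sum (scheme_mass ord h hR) (grid_section n) (\<lambda>i. v t i + - u t i) \<le> 2 * (M0\<^sup>2 * 6) + 2 * (4 * Ku\<^sup>2)"
      proof (intro sum_mass_add sum_mass_mono[where w = ex] m_nonneg ex_sum)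
        show "\<bar>v t i\<bar> \<le> M0 * ex i" for i using M0(2)[OF t, of "x i"] by (simp add: v_def ex_def D(1))
        show "sq_sum (scheme_mass ord h hR) (grid_section n) (\<lambda>i. - u t i) \<le> 4 * Ku\<^sup>2"
          unfolding sum_grid_section scheme_mass_def u_def sum.case power2_minus
          using Ku[OF t] grid_norm_partial_sum[OF h(1), where v = "uL t" and ord = ord and n = "n + 4" and K = Ku]
            grid_norm_partial_sum[OF hR(1), where v = "uR t" and ord = ord and n = "n + 4" and K = Ku] by simp
      qed
      then show ?thesis by simp
    qed
    have trunc: "\<bar>scheme_op ord h hR \<tau>h (v t) i - D 2 (x i) t - (\<Sum>m\<in>Ms. D m 0 t * tr m i)\<bar> \<le> (CT * M) * w i"
      if t: "t \<in> {0..tf}" for t i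
    proof -
      have tower: "smooth_tower (\<lambda>m x. D m x t)" using D(3) t by (simp add: smooth_tower_def)
      have sumMs: "(\<Sum>m<ord + 2. D m 0 t * tr m i) = (\<Sum>m\<in>Ms. D m 0 t * tr m i)"
        by (rule sum.mono_neutral_right)
           (auto simp: Ms_def tr_def scheme_trunc_low_order[OF ord])
      have "\<bar>scheme_op ord h hR \<tau>h (v t) i - D 2 (x i) t - (\<Sum>m<ord + 2. D m 0 t * tr m i)\<bar> \<le> CT * M * h ^ ord * ex i"
        using CT(2)[rule_format, OF tower h M(2)[OF t], folded hR_def]
        by (simp add: v_def[abs_def] x_def tr_def ex_def D(1) del: add_2_eq_Suc')
      also have "\<dots> \<le> CT * M * w i"
        using mult_left_mono[OF ex_w[of i], of "CT * M"] CT(1) M(1) by (simp add: mult.assoc)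
      finally show ?thesis unfolding sumMs .
    qed
    have est: "sq_sum (scheme_mass ord h hR) (grid_section n) (\<lambda>i. v t i - u t i) \<le> (Z * h powr q)\<^sup>2"
      if t: "t \<in> {0..tf}" for t n
    proof -
      have "sq_sum (scheme_mass ord h hR) (grid_section n) (\<lambda>i. v t i - u t i)
          \<le> (2 * ((1 + 2 * tf * (1 + tf)) * (CT * M + 2 * (\<Sum>m\<in>Ms. A m * C m)) + (\<Sum>m\<in>Ms. A m * C m)) * (c0 * h powr q))\<^sup>2"
      proof (rule corrected_energy_estimate[where v' = "\<lambda>t i. Ut (x i) t" and v'' = "\<lambda>t i. D 2 (x i) t" and F = "\<lambda>t i. F (x i) t"
            and u' = u' and a = "\<lambda>m t. D m 0 t" and a' = a1 and a'' = a2 and W = W and tr = tr and w = w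
            and K = "2 * (M0\<^sup>2 * 6) + 2 * (4 * Ku\<^sup>2)"])
        show "finite Ms" by (simp add: Ms_def)
        show "sq_sum (scheme_mass ord h hR) (grid_section n) (\<lambda>i. v t i - u t i) \<le> 2 * (M0\<^sup>2 * 6) + 2 * (4 * Ku\<^sup>2)"
          if "t \<in> {0..tf}" for t n
          by (rule bdd[OF that])
        show "((\<lambda>s. v s i) has_real_derivative Ut (x i) t) (at t within {0..tf})" if "t \<in> {0..tf}" for t i
          unfolding v_def by (rule restrict[OF Ut(1) refl that])
        show "((\<lambda>s. Ut (x i) s) has_real_derivative D 2 (x i) t + F (x i) t) (at t within {0..tf})" if "t \<in> {0..tf}" for t i
          by (rule restrict[OF Ut(2) refl that])
        show "((\<lambda>s. u s i) has_real_derivative u' t i) (at t within {0..tf})" if "t \<in> {0..tf}" for t i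
          by (rule restrict[OF u_deriv(1) refl that])
        show "((\<lambda>s. u' s i) has_real_derivative scheme_op ord h hR \<tau>h (u t) i + F (x i) t) (at t within {0..tf})" if "t \<in> {0..tf}" for t i
          by (rule restrict[OF u_deriv(2) refl that])
        show "u 0 i = v 0 i" "u' 0 i = Ut (x i) 0" for i
          using u_init by (cases i; simp add: u_def u'_def v_def x_def grid_point_def U_init)+
        show "((\<lambda>t. D m 0 t) has_real_derivative a1 m t) (at t within {0..tf})" if "t \<in> {0..tf}" for t m
          by (rule restrict[OF a(2) refl that])
        show "(a1 m has_real_derivative a2 m t) (at t within {0..tf})" if "t \<in> {0..tf}" for t m
          by (rule restrict[OF a(3) refl that])
        show "finite_row (\<lambda>v. scheme_op ord h hR \<tau>h v i)" for i by (rule finite_row_scheme_op)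
      qed (use tf0 a(4) W_bound trunc C(1) CT(1) M(1) w_nonneg c0(1) w_sum t in auto)
      then show ?thesis by (simp add: Z_def S_def mult.assoc)
    qed
    have err: "(case i of Inl j \<Rightarrow> err_L U h uL t j | Inr j \<Rightarrow> err_R U hR uR t j) = v t i - u t i" for t i
      by (cases i) (simp_all add: err_L_def err_R_def v_def u_def x_def grid_point_def)
    have cont: "continuous_on {0..tf} (\<lambda>t. v t i - u t i)" for i
      unfolding v_def
      by (intro continuous_on_diff DERIV_continuous_on[OF restrict[OF Ut(1) refl]] DERIV_continuous_on[OF restrict[OF u_deriv(1) refl]])
    show "error_bound U h (h / r) uL uR tf (sqrt (3 * tf) * Z * h powr q)"
      unfolding hR_def[symmetric]
    proof (rule error_boundI[OF h(1) hR(1) tf])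
      show "continuous_on {0..tf} (\<lambda>t. err_L U h uL t j)" for j using cont[of "Inl j"] err[where i = "Inl j"] by simp
      show "continuous_on {0..tf} (\<lambda>t. err_R U hR uR t j)" for j using cont[of "Inr j"] err[where i = "Inr j"] by simp
      show "(\<Sum>i\<in>grid_section n. scheme_mass ord h hR i *
        (case i of Inl j \<Rightarrow> err_L U h uL t j | Inr j \<Rightarrow> err_R U hR uR t j)\<^sup>2) \<le> (Z * h powr q)\<^sup>2" if "t \<in> {0..tf}" for t n
        unfolding err by (rule est[OF that])
      have "sqrt (tf * (3 * (Z * h powr q)\<^sup>2)) = sqrt (3 * tf * (Z * h powr q)\<^sup>2)" by (simp add: mult_ac)
      also have "\<dots> = sqrt (3 * tf) * (Z * h powr q)"
        using Z0 by (simp add: real_sqrt_mult)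
      finally show "sqrt (tf * (3 * (Z * h powr q)\<^sup>2)) \<le> sqrt (3 * tf) * Z * h powr q" by simp
    qed simp
  qed
  have "\<forall>\<^sub>F h in at_right 0. 0 < h \<and> h \<le> 1 \<and> h / r \<le> 1"
    unfolding eventually_at_right_field by (rule exI[of _ "min 1 r"]) (use r in \<open>auto simp: divide_le_eq\<close>)
  then show ?thesis
    by (intro exI[of _ "sqrt (3 * tf) * Z"]) (erule eventually_mono, intro allI impI, elim conjE, rule main)
qed

end
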